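(* Let $\{Y_t\}$ be the stationary and ergodic Poisson INARCH(1) process: conditionally on $\mathcal I_{t-1}=\sigma\{Y_s:s\le t-1\}$, $Y_t$ has the Poisson distribution with mean $\lambda_t=\theta_{10}+\theta_{20}Y_{t-1}$, where the true parameters satisfy $\theta_{10}>0$ and $\theta_{20}\in[0,1)$. Assume that the estimators $\widehat\theta_{1T},\widehat\theta_{2T}$ satisfy, as $T\to\infty$, $$\sqrt T(\widehat\theta_{jT}-\theta_{j0})=\frac1{\sqrt T}\sum_{t=q+1}^T\ell_j(\mathbf Y_{t-q};\theta_{10},\theta_{20})+o_P(1),\qquad j=1,2,$$ where $q\ge1$ is fixed, $\mathbf Y_{t-q}=(Y_t,\dots,Y_{t-q})'$, and for $j=1,2$ the sequence $\{\ell_j(\mathbf Y_{t-q};\theta_{10},\theta_{20})\}_{t\ge q+1}$ is a martingale difference sequence (with respect to $\mathcal I_t$) with finite variances. Assume also that the nonnegative weight function $w$ satisfies $$\mathbb E\left(\int_0^1\Big[1+\exp\{2(\theta_{10}+\theta_{20}Y_1)(u-1)\}(1+Y_1^4)\Big]w(u)\,du\right)<\infty .$$ Let $S_T$ be the test statistic defined in the context, and for $t\ge q+1$, $u\in[0,1]$ let $$\mathcal V_t(u;\theta_{10},\theta_{20})=V_t(u;\theta_{10},\theta_{20})+r_1(u;\theta_{10},\theta_{20})\,\ell_1(\mathbf Y_{t-q};\theta_{10},\theta_{20})+r_2(u;\theta_{10},\theta_{20})\,\ell_2(\mathbf Y_{t-q};\theta_{10},\theta_{20}),$$ with $V_t,r_1,r_2$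 as in the context, and $\bar{\mathcal V}_T(u;\theta_{10},\theta_{20})=\frac1{\sqrt T}\sum_{t=q+1}^T\mathcal V_t(u;\theta_{10},\theta_{20})$. Then, as $T\to\infty$: (i) the limit distribution of $S_T$ is the same as that of $\int_0^1\bar{\mathcal V}_T^2(u;\theta_{10},\theta_{20})\,w(u)\,du$; (ii) the process $\{\bar{\mathcal V}_T(u;\theta_{10},\theta_{20}):u\in[0,1]\}$ converges in distribution to a zero-mean Gaussian process $\{\mathcal V(u;\theta_{10},\theta_{20}):u\in[0,1]\}$ with covariance function $\mathbb E\big[\mathcal V_{q+1}(u_1;\theta_{10},\theta_{20})\mathcal V_{q+1}(u_2;\theta_{10},\theta_{20})\big]$, $u_1,u_2\in[0,1]$; (iii) $S_T$ converges in distribution to $\int_0^1\mathcal V^2(u;\theta_{10},\theta_{20})\,w(u)\,du$.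
   Context: $\{Y_t\}$ is a sequence of nonnegative integer-valued random variables, taken to be the strictly stationary and ergodic solution of the stated model. Test statistic: given observations $Y_1,\dots,Y_T$ and an estimator $(\widehat\theta_{1T},\widehat\theta_{2T})'$ of $(\theta_{10},\theta_{20})'$ computed from them, let (with $0^0=1$) $$\widehat g_{T,Y}(u)=\frac1T\sum_{t=1}^Tu^{Y_t},\qquad \widehat g_{T0}(u)=e^{\widehat\theta_{1T}(u-1)}\,\widehat g_{T,Y}\big(e^{\widehat\theta_{2T}(u-1)}\big),$$ $$S_T=T\int_0^1\big(\widehat g_{T,Y}(u)-\widehat g_{T0}(u)\big)^2w(u)\,du,$$ where $w\ge0$ is a measurable weight function on $[0,1]$. Auxiliary quantities: for $t\ge2$, $$V_t(u;\theta_1,\theta_2)=u^{Y_t}-\exp\{(\theta_1+\theta_2Y_{t-1})(u-1)\},$$ $$r_1(u;\theta_1,\theta_2)=\mathbb E\big[\exp\{(\theta_1+\theta_2Y_1)(u-1)\}(u-1)\big],$$ $$r_2(u;\theta_1,\theta_2)=\mathbb E\big[Y_1\exp\{(\theta_1+\theta_2Y_1)(u-1)\}(u-1)\big].$$ "The limit distribution of $S_T$ is the same as that of $X_T$" means that $S_T$ and $X_T$ converge in distribution to the same limit. Convergence in distribution of processes indexed by $[0,1]$ is understood in $\mathcal C[0,1]$, the space of continuous functions on $[0,1]$ with the supremum norm.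
   Formalization: The process is taken as V_t − r_1 ℓ_1 − r_2 ℓ_2 instead of V_t + r_1 ℓ_1 + r_2 ℓ_2; with plus signs (i) and (iii) fail, e.g. for iid Poisson Y_t (θ_20 = 0) with the sample mean as first estimator, 0 as second, and w = 1. *)

theory Defs
  imports "HOL-Probability.Probability"
begin

section \<open>Processes indexed by the integers\<close>

definition past :: "'a measure \<Rightarrow> (int \<Rightarrow> 'a \<Rightarrow> nat) \<Rightarrow> int \<Rightarrow> 'a measure" where
  "past M Y t = sigma (space M) {Y s -` A \<inter> space M | s A. s \<le> t}"

abbreviation seq_space :: "(int \<Rightarrow> nat) measure" where
  "seq_space \<equiv> PiM UNIV (\<lambda>_. count_space UNIV)"

definition strictly_stationary :: "'a measure \<Rightarrow> (int \<Rightarrow> 'a \<Rightarrow> nat) \<Rightarrow> bool" where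
  "strictly_stationary M Y \<longleftrightarrow>
     (\<forall>k::int. distr M seq_space (\<lambda>\<omega> t. Y (t + k) \<omega>) = distr M seq_space (\<lambda>\<omega> t. Y t \<omega>))"

definition ergodic_process :: "'a measure \<Rightarrow> (int \<Rightarrow> 'a \<Rightarrow> nat) \<Rightarrow> bool" where
  "ergodic_process M Y \<longleftrightarrow>
     (\<forall>A \<in> sets seq_space. (\<lambda>y t. y (t + 1)) -` A = A \<longrightarrow>
        measure M {\<omega> \<in> space M. (\<lambda>t. Y t \<omega>) \<in> A} \<in> {0, 1})"

definition poisson_inarch1 :: "'a measure \<Rightarrow> (int \<Rightarrow> 'a \<Rightarrow> nat) \<Rightarrow> real \<Rightarrow> real \<Rightarrow> bool" where
  "poisson_inarch1 M Y \<theta>1 \<theta>2 \<longleftrightarrow>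
     (\<forall>t. Y t \<in> M \<rightarrow>\<^sub>M count_space UNIV) \<and>
     (\<forall>t k. AE \<omega> in M.
        real_cond_exp M (past M Y (t - 1)) (indicator {\<omega> \<in> space M. Y t \<omega> = k}) \<omega>
          = pmf (poisson_pmf (\<theta>1 + \<theta>2 * real (Y (t - 1) \<omega>))) k)"

definition martingale_difference_from ::
    "'a measure \<Rightarrow> (int \<Rightarrow> 'a measure) \<Rightarrow> int \<Rightarrow> (int \<Rightarrow> 'a \<Rightarrow> real) \<Rightarrow> bool" where
  "martingale_difference_from M F t0 X \<longleftrightarrow>
     (\<forall>t\<ge>t0. X t \<in> borel_measurable (F t) \<and> integrable M (X t) \<and>
        (AE \<omega> in M. real_cond_exp M (F (t - 1)) (X t) \<omega> = 0))"


section \<open>Modes of convergence\<close>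

definition is_o_P_1 :: "'a measure \<Rightarrow> (nat \<Rightarrow> 'a \<Rightarrow> real) \<Rightarrow> bool" where
  "is_o_P_1 M R \<longleftrightarrow>
     (\<forall>e>0. (\<lambda>T. measure M {\<omega> \<in> space M. \<bar>R T \<omega>\<bar> > e}) \<longlonglongrightarrow> 0)"

text \<open>The measurability requirements in the next two definitions exclude the junk values that
  \<^const>\<open>distr\<close> and the Bochner integral take at non-measurable functions.\<close>

definition conv_in_dist_real ::
    "'a measure \<Rightarrow> (nat \<Rightarrow> 'a \<Rightarrow> real) \<Rightarrow> real measure \<Rightarrow> bool" where
  "conv_in_dist_real M X \<mu> \<longleftrightarrow>
     (\<forall>T. X T \<in> borel_measurable M) \<and> real_distribution \<mu> \<and>
     weak_conv_m (\<lambda>T. distr M borel (X T)) \<mu>"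

definition borel_of :: "'c topology \<Rightarrow> 'c measure" where
  "borel_of S = sigma (topspace S) {U. openin S U}"

definition conv_in_dist_top ::
    "'c topology \<Rightarrow> 'a measure \<Rightarrow> (nat \<Rightarrow> 'a \<Rightarrow> 'c) \<Rightarrow> 'b measure \<Rightarrow> ('b \<Rightarrow> 'c) \<Rightarrow> bool" where
  "conv_in_dist_top S M X N X0 \<longleftrightarrow>
     (\<forall>T. X T \<in> M \<rightarrow>\<^sub>M borel_of S) \<and> X0 \<in> N \<rightarrow>\<^sub>M borel_of S \<and>
     (\<forall>F. continuous_map S euclideanreal F \<and> bounded (F ` topspace S) \<longrightarrow>
        (\<lambda>T. \<integral>\<omega>. F (X T \<omega>) \<partial>M) \<longlonglongrightarrow> (\<integral>\<omega>. F (X0 \<omega>) \<partial>N))"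

text \<open>The elements of \<^const>\<open>cfunspace\<close> are extensional, so the path \<open>f\<close> on the unit
  interval is represented by \<open>restrict f {0..1}\<close>.\<close>

definition C01 :: "(real \<Rightarrow> real) topology" where
  "C01 = mtopology_of (cfunspace (top_of_set {0..1}) euclidean_metric)"

definition conv_in_dist_C01 ::
    "'a measure \<Rightarrow> (nat \<Rightarrow> real \<Rightarrow> 'a \<Rightarrow> real) \<Rightarrow> 'b measure \<Rightarrow> (real \<Rightarrow> 'b \<Rightarrow> real) \<Rightarrow> bool" where
  "conv_in_dist_C01 M X N X0 \<longleftrightarrow>
     conv_in_dist_top C01 M (\<lambda>T \<omega>. restrict (\<lambda>u. X T u \<omega>) {0..1})
                          N (\<lambda>\<omega>. restrict (\<lambda>u. X0 u \<omega>) {0..1})"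


section \<open>Gaussian processes\<close>

definition normal_law :: "real \<Rightarrow> real \<Rightarrow> real measure" where
  "normal_law m \<sigma> =
     (if \<sigma> = 0 then return borel m else density lborel (\<lambda>x. ennreal (normal_density m \<sigma> x)))"

definition gaussian_process :: "'b measure \<Rightarrow> 'i set \<Rightarrow> ('i \<Rightarrow> 'b \<Rightarrow> real) \<Rightarrow> bool" where
  "gaussian_process N I X \<longleftrightarrow>
     (\<forall>i\<in>I. X i \<in> borel_measurable N) \<and>
     (\<forall>J c. finite J \<and> J \<subseteq> I \<longrightarrow>
        (\<exists>m. \<exists>\<sigma>\<ge>0. distr N borel (\<lambda>\<omega>. \<Sum>i\<in>J. c i * X i \<omega>) = normal_law m \<sigma>))"


section \<open>The test statistic\<close>

text \<open>An estimator is a function of the list of observations; the sample size is the length of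
  the list.\<close>

definition obs :: "(int \<Rightarrow> 'a \<Rightarrow> nat) \<Rightarrow> nat \<Rightarrow> 'a \<Rightarrow> nat list" where
  "obs Y T \<omega> = map (\<lambda>t. Y t \<omega>) [1..int T]"

definition emp_pgf :: "(int \<Rightarrow> 'a \<Rightarrow> nat) \<Rightarrow> nat \<Rightarrow> real \<Rightarrow> 'a \<Rightarrow> real" where
  "emp_pgf Y T u \<omega> = (1 / real T) * (\<Sum>t = 1..int T. u ^ Y t \<omega>)"

definition est_pgf :: "(nat list \<Rightarrow> real) \<Rightarrow> (nat list \<Rightarrow> real) \<Rightarrow>
    (int \<Rightarrow> 'a \<Rightarrow> nat) \<Rightarrow> nat \<Rightarrow> real \<Rightarrow> 'a \<Rightarrow> real" where
  "est_pgf est1 est2 Y T u \<omega> =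
     exp (est1 (obs Y T \<omega>) * (u - 1)) * emp_pgf Y T (exp (est2 (obs Y T \<omega>) * (u - 1))) \<omega>"

definition test_stat :: "(nat list \<Rightarrow> real) \<Rightarrow> (nat list \<Rightarrow> real) \<Rightarrow> (real \<Rightarrow> real) \<Rightarrow>
    (int \<Rightarrow> 'a \<Rightarrow> nat) \<Rightarrow> nat \<Rightarrow> 'a \<Rightarrow> real" where
  "test_stat est1 est2 w Y T \<omega> =
     real T * (LINT u|lebesgue_on {0..1}. (emp_pgf Y T u \<omega> - est_pgf est1 est2 Y T u \<omega>)\<^sup>2 * w u)"


section \<open>The approximating process\<close>

definition V_proc :: "(int \<Rightarrow> 'a \<Rightarrow> nat) \<Rightarrow> real \<Rightarrow> real \<Rightarrow> int \<Rightarrow> real \<Rightarrow> 'a \<Rightarrow> real" where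
  "V_proc Y \<theta>1 \<theta>2 t u \<omega> =
     u ^ Y t \<omega> - exp ((\<theta>1 + \<theta>2 * real (Y (t - 1) \<omega>)) * (u - 1))"

definition r1 :: "'a measure \<Rightarrow> (int \<Rightarrow> 'a \<Rightarrow> nat) \<Rightarrow> real \<Rightarrow> real \<Rightarrow> real \<Rightarrow> real" where
  "r1 M Y \<theta>1 \<theta>2 u = (\<integral>\<omega>. exp ((\<theta>1 + \<theta>2 * real (Y 1 \<omega>)) * (u - 1)) * (u - 1) \<partial>M)"

definition r2 :: "'a measure \<Rightarrow> (int \<Rightarrow> 'a \<Rightarrow> nat) \<Rightarrow> real \<Rightarrow> real \<Rightarrow> real \<Rightarrow> real" where
  "r2 M Y \<theta>1 \<theta>2 u =
     (\<integral>\<omega>. real (Y 1 \<omega>) * exp ((\<theta>1 + \<theta>2 * real (Y 1 \<omega>)) * (u - 1)) * (u - 1) \<partial>M)"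

definition lag_vec :: "(int \<Rightarrow> 'a \<Rightarrow> nat) \<Rightarrow> nat \<Rightarrow> int \<Rightarrow> 'a \<Rightarrow> nat list" where
  "lag_vec Y q t \<omega> = map (\<lambda>i. Y (t - int i) \<omega>) [0..<Suc q]"

text \<open>The estimation terms enter with a minus sign: \<open>r1\<close> and \<open>r2\<close> are the means of the
  derivatives of \<open>exp ((\<theta>1 + \<theta>2 * Y 1) * (u - 1))\<close> with respect to \<open>\<theta>1\<close> and \<open>\<theta>2\<close>, and the
  estimated function is subtracted in the statistic, so the expansion of
  \<open>sqrt T * (emp_pgf - est_pgf)\<close> around the true parameter is the normalised sum of
  \<open>V - r1 * l1 - r2 * l2\<close>.  The source writes \<open>V + r1 * l1 + r2 * l2\<close>.  With that sign the limit
  of the statistic would be wrong already for independent Poisson variables with mean \<open>\<theta>1\<close>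
  (\<open>\<theta>2 = 0\<close>), sample mean as first and constant 0 as second estimator, and \<open>w = 1\<close>: there
  \<open>V - r1 * l1\<close> and \<open>r1 * l1\<close> are uncorrelated, so \<open>V + r1 * l1\<close> has at each \<open>u < 1\<close> a variance
  larger by \<open>4 * \<theta>1 * r1\<^sup>2\<close>.\<close>

definition calV :: "'a measure \<Rightarrow> (int \<Rightarrow> 'a \<Rightarrow> nat) \<Rightarrow> nat \<Rightarrow>
    (nat list \<Rightarrow> real \<Rightarrow> real \<Rightarrow> real) \<Rightarrow> (nat list \<Rightarrow> real \<Rightarrow> real \<Rightarrow> real) \<Rightarrow>
    real \<Rightarrow> real \<Rightarrow> int \<Rightarrow> real \<Rightarrow> 'a \<Rightarrow> real" where
  "calV M Y q l1 l2 \<theta>1 \<theta>2 t u \<omega> =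
     V_proc Y \<theta>1 \<theta>2 t u \<omega>
       - r1 M Y \<theta>1 \<theta>2 u * l1 (lag_vec Y q t \<omega>) \<theta>1 \<theta>2
       - r2 M Y \<theta>1 \<theta>2 u * l2 (lag_vec Y q t \<omega>) \<theta>1 \<theta>2"

definition calV_bar :: "'a measure \<Rightarrow> (int \<Rightarrow> 'a \<Rightarrow> nat) \<Rightarrow> nat \<Rightarrow>
    (nat list \<Rightarrow> real \<Rightarrow> real \<Rightarrow> real) \<Rightarrow> (nat list \<Rightarrow> real \<Rightarrow> real \<Rightarrow> real) \<Rightarrow>
    real \<Rightarrow> real \<Rightarrow> nat \<Rightarrow> real \<Rightarrow> 'a \<Rightarrow> real" where
  "calV_bar M Y q l1 l2 \<theta>1 \<theta>2 T u \<omega> =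
     (1 / sqrt (real T)) * (\<Sum>t = int q + 1..int T. calV M Y q l1 l2 \<theta>1 \<theta>2 t u \<omega>)"

text \<open>Asymptotic linearity of an estimator \<open>est\<close> of \<open>\<theta>\<close> with summands \<open>L t\<close>.\<close>

definition asymp_linear :: "'a measure \<Rightarrow> (int \<Rightarrow> 'a \<Rightarrow> nat) \<Rightarrow> nat \<Rightarrow>
    (nat list \<Rightarrow> real) \<Rightarrow> real \<Rightarrow> (int \<Rightarrow> 'a \<Rightarrow> real) \<Rightarrow> bool" where
  "asymp_linear M Y q est \<theta> L \<longleftrightarrow>
     is_o_P_1 M (\<lambda>T \<omega>. sqrt (real T) * (est (obs Y T \<omega>) - \<theta>)
                      - (1 / sqrt (real T)) * (\<Sum>t = int q + 1..int T. L t \<omega>))"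

end

theory Submission
  imports Defs
begin

text \<open>
  Expand the process in powers of \<open>u\<close>.  With \<open>D 0, D 1\<close> the two estimation terms and
  \<open>D (k + 2)\<close> the indicator of \<open>Y t = k\<close> minus its conditional probability, each summand of the
  process is \<open>\<Sum>k. \<phi> k u * D k\<close> with \<open>\<phi> 0 = - r1\<close>, \<open>\<phi> 1 = - r2\<close>, \<open>\<phi> (k + 2) u = u ^ k\<close>.
  A truncated drift inequality gives exponential moments of \<open>Y\<close>, so the variances of the \<open>D k\<close>
  decay geometrically.  Hence the coefficient sequences of the normalised sums stay, up to small
  probability, in a compact box of \<open>nat \<Rightarrow> real\<close> with geometrically decaying sides, on which
  summing the series is continuous into \<open>C[0,1]\<close>.  On the box, Stone-Weierstrass reduces convergence in
  distribution to characteristic functions of finite linear combinations.  These converge by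
  McLeish's argument for martingale differences, whose law of large numbers for the squares is the
  ergodic theorem, proved in turn with the maximal sums of Katznelson and Weiss.  The limit is the
  series with Gaussian coefficients obtained by Gram-Schmidt.

  For the statistic, a second-order expansion in the parameters has a remainder that tends to zero
  in probability uniformly in \<open>u\<close>: the averages in the linear terms converge uniformly because the
  empirical probabilities of the values of \<open>Y\<close> converge in the norm weighted by \<open>k + 1\<close>, and the
  exponential factors are controlled by \<open>Y t \<le> sqrt T * sqrt (\<Sum>s\<le>T. (Y s)\<^sup>2 / T)\<close>.
\<close>

section \<open>The ergodic theorem\<close>

text \<open>The obstacle is convergence in C[0,1]. Working with coefficients replaces estimates of
  path increments by second moments: the summands \<open>inc k (sh t \<omega>)\<close> are
  orthogonal in t, so the variance of a normalised sum is at most that of one summand, for every T.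
  The variances are bounded by a multiple of \<open>\<rho> ^ (4 * k)\<close> and the box has sides
  \<open>R * \<rho> ^ k\<close>; Chebyshev then leaves \<open>\<rho> ^ (2 * k)\<close>, summable
  over k, and the sides are summable as well. The Gaussian coefficients have the same variances and
  meet the same box. McLeish's product suits the model because products of
  \<open>1 + \<i> * X\<close> over martingale differences have mean one by orthogonality alone; what
  remains random is the sum of squares, and ergodicity makes its limit a constant. The drift
  inequality is truncated because half of a moment cannot be subtracted before that moment is known
  to be finite. The statistic and the process are compared path by path: their distance on [0,1] is
  bounded by one random variable free of u, so integrating against w multiplies the error by the
  integral of w.\<close>

primrec max_sum :: "('a \<Rightarrow> 'a) \<Rightarrow> ('a \<Rightarrow> real) \<Rightarrow> nat \<Rightarrow> 'a \<Rightarrow> real" where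
  "max_sum T f 0 = (\<lambda>x. 0)"
| "max_sum T f (Suc n) = (\<lambda>x. max 0 (f x + max_sum T f n (T x)))"

lemma max_sum_nonneg: "0 \<le> max_sum T f n x"
  by (cases n) auto

lemma max_sum_mono: "max_sum T f n x \<le> max_sum T f (Suc n) x"
proof (induction n arbitrary: x)
  case (Suc n)
  from Suc[of "T x"] show ?case
    unfolding max_sum.simps(2)[of T f "Suc n"] max_sum.simps(2)[of T f n]
    by (intro max.mono add_left_mono) auto
qed simp

text \<open>\<open>max_sum T f n x\<close> is the largest of the sums of \<open>f\<close> over the
  first m points of the orbit, m at most n, the empty sum included; the recursion peels off the
  first point.\<close>

lemma birkhoff_sum_le_max_sum: "(\<Sum>i<n. f ((T ^^ i) x)) \<le> max_sum T f n x"
proof (induction n arbitrary: x)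
  case (Suc n)
  have "(\<Sum>i<Suc n. f ((T ^^ i) x)) = f x + (\<Sum>i<n. f ((T ^^ i) (T x)))"
    by (subst sum.lessThan_Suc_shift) (simp add: funpow_swap1)
  with Suc[of "T x"] show ?case by simp
qed simp

locale ergodic_transformation = prob_space Q for Q :: "'a measure" +
  fixes T :: "'a \<Rightarrow> 'a"
  assumes T_meas [measurable]: "T \<in> Q \<rightarrow>\<^sub>M Q"
    and T_preserves: "distr Q Q T = Q"
    and T_ergodic: "\<And>A. A \<in> sets Q \<Longrightarrow> T -` A \<inter> space Q = A \<Longrightarrow> prob A = 0 \<or> prob A = 1"
begin

lemma integrable_T: "integrable Q f \<Longrightarrow> integrable Q (\<lambda>x. f (T x))" for f :: "'a \<Rightarrow> real"
  using integrable_distr[OF T_meas, of f] T_preserves by simp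

lemma integral_T: 
  fixes f :: "'a \<Rightarrow> real"
  assumes [measurable]: "f \<in> borel_measurable Q"
  shows "(\<integral>x. f (T x) \<partial>Q) = (\<integral>x. f x \<partial>Q)"
  using integral_distr[OF T_meas assms] T_preserves by simp

lemma max_sum_measurable [measurable]:
  "f \<in> borel_measurable Q \<Longrightarrow> max_sum T f n \<in> borel_measurable Q"
  by (induction n) simp_all

lemma integrable_max_sum: "integrable Q f \<Longrightarrow> integrable Q (max_sum T f n)"
proof (induction n)
  case (Suc n)
  then have "integrable Q (\<lambda>x. max 0 (f x + max_sum T f n (T x)))"
    using integrable_T[of "max_sum T f n"]
    by (intro integrable_max Bochner_Integration.integrable_add) auto
  then show ?case by simp
qed simp

text \<open>On the event where the maximal sums diverge, which is invariant, the nonnegative mean of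
  \<open>max_sum (n + 1) - max_sum n \<circ> T\<close> converges to the mean of \<open>f\<close>.\<close>

lemma AE_max_sum_bounded:
  assumes f: "integrable Q f" and neg: "(\<integral>x. f x \<partial>Q) < 0"
  shows "AE x in Q. \<exists>B. \<forall>n. max_sum T f n x \<le> B"
proof -
  have [measurable]: "f \<in> borel_measurable Q" using f by auto
  define A where "A = {x \<in> space Q. \<forall>B::nat. \<exists>n. max_sum T f n x > B}"
  have A[measurable]: "A \<in> sets Q" unfolding A_def by measurable
  \<comment> \<open>Passing from x to \<open>T x\<close> changes the maximal sums by
    \<open>f x\<close> and one index, apart from the cut at 0, so divergence is invariant at every
    point and not just almost everywhere, as \<open>T_ergodic\<close> demands.\<close>
  have inv: "(\<forall>B::nat. \<exists>n. max_sum T f n (T x) > B) \<longleftrightarrow> (\<forall>B::nat. \<exists>n. max_sum T f n x > B)" for x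
  proof safe
    fix B :: nat assume *: "\<forall>B::nat. \<exists>n. max_sum T f n (T x) > B"
    obtain B' :: nat where "B' \<ge> B - f x" using real_nat_ceiling_ge by blast
    with * obtain n where "max_sum T f n (T x) > B - f x" by (meson order_le_less_trans)
    then show "\<exists>n. max_sum T f n x > B" by (intro exI[of _ "Suc n"]) auto
  next
    fix B :: nat assume *: "\<forall>B::nat. \<exists>n. max_sum T f n x > B"
    obtain B' :: nat where B': "B' \<ge> max 0 (B + f x)" using real_nat_ceiling_ge by blast
    with * obtain n where n: "max_sum T f n x > B'" by blast
    show "\<exists>n. max_sum T f n (T x) > B"
      using n B' by (cases n) (auto intro!: exI[of _ "n - 1"])
  qed
  have "T -` A \<inter> space Q = A" unfolding A_def using inv measurable_space[OF T_meas] by auto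
  with T_ergodic[OF A] have "prob A = 0 \<or> prob A = 1" by blast
  moreover have "prob A \<noteq> 1"
  proof
    assume "prob A = 1"
    then have AE: "AE x in Q. x \<in> A" using AE_in_set_eq_1[OF A] by simp
    have "(\<lambda>n. \<integral>x. max_sum T f (Suc n) x - max_sum T f n (T x) \<partial>Q) \<longlonglongrightarrow> (\<integral>x. f x \<partial>Q)"
    proof (rule integral_dominated_convergence[where w = "\<lambda>x. \<bar>f x\<bar>"])
      show "AE x in Q. (\<lambda>n. max_sum T f (Suc n) x - max_sum T f n (T x)) \<longlonglongrightarrow> f x"
        using AE
      proof eventually_elim
        fix x assume "x \<in> A"
        then have "\<forall>B::nat. \<exists>n. max_sum T f n (T x) > B" using inv unfolding A_def by auto
        moreover obtain B :: nat where "B \<ge> - f x" using real_nat_ceiling_ge by blast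
        ultimately obtain n where n: "max_sum T f n (T x) > - f x" by (meson order_le_less_trans)
        have "max_sum T f (Suc m) x - max_sum T f m (T x) = f x" if "m \<ge> n" for m
        proof -
          have "max_sum T f n (T x) \<le> max_sum T f m (T x)"
            by (rule lift_Suc_mono_le[OF _ that]) (rule max_sum_mono)
          with n show ?thesis by simp
        qed
        then show "(\<lambda>n. max_sum T f (Suc n) x - max_sum T f n (T x)) \<longlonglongrightarrow> f x"
          by (intro tendsto_eventually eventually_sequentiallyI) auto
      qed
      \<comment> \<open>The difference is the larger of \<open>f x\<close> and
        \<open>- max_sum T f n (T x)\<close>. The second value is at most 0 and is attained only
        when it lies above \<open>f x\<close>, so the difference is either \<open>f x\<close> or
        between \<open>f x\<close> and 0.\<close>
      show "AE x in Q. norm (max_sum T f (Suc n) x - max_sum T f n (T x)) \<le> \<bar>f x\<bar>" for n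
        by (rule AE_I2) (use max_sum_nonneg[of T f n] in \<open>auto simp: max_def abs_if intro: order_trans[OF less_imp_le]\<close>)
    qed (use f in auto)
    moreover have "0 \<le> (\<integral>x. max_sum T f (Suc n) x - max_sum T f n (T x) \<partial>Q)" for n
    proof -
      have "(\<integral>x. max_sum T f (Suc n) x - max_sum T f n (T x) \<partial>Q)
        = (\<integral>x. max_sum T f (Suc n) x \<partial>Q) - (\<integral>x. max_sum T f n x \<partial>Q)"
        using integrable_max_sum[OF f] integrable_T[OF integrable_max_sum[OF f]]
        by (simp del: max_sum.simps add: integral_T)
      also have "\<dots> \<ge> 0"
        using integral_mono[OF integrable_max_sum[OF f] integrable_max_sum[OF f] max_sum_mono]
        by (simp del: max_sum.simps)
      finally show ?thesis .
    qed
    ultimately have "0 \<le> (\<integral>x. f x \<partial>Q)"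
      by (intro LIMSEQ_le_const[of _ "\<integral>x. f x \<partial>Q" 0]) auto
    with neg show False by simp
  qed
  ultimately have "AE x in Q. x \<notin> A" using prob_eq_0[OF A] by blast
  then show ?thesis
    by (rule AE_mp) (rule AE_I2, auto simp: A_def not_less)
qed

text \<open>The function \<open>f - c\<close> has negative mean, so its maximal sums are bounded
  along almost every orbit: the sums of \<open>f\<close> exceed \<open>c * n\<close> by at most a
  constant, which division by n removes.\<close>

lemma AE_birkhoff_average_le:
  assumes f: "integrable Q f" and "c > (\<integral>x. f x \<partial>Q)"
  shows "AE x in Q. \<forall>e>0. \<forall>\<^sub>F n in sequentially. (\<Sum>i<n. f ((T ^^ i) x)) / real n \<le> c + e"
proof -
  have "(\<integral>x. f x - c \<partial>Q) < 0" using f assms(2) prob_space by simp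
  then have "AE x in Q. \<exists>B. \<forall>n. max_sum T (\<lambda>x. f x - c) n x \<le> B"
    using f by (intro AE_max_sum_bounded) auto
  then show ?thesis
  proof eventually_elim
    fix x assume "\<exists>B. \<forall>n. max_sum T (\<lambda>x. f x - c) n x \<le> B"
    then obtain B where B: "\<And>n. (\<Sum>i<n. f ((T ^^ i) x) - c) \<le> B"
      using birkhoff_sum_le_max_sum[where T = T and f = "\<lambda>x. f x - c" and x = x]
      by (meson order_trans)
    show "\<forall>e>0. \<forall>\<^sub>F n in sequentially. (\<Sum>i<n. f ((T ^^ i) x)) / real n \<le> c + e"
    proof safe
      fix e :: real assume e: "e > 0"
      show "\<forall>\<^sub>F n in sequentially. (\<Sum>i<n. f ((T ^^ i) x)) / real n \<le> c + e"
      proof (rule eventually_sequentiallyI[of "Suc (nat \<lceil>\<bar>B\<bar> / e\<rceil>)"])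
        fix n assume n: "n \<ge> Suc (nat \<lceil>\<bar>B\<bar> / e\<rceil>)"
        then have "real n \<ge> \<bar>B\<bar> / e" "n > 0" by linarith+
        then have "B \<le> e * real n" using e by (simp add: field_simps)
        with B[of n] \<open>n > 0\<close> show "(\<Sum>i<n. f ((T ^^ i) x)) / real n \<le> c + e"
          by (simp add: sum_subtractf field_simps)
      qed
    qed
  qed
qed

text \<open>The one-sided estimate needs c strictly above the mean; it is used for the countably
  many values mean + 1/(m+1), and for \<open>- f\<close> to obtain the lower bound.\<close>

theorem AE_birkhoff_average:
  assumes f: "integrable Q f"
  shows "AE x in Q. (\<lambda>n. (\<Sum>i<n. f ((T ^^ i) x)) / real n) \<longlonglongrightarrow> (\<integral>x. f x \<partial>Q)"
proof -
  have 1: "AE x in Q. \<forall>m. \<forall>e>0. \<forall>\<^sub>F n in sequentially.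
      (\<Sum>i<n. f ((T ^^ i) x)) / real n \<le> ((\<integral>x. f x \<partial>Q) + 1 / real (Suc m)) + e"
    by (intro AE_all_countable[THEN iffD2] allI AE_birkhoff_average_le f) simp
  have 2: "AE x in Q. \<forall>m. \<forall>e>0. \<forall>\<^sub>F n in sequentially.
      (\<Sum>i<n. - f ((T ^^ i) x)) / real n \<le> ((\<integral>x. - f x \<partial>Q) + 1 / real (Suc m)) + e"
    by (intro AE_all_countable[THEN iffD2] allI AE_birkhoff_average_le Bochner_Integration.integrable_minus f) simp
  from 1 2 show ?thesis
  proof eventually_elim
    case (elim x)
    show ?case
    proof (rule tendstoI)
      fix e :: real assume e: "e > 0"
      obtain m where "1 / real (Suc m) < e / 2" using e by (metis half_gt_zero nat_approx_posE)
      moreover from elim(1)[rule_format, of "e / 2" m] elim(2)[rule_format, of "e / 2" m] e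
      have "\<forall>\<^sub>F n in sequentially. (\<Sum>i<n. f ((T ^^ i) x)) / real n \<le> (\<integral>x. f x \<partial>Q) + 1 / real (Suc m) + e / 2
        \<and> - ((\<Sum>i<n. f ((T ^^ i) x)) / real n) \<le> - (\<integral>x. f x \<partial>Q) + 1 / real (Suc m) + e / 2"
        by (simp add: sum_negf eventually_conj_iff)
      ultimately show "\<forall>\<^sub>F n in sequentially. dist ((\<Sum>i<n. f ((T ^^ i) x)) / real n) (\<integral>x. f x \<partial>Q) < e"
        by (auto elim!: eventually_mono simp: dist_real_def abs_less_iff)
    qed
  qed
qed

end

section \<open>A central limit theorem for martingale differences\<close>

lemma norm_one_plus_i: "norm (1 + \<i> * complex_of_real x) ^ 2 = 1 + x\<^sup>2"
  by (simp add: cmod_power2)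

lemma one_le_norm_one_plus_i: "1 \<le> norm (1 + \<i> * complex_of_real x)"
proof -
  have "1\<^sup>2 \<le> norm (1 + \<i> * complex_of_real x) ^ 2" by (simp add: norm_one_plus_i)
  then show ?thesis by (rule power2_le_imp_le) simp
qed

lemma exp_neg_quadratic_bound:
  fixes y :: real assumes "0 \<le> y" shows "\<bar>exp (- y) - (1 - y)\<bar> \<le> y\<^sup>2"
proof -
  have "exp (- y) \<le> 1 / (1 + y)"
    using exp_ge_add_one_self[of y] assms by (simp add: exp_minus field_simps)
  also have "\<dots> \<le> 1 - y + y\<^sup>2"
    using assms by (simp add: divide_le_eq) (simp add: algebra_simps power2_eq_square power3_eq_cube[symmetric])
  finally show ?thesis using exp_ge_add_one_self[of "- y"] by simp
qed

text \<open>The logarithm of 1 + ix is ix + x^2/2 up to third order, so dividing exp(ix) by 1 + ix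
  leaves exp(-x^2/2) up to third order. For large x both terms lie in the unit disc and the cubic
  bound exceeds 2.\<close>

lemma iexp_quotient_approx:
  "norm (iexp x / (1 + \<i> * complex_of_real x) - exp (- complex_of_real (x\<^sup>2) / 2)) \<le> 2 * \<bar>x\<bar> ^ 3"
proof (cases "\<bar>x\<bar> \<le> 1")
  case True
  define r where "r = exp (- (x\<^sup>2) / 2) - (1 - x\<^sup>2 / 2)"
  have r: "\<bar>r\<bar> \<le> \<bar>x\<bar> ^ 3 / 4"
  proof -
    have "\<bar>r\<bar> \<le> (x\<^sup>2 / 2)\<^sup>2" unfolding r_def using exp_neg_quadratic_bound[of "x\<^sup>2 / 2"] by simp
    also have "\<dots> = \<bar>x\<bar> ^ 4 / 4" by (simp add: power_divide)
    also have "\<bar>x\<bar> ^ 4 \<le> \<bar>x\<bar> ^ 3" using True by (intro power_decreasing) auto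
    finally show ?thesis by simp
  qed
  define d where "d = iexp x - (1 + \<i> * complex_of_real x - complex_of_real (x\<^sup>2) / 2)"
  have d: "norm d \<le> \<bar>x\<bar> ^ 3 / 6"
  proof -
    have "(\<Sum>k\<le>2. (\<i> * complex_of_real x) ^ k / fact k) = 1 + \<i> * complex_of_real x - complex_of_real (x\<^sup>2) / 2"
      by (simp add: numeral_2_eq_2 power_mult_distrib)
    with iexp_approx1[of x 2] show ?thesis unfolding d_def by (simp add: fact_numeral)
  qed
  \<comment> \<open>The product (1 + ix)(1 - x^2/2) differs from the Taylor polynomial of exp(ix) by
    -i x^3/2. The three error terms contribute 1/6, 1/2 and 1/2 times the cube of the absolute value
    of x.\<close>
  have eq: "iexp x - (1 + \<i> * complex_of_real x) * exp (- complex_of_real (x\<^sup>2) / 2)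
     = d + \<i> * complex_of_real (x ^ 3 / 2) - (1 + \<i> * complex_of_real x) * complex_of_real r"
  proof -
    have "exp (- complex_of_real (x\<^sup>2) / 2) = complex_of_real (1 - x\<^sup>2 / 2 + r)"
      unfolding r_def by (simp flip: exp_of_real)
    then show ?thesis unfolding d_def
      by (simp only:) (simp add: field_simps power2_eq_square power3_eq_cube)
  qed
  have n1: "norm (1 + \<i> * complex_of_real x) \<le> 2"
    using norm_triangle_ineq[of 1 "\<i> * complex_of_real x"] True by (simp add: norm_mult)
  have "norm (iexp x - (1 + \<i> * complex_of_real x) * exp (- complex_of_real (x\<^sup>2) / 2))
     \<le> norm d + norm (\<i> * complex_of_real (x ^ 3 / 2)) + norm ((1 + \<i> * complex_of_real x) * complex_of_real r)"
    unfolding eq by (intro order_trans[OF norm_triangle_ineq4] add_right_mono norm_triangle_ineq)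
  also have "\<dots> \<le> \<bar>x\<bar> ^ 3 / 6 + \<bar>x\<bar> ^ 3 / 2 + 2 * (\<bar>x\<bar> ^ 3 / 4)"
  proof (intro add_mono d)
    show "norm (\<i> * complex_of_real (x ^ 3 / 2)) \<le> \<bar>x\<bar> ^ 3 / 2"
      by (simp add: norm_mult norm_power norm_divide power_abs)
    show "norm ((1 + \<i> * complex_of_real x) * complex_of_real r) \<le> 2 * (\<bar>x\<bar> ^ 3 / 4)"
      unfolding norm_mult using r n1 by (intro mult_mono) auto
  qed
  also have "\<dots> \<le> 2 * \<bar>x\<bar> ^ 3" by simp
  finally have le: "norm (iexp x - (1 + \<i> * complex_of_real x) * exp (- complex_of_real (x\<^sup>2) / 2)) \<le> 2 * \<bar>x\<bar> ^ 3" .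
  have nz: "1 + \<i> * complex_of_real x \<noteq> 0" using one_le_norm_one_plus_i[of x] by force
  have "norm (iexp x / (1 + \<i> * complex_of_real x) - exp (- complex_of_real (x\<^sup>2) / 2))
      = norm (iexp x - (1 + \<i> * complex_of_real x) * exp (- complex_of_real (x\<^sup>2) / 2))
        / norm (1 + \<i> * complex_of_real x)"
    using nz by (simp add: diff_divide_distrib flip: norm_divide)
  also have "\<dots> \<le> norm (iexp x - (1 + \<i> * complex_of_real x) * exp (- complex_of_real (x\<^sup>2) / 2)) / 1"
    using one_le_norm_one_plus_i[of x] by (intro divide_left_mono) auto
  also note le
  finally show ?thesis by simp
next
  case False
  have "norm (iexp x / (1 + \<i> * complex_of_real x) - exp (- complex_of_real (x\<^sup>2) / 2))
     \<le> norm (iexp x / (1 + \<i> * complex_of_real x)) + norm (exp (- complex_of_real (x\<^sup>2) / 2))"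
    by (rule norm_triangle_ineq4)
  also have "\<dots> \<le> 1 + 1"
    using one_le_norm_one_plus_i[of x]
    by (intro add_mono) (simp_all add: norm_divide divide_le_eq)
  also have "\<dots> \<le> 2 * \<bar>x\<bar> ^ 3" using False one_le_power[of "\<bar>x\<bar>" 3] by simp
  finally show ?thesis .
qed

text \<open>All factors on both sides lie in the closed unit disc, so the errors of the individual
  factors add up.\<close>

lemma prod_iexp_quotient_approx:
  fixes x :: "nat \<Rightarrow> real"
  shows "norm ((\<Prod>j<n. iexp (x j) / (1 + \<i> * complex_of_real (x j)))
      - exp (- complex_of_real (\<Sum>j<n. (x j)\<^sup>2) / 2)) \<le> 2 * (\<Sum>j<n. \<bar>x j\<bar> ^ 3)"
proof -
  have "exp (- complex_of_real (\<Sum>j<n. (x j)\<^sup>2) / 2) = (\<Prod>j<n. exp (- complex_of_real ((x j)\<^sup>2) / 2))"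
    by (subst Transcendental.exp_sum[OF finite_lessThan, symmetric])
       (simp add: sum_divide_distrib del: of_real_power flip: sum_negf)
  then have "norm ((\<Prod>j<n. iexp (x j) / (1 + \<i> * complex_of_real (x j)))
      - exp (- complex_of_real (\<Sum>j<n. (x j)\<^sup>2) / 2))
    \<le> (\<Sum>j<n. norm (iexp (x j) / (1 + \<i> * complex_of_real (x j)) - exp (- complex_of_real ((x j)\<^sup>2) / 2)))"
    using one_le_norm_one_plus_i
    by (simp only:, intro norm_prod_diff) (auto simp: norm_divide divide_le_eq)
  also have "\<dots> \<le> (\<Sum>j<n. 2 * \<bar>x j\<bar> ^ 3)" by (intro sum_mono iexp_quotient_approx)
  finally show ?thesis by (simp add: sum_distrib_left)
qed

text \<open>Terms are dropped once the squares of the earlier ones exceed C. The test looks only at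
  indices below k, so stopping preserves martingale differences; the price is that the term which
  crosses the level is still kept.\<close>

definition stop_sq :: "real \<Rightarrow> (nat \<Rightarrow> real) \<Rightarrow> nat \<Rightarrow> real" where
  "stop_sq C x k = (if (\<Sum>j<k. (x j)\<^sup>2) \<le> C then x k else 0)"

lemma norm_prod_one_plus_i_sq:
  fixes x :: "nat \<Rightarrow> real"
  shows "(norm (\<Prod>j<k. 1 + \<i> * complex_of_real (x j)))\<^sup>2 = (\<Prod>j<k. 1 + (x j)\<^sup>2)"
  unfolding prod_norm[symmetric] prod_power_distrib norm_one_plus_i ..

lemma norm_prod_one_plus_i_le:
  fixes x :: "nat \<Rightarrow> real"
  shows "norm (\<Prod>j<k. 1 + \<i> * complex_of_real (x j)) \<le> exp ((\<Sum>j<k. (x j)\<^sup>2) / 2)"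
proof (rule power2_le_imp_le)
  have "(\<Prod>j<k. 1 + (x j)\<^sup>2) \<le> (\<Prod>j<k. exp ((x j)\<^sup>2))"
    by (intro prod_mono) (auto simp: exp_ge_add_one_self add_nonneg_nonneg)
  also have "\<dots> = exp ((\<Sum>j<k. (x j)\<^sup>2) / 2) ^ 2"
    by (subst Transcendental.exp_sum[OF finite_lessThan, symmetric]) (simp add: exp_double[symmetric])
  finally show "(norm (\<Prod>j<k. 1 + \<i> * complex_of_real (x j)))\<^sup>2 \<le> exp ((\<Sum>j<k. (x j)\<^sup>2) / 2) ^ 2"
    unfolding norm_prod_one_plus_i_sq .
qed simp

lemma stop_sq_eq:
  assumes "(\<Sum>j<k. (x j)\<^sup>2) \<le> C" "i \<le> k"
  shows "stop_sq C x i = x i"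
proof -
  have "(\<Sum>j<i. (x j)\<^sup>2) \<le> (\<Sum>j<k. (x j)\<^sup>2)" using assms(2) by (intro sum_mono2) auto
  with assms show ?thesis by (simp add: stop_sq_def)
qed

lemma norm_prod_stop_sq_le:
  assumes "(\<Sum>j<k. (x j)\<^sup>2) \<le> C"
  shows "norm (\<Prod>j<k. 1 + \<i> * complex_of_real (stop_sq C x j)) \<le> exp (C / 2)"
proof -
  have "(\<Prod>j<k. 1 + \<i> * complex_of_real (stop_sq C x j)) = (\<Prod>j<k. 1 + \<i> * complex_of_real (x j))"
    by (intro prod.cong) (auto simp: stop_sq_eq[OF assms])
  also have "norm \<dots> \<le> exp ((\<Sum>j<k. (x j)\<^sup>2) / 2)" by (rule norm_prod_one_plus_i_le)
  finally show ?thesis using assms by (auto elim: order_trans)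
qed

text \<open>Up to the crossing of the level C the squared product is at most \<open>exp C\<close>,
  the crossing term contributes a single factor \<open>1 + (x k)\<^sup>2\<close>, and all later
  factors are 1. The product is therefore unbounded, but its square has an integrable bound.\<close>

lemma norm_prod_stop_sq_sq_le:
  assumes "0 \<le> C"
  shows "(norm (\<Prod>j<k. 1 + \<i> * complex_of_real (stop_sq C x j)))\<^sup>2 \<le> exp C * (1 + (\<Sum>j<k. (x j)\<^sup>2))"
proof (induction k)
  case 0
  then show ?case using assms by simp
next
  case (Suc k)
  let ?P = "\<lambda>k. \<Prod>j<k. 1 + \<i> * complex_of_real (stop_sq C x j)"
  have eq: "(norm (?P (Suc k)))\<^sup>2 = (norm (?P k))\<^sup>2 * (1 + (stop_sq C x k)\<^sup>2)"
    by (simp add: norm_mult power_mult_distrib norm_one_plus_i)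
  show ?case
  proof (cases "(\<Sum>j<k. (x j)\<^sup>2) \<le> C")
    case True
    have "(norm (?P k))\<^sup>2 \<le> (exp (C / 2))\<^sup>2" by (intro power_mono norm_prod_stop_sq_le True) simp
    also have "\<dots> = exp C" by (simp add: exp_double[symmetric])
    finally have "(norm (?P (Suc k)))\<^sup>2 \<le> exp C * (1 + (x k)\<^sup>2)"
      unfolding eq using True by (auto simp: stop_sq_def intro!: mult_right_mono add_nonneg_nonneg)
    also have "\<dots> \<le> exp C * (1 + (\<Sum>j<Suc k. (x j)\<^sup>2))"
      by (intro mult_left_mono add_left_mono) (auto intro: sum_nonneg)
    finally show ?thesis .
  next
    case False
    then have "(norm (?P (Suc k)))\<^sup>2 \<le> exp C * (1 + (\<Sum>j<k. (x j)\<^sup>2))"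
      unfolding eq using Suc by (simp add: stop_sq_def)
    also have "\<dots> \<le> exp C * (1 + (\<Sum>j<Suc k. (x j)\<^sup>2))"
      by (intro mult_left_mono add_left_mono) auto
    finally show ?thesis .
  qed
qed

text \<open>Smallness of \<open>a n / real n\<close> passes to the maximum over k < n: late terms
  satisfy \<open>a k / real n \<le> a k / real k\<close>, and the finitely many early ones are
  beaten by n.\<close>

lemma eventually_all_less_le:
  fixes a :: "nat \<Rightarrow> real"
  assumes "(\<lambda>n. a n / real n) \<longlonglongrightarrow> 0" and "\<And>n. 0 \<le> a n" and e: "e > 0"
  shows "\<forall>\<^sub>F n in sequentially. \<forall>k<n. a k / real n \<le> e"
proof -
  obtain m' where "\<And>n. n \<ge> m' \<Longrightarrow> \<bar>a n / real n\<bar> < e"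
    using LIMSEQ_D[OF assms(1) e] by auto
  then obtain m where m: "\<And>n. n \<ge> m \<Longrightarrow> \<bar>a n / real n\<bar> < e" "0 < m"
    by (metis Suc_leD zero_less_Suc)
  obtain n0 :: nat where n0: "real n0 > (\<Sum>k<m. a k) / e" using reals_Archimedean2 by blast
  show ?thesis
  proof (rule eventually_sequentiallyI[of "Suc (max n0 m)"], safe)
    fix n k assume n: "Suc (max n0 m) \<le> n" and k: "k < n"
    show "a k / real n \<le> e"
    proof (cases "k < m")
      case True
      then have "a k \<le> (\<Sum>k<m. a k)" using assms(2) by (intro member_le_sum) auto
      also have "\<dots> \<le> e * real n0" using n0 e by (simp add: field_simps)
      also have "\<dots> \<le> e * real n" using n e by (intro mult_left_mono) auto
      finally show ?thesis using n by (simp add: field_simps)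
    next
      case False
      then have "0 < k" using m(2) by simp
      then have "a k / real n \<le> a k / real k" using k assms(2)[of k] by (intro divide_left_mono) auto
      also have "\<dots> \<le> e" using m(1)[of k] False assms(2)[of k] by auto
      finally show ?thesis .
    qed
  qed
qed

text \<open>This takes the place of a Lindeberg condition. Comparing consecutive averages shows that
  the last square divided by n tends to 0, hence so does the largest of the first n squares divided
  by n; the sum of cubes is at most the largest scaled term times the average of squares.\<close>

lemma sum_cubes_tendsto_0:
  fixes x :: "nat \<Rightarrow> real"
  assumes v: "(\<lambda>n. (\<Sum>k<n. (x k)\<^sup>2) / real n) \<longlonglongrightarrow> v"
  shows "(\<lambda>n. \<Sum>k<n. \<bar>x k / sqrt (real n)\<bar> ^ 3) \<longlonglongrightarrow> 0"
proof -
  let ?q = "\<lambda>n. (\<Sum>k<n. (x k)\<^sup>2) / real n"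
  have "(\<lambda>n. ?q (Suc n) * (real (Suc n) / real n) - ?q n) \<longlonglongrightarrow> v * 1 - v"
    by (intro tendsto_intros v LIMSEQ_Suc[OF v] LIMSEQ_Suc_n_over_n)
  moreover have "\<forall>\<^sub>F n in sequentially. ?q (Suc n) * (real (Suc n) / real n) - ?q n = (x n)\<^sup>2 / real n"
  proof (rule eventually_sequentiallyI[of 1])
    fix n :: nat assume "1 \<le> n"
    then have "?q (Suc n) * (real (Suc n) / real n) = (\<Sum>k<Suc n. (x k)\<^sup>2) / real n"
      by (simp del: sum.lessThan_Suc of_nat_Suc)
    then show "?q (Suc n) * (real (Suc n) / real n) - ?q n = (x n)\<^sup>2 / real n"
      by (simp add: add_divide_distrib del: of_nat_Suc)
  qed
  ultimately have "(\<lambda>n. (x n)\<^sup>2 / real n) \<longlonglongrightarrow> v * 1 - v"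
    by (rule Lim_transform_eventually)
  then have sq: "(\<lambda>n. (x n)\<^sup>2 / real n) \<longlonglongrightarrow> 0"
    by simp
  obtain B where B: "\<And>n. \<bar>?q n\<bar> \<le> B" "0 < B"
    using BseqE[OF convergent_imp_Bseq[OF convergentI[OF v]]] by auto
  show ?thesis
  proof (rule LIMSEQ_I)
    fix e :: real assume e: "e > 0"
    define d where "d = e / (2 * B)"
    have d: "d > 0" using e B by (simp add: d_def)
    have "\<forall>\<^sub>F n in sequentially. \<forall>k<n. (x k)\<^sup>2 / real n \<le> d\<^sup>2"
      using d by (intro eventually_all_less_le sq) auto
    then obtain m where m: "\<And>n k. n \<ge> m \<Longrightarrow> k < n \<Longrightarrow> (x k)\<^sup>2 / real n \<le> d\<^sup>2"
      by (auto simp: eventually_sequentially)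
    have "norm ((\<Sum>k<n. \<bar>x k / sqrt (real n)\<bar> ^ 3) - 0) < e" if n: "n \<ge> m" for n
    proof -
      have "(\<Sum>k<n. \<bar>x k / sqrt (real n)\<bar> ^ 3) \<le> (\<Sum>k<n. d * ((x k)\<^sup>2 / real n))"
      proof (intro sum_mono)
        fix k assume "k \<in> {..<n}"
        then have "(x k)\<^sup>2 / real n \<le> d\<^sup>2" by (intro m n) simp
        then have "(\<bar>x k / sqrt (real n)\<bar>)\<^sup>2 \<le> d\<^sup>2" by (simp add: power_divide)
        then have "\<bar>x k / sqrt (real n)\<bar> \<le> d" by (rule power2_le_imp_le) (use d in simp)
        then have "\<bar>x k / sqrt (real n)\<bar> * \<bar>x k / sqrt (real n)\<bar>\<^sup>2 \<le> d * \<bar>x k / sqrt (real n)\<bar>\<^sup>2"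
          by (intro mult_right_mono) auto
        then show "\<bar>x k / sqrt (real n)\<bar> ^ 3 \<le> d * ((x k)\<^sup>2 / real n)"
          by (simp add: power_divide power3_eq_cube power2_eq_square mult_ac)
      qed
      also have "\<dots> = d * ?q n" by (simp only: sum_distrib_left sum_divide_distrib)
      also have "\<dots> \<le> d * B" using order_trans[OF abs_ge_self B(1)[of n]] d by (intro mult_left_mono) simp_all
      also have "\<dots> < e" using e B by (simp add: d_def)
      finally show ?thesis by (simp add: sum_nonneg)
    qed
    then show "\<exists>no. \<forall>n\<ge>no. norm ((\<Sum>k<n. \<bar>x k / sqrt (real n)\<bar> ^ 3) - 0) < e" by blast
  qed
qed

text \<open>Bounded second moments give uniform integrability: the norm is at most its truncation at
  K plus its square divided by K, and dominated convergence handles the truncation.\<close>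

lemma (in prob_space) tendsto_integral_L2_bounded:
  fixes D :: "nat \<Rightarrow> 'a \<Rightarrow> complex"
  assumes [measurable]: "\<And>n. D n \<in> borel_measurable M"
    and ae: "AE x in M. (\<lambda>n. D n x) \<longlonglongrightarrow> 0"
    and int: "\<And>n. integrable M (\<lambda>x. (norm (D n x))\<^sup>2)"
    and bound: "\<And>n. (\<integral>x. (norm (D n x))\<^sup>2 \<partial>M) \<le> B"
  shows "(\<lambda>n. \<integral>x. D n x \<partial>M) \<longlonglongrightarrow> 0"
proof (rule LIMSEQ_I)
  fix e :: real assume e: "e > 0"
  have B: "B \<ge> 0" using bound[of 0] by (rule order_trans[rotated]) simp
  \<comment> \<open>With this K the tail \<open>B / K\<close> is at most e/2, also when B =
    0.\<close>
  define K where "K = 2 * (B + 1) / e"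
  have K: "K > 0" using B e by (simp add: K_def)
  have "(\<lambda>n. \<integral>x. min (norm (D n x)) K \<partial>M) \<longlonglongrightarrow> (\<integral>x. 0 \<partial>M)"
  proof (rule integral_dominated_convergence[where w = "\<lambda>_. K"])
    show "AE x in M. (\<lambda>n. min (norm (D n x)) K) \<longlonglongrightarrow> 0"
      using ae
    proof eventually_elim
      fix x assume "(\<lambda>n. D n x) \<longlonglongrightarrow> 0"
      then have "(\<lambda>n. min (norm (D n x)) K) \<longlonglongrightarrow> min 0 K" by (intro tendsto_intros tendsto_norm_zero)
      then show "(\<lambda>n. min (norm (D n x)) K) \<longlonglongrightarrow> 0" using K by simp
    qed
  qed (use K in auto)
  then have "\<exists>m. \<forall>n\<ge>m. \<bar>\<integral>x. min (norm (D n x)) K \<partial>M\<bar> < e / 2"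
    using LIMSEQ_D[of "\<lambda>n. \<integral>x. min (norm (D n x)) K \<partial>M" 0 "e / 2"] e by simp
  then obtain m where m: "\<And>n. n \<ge> m \<Longrightarrow> \<bar>\<integral>x. min (norm (D n x)) K \<partial>M\<bar> < e / 2" by blast
  have "norm ((\<integral>x. D n x \<partial>M) - 0) < e" if "n \<ge> m" for n
  proof -
    have imin: "integrable M (\<lambda>x. min (norm (D n x)) K)"
      using K by (intro integrable_const_bound[of _ K]) auto
    have le: "norm (D n x) \<le> min (norm (D n x)) K + (norm (D n x))\<^sup>2 / K" for x
    proof (cases "norm (D n x) \<le> K")
      case False
      then have "norm (D n x) * K \<le> norm (D n x) * norm (D n x)" by (intro mult_left_mono) auto
      then have "norm (D n x) \<le> (norm (D n x))\<^sup>2 / K" using K by (simp add: field_simps power2_eq_square)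
      moreover have "0 \<le> min (norm (D n x)) K" using K by simp
      ultimately show ?thesis by linarith
    qed (use K in simp)
    have "norm (\<integral>x. D n x \<partial>M) \<le> (\<integral>x. norm (D n x) \<partial>M)" by (rule integral_norm_bound)
    also have "\<dots> \<le> (\<integral>x. min (norm (D n x)) K + (norm (D n x))\<^sup>2 / K \<partial>M)"
      using le K by (intro integral_mono' Bochner_Integration.integrable_add imin integrable_divide int)
        (auto intro!: add_nonneg_nonneg)
    also have "\<dots> = (\<integral>x. min (norm (D n x)) K \<partial>M) + (\<integral>x. (norm (D n x))\<^sup>2 \<partial>M) / K"
      using imin int[of n] by simp
    also have "\<dots> < e / 2 + B / K"
      using m[OF that] bound[of n] K by (intro add_less_le_mono divide_right_mono) auto
    also have "\<dots> \<le> e" using B e by (simp add: K_def field_simps)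
    finally show ?thesis by simp
  qed
  then show "\<exists>no. \<forall>n\<ge>no. norm ((\<integral>x. D n x \<partial>M) - 0) < e" by blast
qed

text \<open>Appending the factor with index k adds \<open>\<i>\<close> times a bounded function of
  the past times \<open>X k\<close>, whose mean vanishes by \<open>orth\<close>. Stopping is what
  makes that function bounded; since \<open>orth\<close> concerns real multipliers, real and
  imaginary parts are treated separately.\<close>

lemma (in prob_space) expectation_prod_stop_sq:
  fixes X :: "nat \<Rightarrow> 'a \<Rightarrow> real"
  assumes sub: "\<And>n. subalgebra M (F n)" and mono: "\<And>n. sets (F n) \<subseteq> sets (F (Suc n))"
    and X: "\<And>n. X n \<in> borel_measurable (F (Suc n))" and Xint: "\<And>n. integrable M (X n)"
    and orth: "\<And>n Z B. Z \<in> borel_measurable (F n) \<Longrightarrow> (\<And>x. \<bar>Z x\<bar> \<le> B) \<Longrightarrow> (\<integral>x. Z x * X n x \<partial>M) = 0"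
  shows "integrable M (\<lambda>x. \<Prod>j<k. 1 + \<i> * complex_of_real (stop_sq C (\<lambda>j. X j x / s) j)) \<and>
    (\<integral>x. (\<Prod>j<k. 1 + \<i> * complex_of_real (stop_sq C (\<lambda>j. X j x / s) j)) \<partial>M) = 1"
proof (induction k)
  case 0
  then show ?case by (simp add: prob_space)
next
  case (Suc k)
  let ?P = "\<lambda>k x. \<Prod>j<k. 1 + \<i> * complex_of_real (stop_sq C (\<lambda>j. X j x / s) j)"
  define Z where "Z x = (if (\<Sum>j<k. (X j x / s)\<^sup>2) \<le> C then ?P k x else 0) / s" for x
  have space: "space (F n) = space M" for n using sub[of n] by (simp add: subalgebra_def)
  have mono': "sets (F m) \<subseteq> sets (F n)" if "m \<le> n" for m n
    using that by (rule lift_Suc_mono_le[of "\<lambda>n. sets (F n)", OF mono])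
  have XF [measurable]: "X j \<in> borel_measurable (F k)" if "j < k" for j
    using measurable_mono[of borel borel "F (Suc j)" "F k"] mono'[of "Suc j" k] that X[of j] space by auto
  have XM [measurable]: "X j \<in> borel_measurable M" for j using Xint by auto
  have XS: "(\<lambda>x. \<Sum>j<i. (X j x / s)\<^sup>2) \<in> borel_measurable (F k)" if "i \<le> k" for i
    using that XF by (intro borel_measurable_sum borel_measurable_power borel_measurable_divide) auto
  have stopF: "(\<lambda>x. stop_sq C (\<lambda>j. X j x / s) j) \<in> borel_measurable (F k)" if "j < k" for j
    unfolding stop_sq_def using XS[of j] XF[OF that] that by simp
  have PF: "?P k \<in> borel_measurable (F k)"
    using stopF by (intro borel_measurable_prod) simp
  have ZF: "Z \<in> borel_measurable (F k)"
    unfolding Z_def using PF XS[of k] by simp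
  have Z: "norm (Z x) \<le> exp (C / 2) / \<bar>s\<bar>" for x
    using norm_prod_stop_sq_le[of "\<lambda>j. X j x / s" k C]
    by (auto simp: Z_def norm_divide intro!: divide_right_mono)
  have Re: "(\<integral>x. Re (Z x) * X k x \<partial>M) = 0" and Im: "(\<integral>x. Im (Z x) * X k x \<partial>M) = 0"
    using ZF by (auto intro!: orth order_trans[OF abs_Re_le_cmod Z] order_trans[OF abs_Im_le_cmod Z])
  have ZM [measurable]: "Z \<in> borel_measurable M" using ZF sub measurable_from_subalg by blast
  have int: "integrable M (\<lambda>x. Z x * complex_of_real (X k x))"
  proof (rule Bochner_Integration.integrable_bound)
    show "integrable M (\<lambda>x. exp (C / 2) / \<bar>s\<bar> * X k x)" using Xint by simp
    show "AE x in M. norm (Z x * complex_of_real (X k x)) \<le> norm (exp (C / 2) / \<bar>s\<bar> * X k x)"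
      using mult_right_mono[OF Z abs_ge_zero] by (intro AE_I2) (simp add: norm_mult abs_mult)
  qed measurable
  have "(\<integral>x. Z x * complex_of_real (X k x) \<partial>M) = 0"
    using Re Im int integral_Re[OF int] integral_Im[OF int] by (intro complex_eqI) simp_all
  moreover have "?P (Suc k) = (\<lambda>x. ?P k x + \<i> * (Z x * complex_of_real (X k x)))"
    by (rule ext) (auto simp: Z_def stop_sq_def algebra_simps)
  ultimately show ?case using Suc int by auto
qed

text \<open>Write the exponential of the stopped sum as \<open>P n x\<close> times the product of
  the quotients exp(ix)/(1 + ix). The first factor has mean one, the second tends to the constant
  \<open>?c\<close> by the law of large numbers for the squares, and the second moments of the first
  are bounded, so the mean of the exponential tends to \<open>?c\<close>.\<close>

theorem (in prob_space) martingale_clt: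
  fixes X :: "nat \<Rightarrow> 'a \<Rightarrow> real"
  assumes sub: "\<And>n. subalgebra M (F n)" and mono: "\<And>n. sets (F n) \<subseteq> sets (F (Suc n))"
    and X: "\<And>n. X n \<in> borel_measurable (F (Suc n))"
    and orth: "\<And>n Z B. Z \<in> borel_measurable (F n) \<Longrightarrow> (\<And>x. \<bar>Z x\<bar> \<le> B) \<Longrightarrow> (\<integral>x. Z x * X n x \<partial>M) = 0"
    and sq: "\<And>n. integrable M (\<lambda>x. (X n x)\<^sup>2)" "\<And>n. (\<integral>x. (X n x)\<^sup>2 \<partial>M) \<le> s"
    and lln: "AE x in M. (\<lambda>n. (\<Sum>k<n. (X k x)\<^sup>2) / real n) \<longlonglongrightarrow> v" and v: "0 \<le> v"
  shows "(\<lambda>n. \<integral>x. iexp ((\<Sum>k<n. X k x) / sqrt (real n)) \<partial>M) \<longlonglongrightarrow> exp (- complex_of_real v / 2)"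
proof -
  have XM [measurable]: "X n \<in> borel_measurable M" for n
    using X sub measurable_from_subalg by blast
  have Xint: "integrable M (X n)" for n
    using sq(1) XM by (rule square_integrable_imp_integrable[rotated])
  \<comment> \<open>Any level above v would do: almost surely the sums of squares eventually stay
    below it and the stopping is inactive.\<close>
  define C where "C = v + 1"
  have C: "0 \<le> C" using v by (simp add: C_def)
  define \<xi> where "\<xi> n x k = X k x / sqrt (real n)" for n x k
  define P where "P n x = (\<Prod>j<n. 1 + \<i> * complex_of_real (stop_sq C (\<xi> n x) j))" for n x
  define S where "S n x = (\<Sum>j<n. stop_sq C (\<xi> n x) j)" for n x
  let ?c = "exp (- complex_of_real v / 2)"
  have [measurable]: "(\<lambda>x. stop_sq C (\<xi> n x) j) \<in> borel_measurable M" for n j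
    unfolding stop_sq_def \<xi>_def by measurable
  have [measurable]: "P n \<in> borel_measurable M" "S n \<in> borel_measurable M" for n
    unfolding P_def S_def by measurable
  have P: "integrable M (P n)" "(\<integral>x. P n x \<partial>M) = 1" for n
  proof -
    have "integrable M (P n) \<and> (\<integral>x. P n x \<partial>M) = 1"
      unfolding P_def \<xi>_def by (rule expectation_prod_stop_sq[of F X, OF sub mono X Xint]) (blast intro: orth)
    then show "integrable M (P n)" "(\<integral>x. P n x \<partial>M) = 1" by auto
  qed
  have PB: "(norm (P n x))\<^sup>2 \<le> exp C * (1 + (\<Sum>j<n. (X j x)\<^sup>2) / real n)" for n x
    using norm_prod_stop_sq_sq_le[OF C, of "\<xi> n x" n]
    by (simp add: P_def \<xi>_def power_divide sum_divide_distrib)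
  have PBi: "integrable M (\<lambda>x. exp C * (1 + (\<Sum>j<n. (X j x)\<^sup>2) / real n))" for n
    using sq by simp
  have P2: "integrable M (\<lambda>x. (norm (P n x))\<^sup>2)" for n
    by (rule Bochner_Integration.integrable_bound[OF PBi[of n]])
       (auto intro!: AE_I2 order_trans[OF PB] simp: sum_nonneg)
  have P2B: "(\<integral>x. (norm (P n x))\<^sup>2 \<partial>M) \<le> exp C * (1 + \<bar>s\<bar>)" for n
  proof -
    have "(\<integral>x. (norm (P n x))\<^sup>2 \<partial>M) \<le> (\<integral>x. exp C * (1 + (\<Sum>j<n. (X j x)\<^sup>2) / real n) \<partial>M)"
      by (intro integral_mono P2 PBi PB)
    also have "\<dots> = exp C * (1 + (\<Sum>j<n. \<integral>x. (X j x)\<^sup>2 \<partial>M) / real n)"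
      using sq by (simp add: prob_space)
    also have "(\<Sum>j<n. \<integral>x. (X j x)\<^sup>2 \<partial>M) \<le> (\<Sum>j<n. \<bar>s\<bar>)"
      by (intro sum_mono order_trans[OF sq(2)]) simp
    then have "(\<Sum>j<n. \<integral>x. (X j x)\<^sup>2 \<partial>M) / real n \<le> \<bar>s\<bar>"
      by (cases "n = 0") (auto simp: divide_le_eq mult.commute)
    finally show ?thesis by (auto intro: mult_left_mono)
  qed
  have conv: "AE x in M. (\<lambda>n. iexp (S n x) - ?c * P n x) \<longlonglongrightarrow> 0 \<and>
      (\<forall>\<^sub>F n in sequentially. S n x = (\<Sum>k<n. X k x) / sqrt (real n))"
    using lln
  proof eventually_elim
    fix x assume lim: "(\<lambda>n. (\<Sum>k<n. (X k x)\<^sup>2) / real n) \<longlonglongrightarrow> v"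
    have q: "(\<Sum>j<n. (\<xi> n x j)\<^sup>2) = (\<Sum>k<n. (X k x)\<^sup>2) / real n" for n
      by (simp add: \<xi>_def power_divide sum_divide_distrib)
    have ev: "\<forall>\<^sub>F n in sequentially. (\<Sum>j<n. (\<xi> n x j)\<^sup>2) \<le> C"
      unfolding q using order_tendstoD(2)[OF lim, of C] by (auto simp: C_def elim!: eventually_mono)
    let ?U = "\<lambda>n. \<Prod>j<n. iexp (\<xi> n x j) / (1 + \<i> * complex_of_real (\<xi> n x j))"
    have "(\<lambda>n. ?U n - exp (- complex_of_real (\<Sum>j<n. (\<xi> n x j)\<^sup>2) / 2)) \<longlonglongrightarrow> 0"
    proof (rule Lim_null_comparison)
      show "\<forall>\<^sub>F n in sequentially. norm (?U n - exp (- complex_of_real (\<Sum>j<n. (\<xi> n x j)\<^sup>2) / 2))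
          \<le> 2 * (\<Sum>j<n. \<bar>\<xi> n x j\<bar> ^ 3)"
        by (intro always_eventually allI prod_iexp_quotient_approx)
      show "(\<lambda>n. 2 * (\<Sum>j<n. \<bar>\<xi> n x j\<bar> ^ 3)) \<longlonglongrightarrow> 0"
        unfolding \<xi>_def using tendsto_mult_right_zero[OF sum_cubes_tendsto_0[OF lim], of 2] .
    qed
    moreover have "(\<lambda>n. exp (- complex_of_real (\<Sum>j<n. (\<xi> n x j)\<^sup>2) / 2)) \<longlonglongrightarrow> ?c"
      unfolding q by (intro tendsto_intros lim) simp
    ultimately have "?U \<longlonglongrightarrow> ?c" by (rule Lim_transform[rotated])
    then have U: "(\<lambda>n. ?U n - ?c) \<longlonglongrightarrow> 0" by (rule LIM_zero)
    have "(\<lambda>n. iexp (S n x) - ?c * P n x) \<longlonglongrightarrow> 0"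
    proof (rule Lim_null_comparison)
      show "\<forall>\<^sub>F n in sequentially. norm (iexp (S n x) - ?c * P n x) \<le> exp (C / 2) * norm (?U n - ?c)"
        using ev
      proof eventually_elim
        fix n assume le: "(\<Sum>j<n. (\<xi> n x j)\<^sup>2) \<le> C"
        have nz: "1 + \<i> * complex_of_real y \<noteq> 0" for y using one_le_norm_one_plus_i[of y] by force
        have Peq: "P n x = (\<Prod>j<n. 1 + \<i> * complex_of_real (\<xi> n x j))"
          unfolding P_def by (intro prod.cong) (auto simp: stop_sq_eq[OF le])
        have "iexp (S n x) = (\<Prod>j<n. iexp (\<xi> n x j))"
          unfolding S_def by (simp add: stop_sq_eq[OF le] Transcendental.exp_sum sum_distrib_left)
        also have "\<dots> = P n x * ?U n"
          unfolding Peq by (simp add: prod_dividef nz)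
        finally have "iexp (S n x) - ?c * P n x = P n x * (?U n - ?c)"
          by (simp add: algebra_simps)
        then show "norm (iexp (S n x) - ?c * P n x) \<le> exp (C / 2) * norm (?U n - ?c)"
          using norm_prod_stop_sq_le[OF le] unfolding P_def by (simp add: norm_mult mult_right_mono)
      qed
      show "(\<lambda>n. exp (C / 2) * norm (?U n - ?c)) \<longlonglongrightarrow> 0"
        using tendsto_mult_right_zero[OF tendsto_norm_zero[OF U]] .
    qed
    moreover have "\<forall>\<^sub>F n in sequentially. S n x = (\<Sum>k<n. X k x) / sqrt (real n)"
      using ev by eventually_elim
        (simp add: S_def stop_sq_eq, simp add: \<xi>_def sum_divide_distrib)
    ultimately show "(\<lambda>n. iexp (S n x) - ?c * P n x) \<longlonglongrightarrow> 0 \<and>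
      (\<forall>\<^sub>F n in sequentially. S n x = (\<Sum>k<n. X k x) / sqrt (real n))" ..
  qed
  \<comment> \<open>As \<open>P n\<close> has mean one, this integral is the mean of
    \<open>iexp (S n x)\<close> minus \<open>?c\<close>. The second moment bound comes from (1 +
    a)^2 \<le> 2 + 2 a^2 with a the norm of \<open>P n x\<close>.\<close>
  have "(\<lambda>n. \<integral>x. iexp (S n x) - ?c * P n x \<partial>M) \<longlonglongrightarrow> 0"
  proof (rule tendsto_integral_L2_bounded[where B = "2 + 2 * (exp C * (1 + \<bar>s\<bar>))"])
    have le: "(norm (iexp (S n x) - ?c * P n x))\<^sup>2 \<le> 2 + 2 * (norm (P n x))\<^sup>2" for n x
    proof -
      have "norm (iexp (S n x) - ?c * P n x) \<le> 1 + norm (P n x)"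
        using v by (intro order_trans[OF norm_triangle_ineq4]) (simp add: norm_mult mult_left_le_one_le)
      then have "(norm (iexp (S n x) - ?c * P n x))\<^sup>2 \<le> (1 + norm (P n x))\<^sup>2" by (intro power_mono) auto
      also have "\<dots> \<le> 2 + 2 * (norm (P n x))\<^sup>2"
        using zero_le_power2[of "1 - norm (P n x)"] by (simp add: power2_eq_square algebra_simps)
      finally show ?thesis .
    qed
    show "integrable M (\<lambda>x. (norm (iexp (S n x) - ?c * P n x))\<^sup>2)" for n
      by (rule Bochner_Integration.integrable_bound[of _ "\<lambda>x. 2 + 2 * (norm (P n x))\<^sup>2"])
         (use P2 le in auto)
    then have "(\<integral>x. (norm (iexp (S n x) - ?c * P n x))\<^sup>2 \<partial>M) \<le> (\<integral>x. 2 + 2 * (norm (P n x))\<^sup>2 \<partial>M)" for n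
      using P2[of n] by (intro integral_mono le) auto
    then show "(\<integral>x. (norm (iexp (S n x) - ?c * P n x))\<^sup>2 \<partial>M) \<le> 2 + 2 * (exp C * (1 + \<bar>s\<bar>))" for n
      by (rule order_trans) (use P2[of n] P2B[of n] in \<open>simp add: prob_space\<close>)
    show "AE x in M. (\<lambda>n. iexp (S n x) - ?c * P n x) \<longlonglongrightarrow> 0" using conv by auto
  qed measurable
  moreover have "(\<integral>x. iexp (S n x) - ?c * P n x \<partial>M) = (\<integral>x. iexp (S n x) \<partial>M) - ?c" for n
    using P[of n] integrable_iexp[of "\<lambda>x. complex_of_real (S n x)"] by simp
  ultimately have lim1: "(\<lambda>n. \<integral>x. iexp (S n x) \<partial>M) \<longlonglongrightarrow> ?c"
    by (simp add: LIM_zero_iff)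
  have iex: "integrable M (\<lambda>x. iexp (f x))" if "f \<in> borel_measurable M" for f
    using that by (intro integrable_iexp) auto
  \<comment> \<open>The stopped and the unstopped sums agree almost surely from some index on, so
    the bounded exponentials have the same limit in mean.\<close>
  have "(\<lambda>n. \<integral>x. iexp ((\<Sum>k<n. X k x) / sqrt (real n)) - iexp (S n x) \<partial>M) \<longlonglongrightarrow> (\<integral>x. 0 \<partial>M)"
  proof (rule integral_dominated_convergence[where w = "\<lambda>_. 2"])
    show "AE x in M. (\<lambda>n. iexp ((\<Sum>k<n. X k x) / sqrt (real n)) - iexp (S n x)) \<longlonglongrightarrow> 0"
      using conv by eventually_elim (auto intro!: tendsto_eventually elim!: eventually_mono)
    show "AE x in M. norm (iexp ((\<Sum>k<n. X k x) / sqrt (real n)) - iexp (S n x)) \<le> 2" for n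
      by (intro AE_I2 order_trans[OF norm_triangle_ineq4]) simp
  qed auto
  moreover have "(\<integral>x. iexp ((\<Sum>k<n. X k x) / sqrt (real n)) - iexp (S n x) \<partial>M)
     = (\<integral>x. iexp ((\<Sum>k<n. X k x) / sqrt (real n)) \<partial>M) - (\<integral>x. iexp (S n x) \<partial>M)" for n
    by (intro Bochner_Integration.integral_diff iex) auto
  ultimately have "(\<lambda>n. (\<integral>x. iexp ((\<Sum>k<n. X k x) / sqrt (real n)) \<partial>M) - (\<integral>x. iexp (S n x) \<partial>M)) \<longlonglongrightarrow> 0"
    by (simp only: integral_zero)
  from tendsto_add[OF this lim1] show ?thesis by simp
qed

section \<open>Convergence of expectations from characteristic functions\<close>

text \<open>The phase b covers sines as well, so closure under products follows from the
  product-to-sum formula alone. Each generator depends on finitely many coordinates, and its mean is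
  a real part of a value of a characteristic function.\<close>

inductive_set trig_poly :: "((nat \<Rightarrow> real) \<Rightarrow> real) set" where
  cosine: "(\<lambda>x. a * cos (b + (\<Sum>k<n. c k * x k))) \<in> trig_poly"
| add: "f \<in> trig_poly \<Longrightarrow> g \<in> trig_poly \<Longrightarrow> (\<lambda>x. f x + g x) \<in> trig_poly"

lemma trig_poly_const: "(\<lambda>_. a) \<in> trig_poly"
  using trig_poly.cosine[of a 0 "\<lambda>_. 0" 0] by simp

lemma trig_poly_cosine_mult:
  "(\<lambda>x. (a * cos (b + (\<Sum>k<n. c k * x k))) * (a' * cos (b' + (\<Sum>k<n'. c' k * x k)))) \<in> trig_poly"
proof -
  define m where "m = max n n'"
  define d where "d k = (if k < n then c k else 0)" for k
  define d' where "d' k = (if k < n' then c' k else 0)" for k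
  have d: "(\<Sum>k<n. c k * x k) = (\<Sum>k<m. d k * x k)" for x
    unfolding d_def m_def by (intro sum.mono_neutral_cong_left) auto
  have d': "(\<Sum>k<n'. c' k * x k) = (\<Sum>k<m. d' k * x k)" for x
    unfolding d'_def m_def by (intro sum.mono_neutral_cong_left) auto
  have "(a * cos (b + (\<Sum>k<n. c k * x k))) * (a' * cos (b' + (\<Sum>k<n'. c' k * x k)))
     = a * a' / 2 * cos ((b - b') + (\<Sum>k<m. (d k - d' k) * x k))
     + a * a' / 2 * cos ((b + b') + (\<Sum>k<m. (d k + d' k) * x k))" for x
  proof -
    have 1: "(b - b') + (\<Sum>k<m. (d k - d' k) * x k)
       = (b + (\<Sum>k<m. d k * x k)) - (b' + (\<Sum>k<m. d' k * x k))"
      by (simp add: algebra_simps sum_subtractf)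
    have 2: "(b + b') + (\<Sum>k<m. (d k + d' k) * x k)
       = (b + (\<Sum>k<m. d k * x k)) + (b' + (\<Sum>k<m. d' k * x k))"
      by (simp add: algebra_simps sum.distrib)
    show ?thesis unfolding d d' 1 2 cos_diff cos_add by (simp add: algebra_simps)
  qed
  then show ?thesis by (simp only:) (intro trig_poly.intros)
qed

lemma trig_poly_mult:
  assumes "f \<in> trig_poly" "g \<in> trig_poly" shows "(\<lambda>x. f x * g x) \<in> trig_poly"
  using assms(1)
proof induction
  case (cosine a b c n)
  show ?case using assms(2)
    by induction (auto simp: distrib_left intro: trig_poly_cosine_mult trig_poly.add)
qed (auto simp: distrib_right intro: trig_poly.add)

lemma trig_poly_bounded:
  assumes "f \<in> trig_poly" obtains C where "0 \<le> C" "\<And>x. \<bar>f x\<bar> \<le> C"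
proof -
  have "\<exists>C\<ge>0. \<forall>x. \<bar>f x\<bar> \<le> C" using assms
  proof induction
    case (cosine a b c n)
    have "\<bar>a * cos (b + (\<Sum>k<n. c k * x k))\<bar> \<le> \<bar>a\<bar>" for x
      by (simp add: abs_mult mult_left_le)
    then show ?case by (intro exI[of _ "\<bar>a\<bar>"]) auto
  next
    case (add f g)
    then obtain C C' where "0 \<le> C" "0 \<le> C'" "\<And>x. \<bar>f x\<bar> \<le> C" "\<And>x. \<bar>g x\<bar> \<le> C'" by blast
    then show ?case
      by (intro exI[of _ "C + C'"]) (auto intro: order_trans[OF abs_triangle_ineq] add_mono)
  qed
  then show ?thesis using that by blast
qed

lemma continuous_on_coordinate: "continuous_on S (\<lambda>x::nat \<Rightarrow> real. x k)"
  by (rule continuous_on_subset[OF continuous_on_product_coordinates]) simp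

lemma trig_poly_continuous: "f \<in> trig_poly \<Longrightarrow> continuous_on S f"
  by (induction rule: trig_poly.induct) (intro continuous_intros continuous_on_coordinate | assumption)+

lemma trig_poly_compose:
  assumes "real_polynomial_function q" "f \<in> trig_poly" shows "(\<lambda>x. q (f x)) \<in> trig_poly"
  using assms(1)
proof induction
  case (linear h)
  then obtain c where "h = (\<lambda>x. x * c)" using real_bounded_linear by blast
  then show ?case using trig_poly_mult[OF assms(2) trig_poly_const] by simp
qed (auto intro: trig_poly_const trig_poly.add trig_poly_mult)

text \<open>Stone-Weierstrass controls the approximation on \<open>K\<close> only; composing with a polynomial that
  approximates the clipping function on the range gives a bound on the whole space as well.\<close>

lemma trig_poly_approx:
  assumes K: "compact K" and f: "continuous_on K f" and B: "0 \<le> B" "\<And>x. x \<in> K \<Longrightarrow> \<bar>f x\<bar> \<le> B"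
    and e: "0 < e"
  obtains g where "g \<in> trig_poly" "\<And>x. x \<in> K \<Longrightarrow> \<bar>f x - g x\<bar> < e" "\<And>x. \<bar>g x\<bar> \<le> B + e"
proof -
  interpret function_ring_on trig_poly K
  proof
    fix x y :: "nat \<Rightarrow> real" assume "x \<noteq> y"
    then obtain k where k: "x k \<noteq> y k" by auto
    define d where "d = \<bar>x k\<bar> + \<bar>y k\<bar> + 1"
    have d: "d > 0" by (simp add: d_def add_nonneg_pos)
    \<comment> \<open>This scale puts \<open>s * x k\<close> and \<open>s * y k\<close> into the
      interval from -pi/2 to pi/2, on which the sine is injective; the phase -pi/2 below turns the
      cosine into that sine.\<close>
    define s where "s = pi / (2 * d)"
    have s: "s > 0" using d by (simp add: s_def)
    have bd: "\<bar>s * z\<bar> \<le> pi / 2" if "\<bar>z\<bar> \<le> d" for z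
    proof -
      have "\<bar>s * z\<bar> \<le> s * d"
        using s that by (simp add: abs_mult)
      also have "\<dots> = pi / 2" using d by (simp add: s_def)
      finally show ?thesis .
    qed
    have "\<bar>s * x k\<bar> \<le> pi / 2" "\<bar>s * y k\<bar> \<le> pi / 2" by (intro bd, simp add: d_def)+
    then have "sin (s * x k) \<noteq> sin (s * y k)"
      using sin_inj_pi[of "s * x k" "s * y k"] k s unfolding abs_le_iff by (auto simp: minus_le_iff)
    moreover have "1 * cos (- (pi / 2) + (\<Sum>j<Suc k. (if j = k then s else 0) * z j)) = sin (s * z k)" for z
    proof -
      have "(\<Sum>j<Suc k. (if j = k then s else 0) * z j) = (\<Sum>j<Suc k. if j = k then s * z j else 0)"
        by (intro sum.cong) auto
      then show ?thesis by (simp add: cos_diff)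
    qed
    ultimately show "\<exists>f\<in>trig_poly. f x \<noteq> f y"
      by (intro bexI[OF _ trig_poly.cosine[of 1 "- (pi / 2)" "\<lambda>j. if j = k then s else 0" "Suc k"]]) simp
  qed (use K in \<open>auto intro: trig_poly_continuous trig_poly.add trig_poly_mult trig_poly_const\<close>)
  obtain p where p: "p \<in> trig_poly" "\<And>x. x \<in> K \<Longrightarrow> \<bar>f x - p x\<bar> < e / 2"
    using Stone_Weierstrass_basic[OF f, of "e / 2"] e by auto
  obtain C where C: "0 \<le> C" "\<And>x. \<bar>p x\<bar> \<le> C" using trig_poly_bounded[OF p(1)] by blast
  define h where "h y = max (- B) (min B y)" for y
  have h: "continuous_on {-C..C} h" unfolding h_def by (intro continuous_intros)
  obtain q where q: "real_polynomial_function q" "\<And>y. y \<in> {-C..C} \<Longrightarrow> \<bar>h y - q y\<bar> < e / 2"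
    using Stone_Weierstrass_real_polynomial_function[OF _ h, of "e / 2"] e by auto
  have q': "\<bar>h (p x) - q (p x)\<bar> < e / 2" for x
    using q(2)[of "p x"] C(2)[of x] by (auto simp: abs_le_iff)
  show thesis
  proof
    show "(\<lambda>x. q (p x)) \<in> trig_poly" by (rule trig_poly_compose[OF q(1) p(1)])
    \<comment> \<open>On K the values of f lie between -B and B, so clipping \<open>p x\<close> to
      this interval does not move it away from \<open>f x\<close>.\<close>
    show "\<bar>f x - q (p x)\<bar> < e" if "x \<in> K" for x
    proof -
      have "\<bar>f x - h (p x)\<bar> \<le> \<bar>f x - p x\<bar>" using B(2)[OF that] unfolding h_def by (auto simp: max_def min_def)
      with p(2)[OF that] q'[of x] show ?thesis by linarith
    qed
    show "\<bar>q (p x)\<bar> \<le> B + e" for x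
    proof -
      have "\<bar>h (p x)\<bar> \<le> B" unfolding h_def using B(1) by auto
      with q'[of x] show ?thesis using e by linarith
    qed
  qed
qed

lemma trig_poly_measurable: "f \<in> trig_poly \<Longrightarrow> f \<in> borel_measurable borel"
  by (rule borel_measurable_continuous_onI) (rule trig_poly_continuous)

lemma trig_poly_tendsto:
  fixes W :: "nat \<Rightarrow> 'a \<Rightarrow> nat \<Rightarrow> real" and G :: "'b \<Rightarrow> nat \<Rightarrow> real"
  assumes M: "prob_space M" and N: "prob_space N"
    and W [measurable]: "\<And>T k. (\<lambda>\<omega>. W T \<omega> k) \<in> borel_measurable M"
    and G [measurable]: "\<And>k. (\<lambda>\<omega>. G \<omega> k) \<in> borel_measurable N"
    and char: "\<And>n c. (\<lambda>T. \<integral>\<omega>. iexp (\<Sum>k<n. c k * W T \<omega> k) \<partial>M) \<longlonglongrightarrow> (\<integral>\<omega>. iexp (\<Sum>k<n. c k * G \<omega> k) \<partial>N)"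
    and g: "g \<in> trig_poly"
  shows "(\<lambda>T. \<integral>\<omega>. g (W T \<omega>) \<partial>M) \<longlonglongrightarrow> (\<integral>\<omega>. g (G \<omega>) \<partial>N)"
proof -
  interpret M: prob_space M by fact
  interpret N: prob_space N by fact
  have Wm [measurable]: "W T \<in> borel_measurable M" for T
    by (rule measurable_coordinatewise_then_product) simp
  have Gm [measurable]: "G \<in> borel_measurable N"
    by (rule measurable_coordinatewise_then_product) simp
  show ?thesis using g
  proof induction
    case (cosine a b c n)
    have cosE: "a * cos (b + s) = Re (of_real a * iexp b * iexp s)" for s
      by (simp add: Re_exp Im_exp cos_add algebra_simps)
    have M1: "complex_integrable M (\<lambda>\<omega>. iexp (\<Sum>k<n. c k * W T \<omega> k))" for T
      by (intro M.integrable_iexp) auto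
    have N1: "complex_integrable N (\<lambda>\<omega>. iexp (\<Sum>k<n. c k * G \<omega> k))"
      by (intro N.integrable_iexp) auto
    have M2: "(\<integral>\<omega>. a * cos (b + (\<Sum>k<n. c k * W T \<omega> k)) \<partial>M)
        = Re (of_real a * iexp b * (\<integral>\<omega>. iexp (\<Sum>k<n. c k * W T \<omega> k) \<partial>M))" for T
      unfolding cosE using M1[of T] by (subst integral_Re) auto
    have N2: "(\<integral>\<omega>. a * cos (b + (\<Sum>k<n. c k * G \<omega> k)) \<partial>N)
        = Re (of_real a * iexp b * (\<integral>\<omega>. iexp (\<Sum>k<n. c k * G \<omega> k) \<partial>N))"
      unfolding cosE using N1 by (subst integral_Re) auto
    show ?case unfolding M2 N2 by (intro tendsto_intros char)
  next
    case (add f g)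
    have bi: "integrable M (\<lambda>\<omega>. h (W T \<omega>))" "integrable N (\<lambda>\<omega>. h (G \<omega>))" if "h \<in> trig_poly" for h T
    proof -
      obtain C where "0 \<le> C" "\<And>x. \<bar>h x\<bar> \<le> C" using trig_poly_bounded[OF \<open>h \<in> trig_poly\<close>] by blast
      then show "integrable M (\<lambda>\<omega>. h (W T \<omega>))" "integrable N (\<lambda>\<omega>. h (G \<omega>))"
        using trig_poly_measurable[OF that]
        by (auto intro!: M.integrable_const_bound[of _ C] N.integrable_const_bound[of _ C])
    qed
    show ?case using add by (simp add: bi tendsto_add)
  qed
qed

lemma (in prob_space) integral_diff_le_on_large_set:
  fixes a b :: "'a \<Rightarrow> real"
  assumes [measurable]: "a \<in> borel_measurable M" "b \<in> borel_measurable M" "A \<in> sets M"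
    and bd: "\<And>\<omega>. \<omega> \<in> space M \<Longrightarrow> \<bar>a \<omega>\<bar> \<le> B" "\<And>\<omega>. \<omega> \<in> space M \<Longrightarrow> \<bar>b \<omega>\<bar> \<le> B'"
    and A: "\<And>\<omega>. \<omega> \<in> A \<Longrightarrow> \<bar>a \<omega> - b \<omega>\<bar> \<le> e" and e: "0 \<le> e"
  shows "\<bar>(\<integral>\<omega>. a \<omega> \<partial>M) - (\<integral>\<omega>. b \<omega> \<partial>M)\<bar> \<le> e + (B + B') * prob (space M - A)"
proof -
  have int: "integrable M a" "integrable M b"
    using bd by (auto intro: integrable_const_bound[of _ B] integrable_const_bound[of _ B'])
  have "\<bar>(\<integral>\<omega>. a \<omega> \<partial>M) - (\<integral>\<omega>. b \<omega> \<partial>M)\<bar> = \<bar>\<integral>\<omega>. a \<omega> - b \<omega> \<partial>M\<bar>" using int by simp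
  also have "\<dots> \<le> (\<integral>\<omega>. \<bar>a \<omega> - b \<omega>\<bar> \<partial>M)" by (rule integral_abs_bound)
  also have "\<dots> \<le> (\<integral>\<omega>. e + (B + B') * indicator (space M - A) \<omega> \<partial>M)"
  proof (rule integral_mono)
    fix \<omega> assume w: "\<omega> \<in> space M"
    have B: "0 \<le> B" "0 \<le> B'" using bd[OF w] by linarith+
    show "\<bar>a \<omega> - b \<omega>\<bar> \<le> e + (B + B') * indicator (space M - A) \<omega>"
      using A[of \<omega>] bd[OF w] e w by (cases "\<omega> \<in> A") auto
  qed (use int in \<open>auto intro!: integrable_real_indicator simp: less_top[symmetric]\<close>)
  also have "\<dots> = e + (B + B') * prob (space M - A)"
    by (subst Bochner_Integration.integral_add)
       (auto intro!: integrable_real_indicator simp: prob_space less_top[symmetric])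
  finally show ?thesis .
qed

text \<open>Assumption \<open>K\<close> couples tightness with a factorisation: on a compact set the
  functionals \<open>a T\<close> and \<open>a0\<close> are one and the same continuous function of
  the coefficients, and off it only the bound B is known. Approximating that function on K by a
  trigonometric polynomial bounded everywhere makes the exceptional sets cost little.\<close>

theorem tendsto_integral_of_trig_poly:
  fixes W :: "nat \<Rightarrow> 'a \<Rightarrow> nat \<Rightarrow> real" and G :: "'b \<Rightarrow> nat \<Rightarrow> real"
    and a :: "nat \<Rightarrow> 'a \<Rightarrow> real" and a0 :: "'b \<Rightarrow> real"
  assumes M: "prob_space M" and N: "prob_space N"
    and W: "\<And>T k. (\<lambda>\<omega>. W T \<omega> k) \<in> borel_measurable M"
    and G: "\<And>k. (\<lambda>\<omega>. G \<omega> k) \<in> borel_measurable N"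
    and char: "\<And>n c. (\<lambda>T. \<integral>\<omega>. iexp (\<Sum>k<n. c k * W T \<omega> k) \<partial>M) \<longlonglongrightarrow> (\<integral>\<omega>. iexp (\<Sum>k<n. c k * G \<omega> k) \<partial>N)"
    and a [measurable]: "\<And>T. a T \<in> borel_measurable M" and a0 [measurable]: "a0 \<in> borel_measurable N"
    and bd: "\<And>T \<omega>. \<omega> \<in> space M \<Longrightarrow> \<bar>a T \<omega>\<bar> \<le> B" "\<And>\<omega>. \<omega> \<in> space N \<Longrightarrow> \<bar>a0 \<omega>\<bar> \<le> B"
    and K: "\<And>e. 0 < e \<Longrightarrow> \<exists>K f. compact K \<and> continuous_on K f \<and> (\<forall>x\<in>K. \<bar>f x\<bar> \<le> B) \<and>
      (\<forall>T. measure M {\<omega> \<in> space M. W T \<omega> \<notin> K} \<le> e) \<and> measure N {\<omega> \<in> space N. G \<omega> \<notin> K} \<le> e \<and>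
      (\<forall>T. \<forall>\<omega>\<in>space M. W T \<omega> \<in> K \<longrightarrow> a T \<omega> = f (W T \<omega>)) \<and>
      (\<forall>\<omega>\<in>space N. G \<omega> \<in> K \<longrightarrow> a0 \<omega> = f (G \<omega>))"
  shows "(\<lambda>T. \<integral>\<omega>. a T \<omega> \<partial>M) \<longlonglongrightarrow> (\<integral>\<omega>. a0 \<omega> \<partial>N)"
proof (rule LIMSEQ_I)
  fix r :: real assume r: "0 < r"
  interpret M: prob_space M by fact
  interpret N: prob_space N by fact
  have Wm [measurable]: "W T \<in> borel_measurable M" for T
    by (rule measurable_coordinatewise_then_product) (rule W)
  have Gm [measurable]: "G \<in> borel_measurable N"
    by (rule measurable_coordinatewise_then_product) (rule G)
  have B: "0 \<le> B" using M.not_empty bd(1)[of _ 0] by (metis abs_ge_zero all_not_in_conv order_trans)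
  \<comment> \<open>Chosen for \<open>er\<close>: approximation on K and the exceptional event
    together cost at most r/3, once on each side, which leaves r/3 for the convergence of the
    polynomial.\<close>
  define e where "e = min 1 (r / (3 * (2 * B + 2)))"
  have e: "0 < e" "e \<le> 1" using r B by (simp_all add: e_def)
  have er: "e + (B + (B + e)) * e \<le> r / 3"
  proof -
    have "e + (B + (B + e)) * e = (1 + 2 * B + e) * e" by (simp add: algebra_simps)
    also have "\<dots> \<le> (2 * B + 2) * e" using e by (intro mult_right_mono) auto
    also have "\<dots> \<le> (2 * B + 2) * (r / (3 * (2 * B + 2)))" using B by (intro mult_left_mono) (auto simp: e_def)
    also have "\<dots> = r / 3"
    proof -
      have "2 * B + 2 \<noteq> 0" using B by simp
      then show ?thesis by (metis divide_divide_eq_left' mult.commute times_divide_eq_right nonzero_mult_div_cancel_left)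
    qed
    finally show ?thesis .
  qed
  obtain K f where Kf: "compact K" "continuous_on K f" "\<And>x. x \<in> K \<Longrightarrow> \<bar>f x\<bar> \<le> B"
      and PM: "\<And>T. M.prob {\<omega> \<in> space M. W T \<omega> \<notin> K} \<le> e" and PN: "N.prob {\<omega> \<in> space N. G \<omega> \<notin> K} \<le> e"
      and aM: "\<And>T \<omega>. \<omega> \<in> space M \<Longrightarrow> W T \<omega> \<in> K \<Longrightarrow> a T \<omega> = f (W T \<omega>)"
      and aN: "\<And>\<omega>. \<omega> \<in> space N \<Longrightarrow> G \<omega> \<in> K \<Longrightarrow> a0 \<omega> = f (G \<omega>)"
    using K[OF e(1)] by blast
  have [measurable]: "K \<in> sets borel" using Kf(1) by (intro borel_closed compact_imp_closed)
  obtain g where g: "g \<in> trig_poly" "\<And>x. x \<in> K \<Longrightarrow> \<bar>f x - g x\<bar> < e" "\<And>x. \<bar>g x\<bar> \<le> B + e"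
    using trig_poly_approx[OF Kf(1,2) B Kf(3) e(1)] by blast
  have [measurable]: "g \<in> borel_measurable borel" by (rule trig_poly_measurable[OF g(1)])
  have cM: "space M - {\<omega> \<in> space M. W T \<omega> \<in> K} = {\<omega> \<in> space M. W T \<omega> \<notin> K}" for T by auto
  have cN: "space N - {\<omega> \<in> space N. G \<omega> \<in> K} = {\<omega> \<in> space N. G \<omega> \<notin> K}" by auto
  have 1: "\<bar>(\<integral>\<omega>. a T \<omega> \<partial>M) - (\<integral>\<omega>. g (W T \<omega>) \<partial>M)\<bar> \<le> r / 3" for T
  proof -
    have "\<bar>(\<integral>\<omega>. a T \<omega> \<partial>M) - (\<integral>\<omega>. g (W T \<omega>) \<partial>M)\<bar>
       \<le> e + (B + (B + e)) * M.prob (space M - {\<omega> \<in> space M. W T \<omega> \<in> K})"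
      using bd(1) g aM e by (intro M.integral_diff_le_on_large_set) (auto intro: less_imp_le)
    also have "\<dots> \<le> e + (B + (B + e)) * e"
      unfolding cM using PM[of T] B e by (intro add_left_mono mult_left_mono) auto
    finally show ?thesis using er by simp
  qed
  have 2: "\<bar>(\<integral>\<omega>. a0 \<omega> \<partial>N) - (\<integral>\<omega>. g (G \<omega>) \<partial>N)\<bar> \<le> r / 3"
  proof -
    have "\<bar>(\<integral>\<omega>. a0 \<omega> \<partial>N) - (\<integral>\<omega>. g (G \<omega>) \<partial>N)\<bar>
       \<le> e + (B + (B + e)) * N.prob (space N - {\<omega> \<in> space N. G \<omega> \<in> K})"
      using bd(2) g aN e by (intro N.integral_diff_le_on_large_set) (auto intro: less_imp_le)
    also have "\<dots> \<le> e + (B + (B + e)) * e"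
      unfolding cN using PN B e by (intro add_left_mono mult_left_mono) auto
    finally show ?thesis using er by simp
  qed
  have "(\<lambda>T. \<integral>\<omega>. g (W T \<omega>) \<partial>M) \<longlonglongrightarrow> (\<integral>\<omega>. g (G \<omega>) \<partial>N)"
    by (rule trig_poly_tendsto[OF M N W G char g(1)])
  then obtain m where m: "\<And>T. T \<ge> m \<Longrightarrow> \<bar>(\<integral>\<omega>. g (W T \<omega>) \<partial>M) - (\<integral>\<omega>. g (G \<omega>) \<partial>N)\<bar> < r / 3"
    using LIMSEQ_D[of "\<lambda>T. \<integral>\<omega>. g (W T \<omega>) \<partial>M" _ "r / 3"] r by fastforce
  show "\<exists>no. \<forall>T\<ge>no. norm ((\<integral>\<omega>. a T \<omega> \<partial>M) - (\<integral>\<omega>. a0 \<omega> \<partial>N)) < r"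
  proof (intro exI[of _ m] allI impI)
    fix T assume "T \<ge> m"
    from m[OF this] 1[of T] 2 show "norm ((\<integral>\<omega>. a T \<omega> \<partial>M) - (\<integral>\<omega>. a0 \<omega> \<partial>N)) < r"
      unfolding real_norm_def by linarith
  qed
qed

text \<open>Tychonoff's theorem for a product of compact intervals.\<close>

lemma compact_box: "compact {x :: nat \<Rightarrow> real. \<forall>k. \<bar>x k\<bar> \<le> b k}"
proof -
  have "compact_space (product_topology (\<lambda>k. subtopology euclidean {- b k..b k}) UNIV)"
    by (intro compact_space_product_topology[THEN iffD2] disjI2 ballI)
       (simp add: compact_space_subtopology compactin_euclidean_iff)
  then have "compactin (product_topology (\<lambda>k. euclidean) UNIV) (PiE UNIV (\<lambda>k. {- b k..b k}))"
    using compactin_PiE[of "\<lambda>k. euclidean" UNIV "\<lambda>k. {- b k..b k}"] by simp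
  moreover have "PiE UNIV (\<lambda>k. {- b k..b k}) = {x. \<forall>k. \<bar>x k\<bar> \<le> b k}"
    by (auto simp: PiE_UNIV_domain abs_le_iff Pi_iff) (metis minus_le_iff)+
  ultimately show ?thesis by (simp add: euclidean_product_topology)
qed

section \<open>Gaussian sequences with given covariances\<close>

lemma integrable_mult_L2:
  fixes f g :: "'a \<Rightarrow> real"
  assumes [measurable]: "f \<in> borel_measurable M" "g \<in> borel_measurable M"
    and "integrable M (\<lambda>x. (f x)\<^sup>2)" "integrable M (\<lambda>x. (g x)\<^sup>2)"
  shows "integrable M (\<lambda>x. f x * g x)"
proof (rule Bochner_Integration.integrable_bound)
  show "integrable M (\<lambda>x. (f x)\<^sup>2 + (g x)\<^sup>2)" using assms by simp
  show "AE x in M. norm (f x * g x) \<le> norm ((f x)\<^sup>2 + (g x)\<^sup>2)"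
  proof (rule AE_I2)
    fix x
    have "2 * (\<bar>f x\<bar> * \<bar>g x\<bar>) \<le> \<bar>f x\<bar>\<^sup>2 + \<bar>g x\<bar>\<^sup>2"
      using zero_le_power2[of "\<bar>f x\<bar> - \<bar>g x\<bar>"] by (simp add: power2_diff)
    moreover have "0 \<le> \<bar>f x\<bar> * \<bar>g x\<bar>" by simp
    ultimately have "\<bar>f x\<bar> * \<bar>g x\<bar> \<le> \<bar>f x\<bar>\<^sup>2 + \<bar>g x\<bar>\<^sup>2" by linarith
    then show "norm (f x * g x) \<le> norm ((f x)\<^sup>2 + (g x)\<^sup>2)" by (simp add: abs_mult)
  qed
qed measurable

lemma integrable_sum_sq:
  fixes f :: "'i \<Rightarrow> 'a \<Rightarrow> real"
  assumes [measurable]: "\<And>i. i \<in> I \<Longrightarrow> f i \<in> borel_measurable M"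
    and "\<And>i. i \<in> I \<Longrightarrow> integrable M (\<lambda>x. (f i x)\<^sup>2)"
  shows "integrable M (\<lambda>x. (\<Sum>i\<in>I. c i * f i x)\<^sup>2)"
proof -
  have "integrable M (\<lambda>x. \<Sum>i\<in>I. \<Sum>j\<in>I. c i * c j * (f i x * f j x))"
    using assms by (intro Bochner_Integration.integrable_sum integrable_mult_right integrable_mult_L2) auto
  then show ?thesis
    by (simp add: power2_eq_square sum_product mult_ac)
qed

text \<open>Where the residual vanishes, the division by zero makes the corresponding function of
  the orthogonal system vanish identically.\<close>

fun gram_schmidt :: "'a measure \<Rightarrow> (nat \<Rightarrow> 'a \<Rightarrow> real) \<Rightarrow> nat \<Rightarrow> 'a \<Rightarrow> real" where
  "gram_schmidt M D k =
    (let r = (\<lambda>x. D k x - (\<Sum>j<k. (\<integral>y. D k y * gram_schmidt M D j y \<partial>M) * gram_schmidt M D j x))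
     in (\<lambda>x. r x / sqrt (\<integral>y. (r y)\<^sup>2 \<partial>M)))"

declare gram_schmidt.simps [simp del]

text \<open>In an orthogonal system every second moment of a combination of the \<open>D k\<close>
  becomes a sum of squares. Here \<open>\<nu> j\<close> is the squared norm of the j-th function of
  the system and is 0 or 1, the value 0 occurring where \<open>D j\<close> depends linearly on its
  predecessors; being idempotent it may stand inside the square.\<close>

lemma gram_schmidt_expansion:
  fixes D :: "nat \<Rightarrow> 'a \<Rightarrow> real"
  assumes D [measurable]: "\<And>k. D k \<in> borel_measurable M"
    and sq: "\<And>k. integrable M (\<lambda>x. (D k x)\<^sup>2)"
  obtains a :: "nat \<Rightarrow> nat \<Rightarrow> real" and \<nu> :: "nat \<Rightarrow> real" where
    "\<And>n c. (\<integral>x. (\<Sum>k<n. c k * D k x)\<^sup>2 \<partial>M) = (\<Sum>j<n. (\<nu> j * (\<Sum>k<n. c k * a k j))\<^sup>2)"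
    "\<And>k j. k < j \<Longrightarrow> a k j = 0"
proof -
  define e where "e = gram_schmidt M D"
  define r where "r k x = D k x - (\<Sum>j<k. (\<integral>y. D k y * e j y \<partial>M) * e j x)" for k x
  define \<rho> where "\<rho> k = sqrt (\<integral>y. (r k y)\<^sup>2 \<partial>M)" for k
  have e: "e k = (\<lambda>x. r k x / \<rho> k)" for k
    unfolding \<rho>_def r_def e_def by (subst gram_schmidt.simps) (simp add: Let_def)
  have em: "e k \<in> borel_measurable M \<and> integrable M (\<lambda>x. (e k x)\<^sup>2)
      \<and> r k \<in> borel_measurable M \<and> integrable M (\<lambda>x. (r k x)\<^sup>2)" for k
  proof (induction k rule: less_induct)
    case (less k)
    let ?f = "\<lambda>j. if j = k then D k else e j"
    let ?c = "\<lambda>j. if j = k then 1 else - (\<integral>y. D k y * e j y \<partial>M)"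
    have rk: "r k = (\<lambda>x. \<Sum>j<Suc k. ?c j * ?f j x)"
      unfolding r_def by (auto simp: fun_eq_iff sum_negf[symmetric] intro!: sum.cong)
    have "r k \<in> borel_measurable M"
      unfolding rk using less D by (intro borel_measurable_sum borel_measurable_times) auto
    moreover have "integrable M (\<lambda>x. (r k x)\<^sup>2)"
      unfolding rk using less D sq by (intro integrable_sum_sq) (auto simp: less_Suc_eq)
    ultimately show ?case unfolding e by (simp add: power_divide)
  qed
  note [measurable] = em[THEN conjunct1] em[THEN conjunct2, THEN conjunct2, THEN conjunct1]
  have esq: "integrable M (\<lambda>x. (e k x)\<^sup>2)" and rsq: "integrable M (\<lambda>x. (r k x)\<^sup>2)" for k using em by auto
  have ipi: "integrable M (\<lambda>x. e i x * e j x)" "integrable M (\<lambda>x. D i x * e j x)" for i j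
    by (intro integrable_mult_L2 esq sq; measurable)+
  have \<rho>sq: "(\<integral>y. (r k y)\<^sup>2 \<partial>M) = (\<rho> k)\<^sup>2" for k by (simp add: \<rho>_def)
  have norm: "e k = (\<lambda>x. 0) \<or> (\<integral>x. e k x * e k x \<partial>M) = 1" for k
  proof (cases "\<rho> k = 0")
    case True then show ?thesis by (simp add: e)
  next
    case False
    have "(\<integral>x. e k x * e k x \<partial>M) = (\<integral>y. (r k y)\<^sup>2 \<partial>M) / (\<rho> k)\<^sup>2"
      by (simp add: e power2_eq_square)
    with False show ?thesis by (simp add: \<rho>sq)
  qed
  have sym: "(\<integral>x. e i x * e j x \<partial>M) = (\<integral>x. e j x * e i x \<partial>M)" for i j
    by (subst mult.commute) simp
  have orth: "\<forall>j<k. (\<integral>x. e k x * e j x \<partial>M) = 0" for k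
  proof (induction k rule: less_induct)
    case (less k)
    have o: "(\<integral>x. e i x * e j x \<partial>M) = 0" if "i < k" "j < k" "i \<noteq> j" for i j
      using less[of i] less[of j] that sym[of i j] by (cases i j rule: linorder_cases) auto
    show ?case
    proof safe
      fix j assume j: "j < k"
      have "(\<integral>x. r k x * e j x \<partial>M) = (\<integral>x. D k x * e j x - (\<Sum>i<k. (\<integral>y. D k y * e i y \<partial>M) * (e i x * e j x)) \<partial>M)"
        unfolding r_def by (simp add: left_diff_distrib sum_distrib_right mult.assoc)
      also have "\<dots> = (\<integral>x. D k x * e j x \<partial>M) - (\<Sum>i<k. (\<integral>y. D k y * e i y \<partial>M) * (\<integral>x. e i x * e j x \<partial>M))"
        using ipi by simp
      also have "(\<Sum>i<k. (\<integral>y. D k y * e i y \<partial>M) * (\<integral>x. e i x * e j x \<partial>M))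
         = (\<Sum>i<k. if i = j then (\<integral>y. D k y * e j y \<partial>M) * (\<integral>x. e j x * e j x \<partial>M) else 0)"
        using o j by (intro sum.cong) auto
      also have "\<dots> = (\<integral>y. D k y * e j y \<partial>M) * (\<integral>x. e j x * e j x \<partial>M)" using j by simp
      also have "\<dots> = (\<integral>x. D k x * e j x \<partial>M)" using norm[of j] by auto
      finally have "(\<integral>x. r k x * e j x \<partial>M) = 0" by simp
      then show "(\<integral>x. e k x * e j x \<partial>M) = 0" unfolding e[of k] by simp
    qed
  qed
  have orth': "(\<integral>x. e i x * e j x \<partial>M) = 0" if "i \<noteq> j" for i j
    using orth[of i] orth[of j] that sym[of i j] by (cases i j rule: linorder_cases) auto
  define a where "a k j = (if j < k then (\<integral>y. D k y * e j y \<partial>M) else if j = k then \<rho> k else 0)" for k j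
  define \<nu> where "\<nu> j = (\<integral>x. e j x * e j x \<partial>M)" for j
  have \<nu>: "\<nu> j * \<nu> j = \<nu> j" for j using norm[of j] by (auto simp: \<nu>_def)
  \<comment> \<open>Only almost everywhere: when \<open>\<rho> k = 0\<close>, a vanishing second
    moment makes the residual zero off a null set.\<close>
  have exp: "AE x in M. D k x = (\<Sum>j<n. a k j * e j x)" if "k < n" for k n
  proof -
    have "AE x in M. r k x = \<rho> k * e k x"
    proof (cases "\<rho> k = 0")
      case True
      then have "(\<integral>y. (r k y)\<^sup>2 \<partial>M) = 0" by (simp add: \<rho>sq)
      then have "AE x in M. (r k x)\<^sup>2 = 0"
        using integral_nonneg_eq_0_iff_AE[OF rsq[of k]] by simp
      then show ?thesis using True by auto
    qed (simp add: e)
    moreover have "(\<Sum>j<n. a k j * e j x) = (\<Sum>j<k. (\<integral>y. D k y * e j y \<partial>M) * e j x) + \<rho> k * e k x" for x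
    proof -
      have "(\<Sum>j<n. a k j * e j x) = (\<Sum>j<Suc k. a k j * e j x)"
        using that by (intro sum.mono_neutral_right) (auto simp: a_def)
      also have "\<dots> = (\<Sum>j<k. (\<integral>y. D k y * e j y \<partial>M) * e j x) + \<rho> k * e k x" by (simp add: a_def)
      finally show ?thesis .
    qed
    ultimately show ?thesis by (auto simp: r_def elim!: eventually_mono)
  qed
  show thesis
  proof
    fix n :: nat and c :: "nat \<Rightarrow> real"
    define b where "b j = (\<Sum>k<n. c k * a k j)" for j
    have "AE x in M. \<forall>k\<in>{..<n}. D k x = (\<Sum>j<n. a k j * e j x)"
      by (intro AE_ball_countable[THEN iffD2] ballI exp) auto
    then have "AE x in M. (\<Sum>k<n. c k * D k x)\<^sup>2 = (\<Sum>i<n. \<Sum>j<n. b i * b j * (e i x * e j x))"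
    proof eventually_elim
      fix x assume "\<forall>k\<in>{..<n}. D k x = (\<Sum>j<n. a k j * e j x)"
      then have "(\<Sum>k<n. c k * D k x) = (\<Sum>k<n. \<Sum>j<n. c k * a k j * e j x)"
        by (simp add: sum_distrib_left mult.assoc)
      also have "\<dots> = (\<Sum>j<n. b j * e j x)"
        by (subst sum.swap) (simp add: b_def sum_distrib_right)
      finally show "(\<Sum>k<n. c k * D k x)\<^sup>2 = (\<Sum>i<n. \<Sum>j<n. b i * b j * (e i x * e j x))"
        by (simp add: power2_eq_square sum_product mult_ac)
    qed
    then have "(\<integral>x. (\<Sum>k<n. c k * D k x)\<^sup>2 \<partial>M) = (\<integral>x. (\<Sum>i<n. \<Sum>j<n. b i * b j * (e i x * e j x)) \<partial>M)"
      by (intro integral_cong_AE) auto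
    also have "\<dots> = (\<Sum>i<n. \<Sum>j<n. b i * b j * (\<integral>x. e i x * e j x \<partial>M))"
      using ipi by simp
    also have "\<dots> = (\<Sum>i<n. \<Sum>j<n. if j = i then b i * b i * \<nu> i else 0)"
      using orth' by (intro sum.cong) (auto simp: \<nu>_def)
    also have "\<dots> = (\<Sum>i<n. (\<nu> i * b i)\<^sup>2)"
      by (intro sum.cong) (simp_all add: power2_eq_square mult_ac \<nu> flip: mult.assoc[of "\<nu> _" "\<nu> _"])
    finally show "(\<integral>x. (\<Sum>k<n. c k * D k x)\<^sup>2 \<partial>M) = (\<Sum>j<n. (\<nu> j * (\<Sum>k<n. c k * a k j))\<^sup>2)"
      by (simp add: b_def)
  next
    show "a k j = 0" if "k < j" for k j using that by (simp add: a_def)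
  qed
qed

text \<open>The index set is the reals because the theorem asks for a measure on
  \<open>real \<Rightarrow> real\<close>; the coordinates at \<open>real j\<close> serve as a
  sequence of independent standard normal variables.\<close>

definition gauss_space :: "(real \<Rightarrow> real) measure" where
  "gauss_space = PiM UNIV (\<lambda>_. std_normal_distribution)"

lemma prob_space_gauss_space: "prob_space gauss_space"
  unfolding gauss_space_def by (intro prob_space_PiM) (rule real_distribution.axioms(1)[OF real_dist_normal_dist])

lemma gauss_space_coordinate [measurable]: "(\<lambda>x. x i) \<in> borel_measurable gauss_space"
proof -
  have "(\<lambda>x. x i) \<in> gauss_space \<rightarrow>\<^sub>M std_normal_distribution"
    unfolding gauss_space_def by (rule measurable_component_singleton) simp
  then show ?thesis by (simp cong: measurable_cong_sets)
qed

lemma distr_gauss_space: "distr gauss_space borel (\<lambda>x. x i) = std_normal_distribution"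
proof -
  have "distr gauss_space std_normal_distribution (\<lambda>x. x i) = std_normal_distribution"
    unfolding gauss_space_def
    by (rule distr_PiM_component) (auto intro: real_distribution.axioms(1)[OF real_dist_normal_dist])
  moreover have "distr gauss_space borel (\<lambda>x. x i) = distr gauss_space std_normal_distribution (\<lambda>x. x i)"
    by (rule distr_cong) simp_all
  ultimately show ?thesis by simp
qed

lemma char_gauss_space:
  "(\<integral>x. iexp (\<Sum>j<n. b j * x (real j)) \<partial>gauss_space) = exp (- complex_of_real (\<Sum>j<n. (b j)\<^sup>2) / 2)"
proof -
  interpret prob_space gauss_space by (rule prob_space_gauss_space)
  have sets: "sets gauss_space = sets (PiM UNIV (\<lambda>_. borel))"
    unfolding gauss_space_def by (intro sets_PiM_cong) simp_all
  have "distr gauss_space (PiM UNIV (\<lambda>_. borel)) (\<lambda>x. \<lambda>i\<in>UNIV. x i) = distr gauss_space gauss_space (\<lambda>x. x)"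
    by (intro distr_cong) (simp_all add: sets restrict_UNIV)
  also have "\<dots> = PiM UNIV (\<lambda>i. distr gauss_space borel (\<lambda>x. x i))"
    unfolding distr_gauss_space by (simp add: distr_id[unfolded id_def] gauss_space_def)
  finally have "indep_vars (\<lambda>_. borel) (\<lambda>i x. x i) UNIV"
    by (subst indep_vars_iff_distr_eq_PiM') simp_all
  then have "indep_vars (\<lambda>_. borel) (\<lambda>i x. x i) (real ` {..<n})"
    by (rule indep_vars_subset) simp
  \<comment> \<open>The floor recovers the natural number j from the real index
    \<open>real j\<close>.\<close>
  then have "indep_vars (\<lambda>_. borel) (\<lambda>i x. b (nat \<lfloor>i\<rfloor>) * x i) (real ` {..<n})"
    by (rule indep_vars_compose2) simp
  then have "char (distr gauss_space borel (\<lambda>x. \<Sum>i\<in>real ` {..<n}. b (nat \<lfloor>i\<rfloor>) * x i)) 1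
      = (\<Prod>i\<in>real ` {..<n}. char (distr gauss_space borel (\<lambda>x. b (nat \<lfloor>i\<rfloor>) * x i)) 1)"
    by (rule char_distr_sum)
  then have "char (distr gauss_space borel (\<lambda>x. \<Sum>j<n. b j * x (real j))) 1
      = (\<Prod>j<n. char (distr gauss_space borel (\<lambda>x. b j * x (real j))) 1)"
    by (simp add: sum.reindex prod.reindex)
  also have "\<dots> = (\<Prod>j<n. exp (- complex_of_real ((b j)\<^sup>2) / 2))"
  proof (intro prod.cong refl)
    fix j
    have "char (distr gauss_space borel (\<lambda>x. b j * x (real j))) 1 = char (distr gauss_space borel (\<lambda>x. x (real j))) (b j)"
      by (simp add: char_def integral_distr)
    also have "\<dots> = exp (- complex_of_real ((b j)\<^sup>2) / 2)"
      unfolding distr_gauss_space by (simp add: char_std_normal_distribution flip: exp_of_real)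
    finally show "char (distr gauss_space borel (\<lambda>x. b j * x (real j))) 1 = exp (- complex_of_real ((b j)\<^sup>2) / 2)" .
  qed
  also have "\<dots> = exp (- complex_of_real (\<Sum>j<n. (b j)\<^sup>2) / 2)"
    by (simp add: Transcendental.exp_sum[OF finite_lessThan, symmetric] sum_divide_distrib del: of_real_power flip: sum_negf)
  finally show ?thesis by (simp add: char_def integral_distr)
qed

section \<open>Normal laws, the degenerate case included\<close>

lemma normal_law_eq_distr: "0 \<le> \<sigma> \<Longrightarrow> normal_law 0 \<sigma> = distr std_normal_distribution borel (\<lambda>x. \<sigma> * x)"
proof (cases "\<sigma> = 0")
  case True
  interpret real_distribution std_normal_distribution by (rule real_dist_normal_dist)
  show ?thesis using True distr_const[of 0 borel] by (simp add: normal_law_def)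
next
  case False
  assume "0 \<le> \<sigma>"
  interpret real_distribution std_normal_distribution by (rule real_dist_normal_dist)
  have "distributed std_normal_distribution lborel (\<lambda>x. x) std_normal_density"
    by (auto simp: distributed_def distr_id2)
  then have "distributed std_normal_distribution lborel (\<lambda>x. 0 + \<sigma> * x) (normal_density (0 + \<sigma> * 0) (\<bar>\<sigma>\<bar> * 1))"
    using False by (intro normal_density_affine) auto
  then have "distr std_normal_distribution lborel (\<lambda>x. \<sigma> * x) = normal_law 0 \<sigma>"
    using False \<open>0 \<le> \<sigma>\<close> by (simp add: distributed_def normal_law_def)
  then show ?thesis by (metis distr_cong sets_lborel)
qed

lemma distr_eq_normal_law:
  fixes X :: "'b \<Rightarrow> real"
  assumes N: "prob_space N" and X [measurable]: "X \<in> borel_measurable N" and \<sigma>: "0 \<le> \<sigma>"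
    and char: "\<And>t. (\<integral>x. iexp (t * X x) \<partial>N) = exp (- complex_of_real ((t * \<sigma>)\<^sup>2) / 2)"
  shows "distr N borel X = normal_law 0 \<sigma>"
proof -
  interpret N: prob_space N by fact
  interpret S: real_distribution std_normal_distribution by (rule real_dist_normal_dist)
  have 1: "real_distribution (distr N borel X)" by (rule N.real_distribution_distr) simp
  have 2: "real_distribution (normal_law 0 \<sigma>)"
    unfolding normal_law_eq_distr[OF \<sigma>] by (rule S.real_distribution_distr) simp
  have "char (distr N borel X) t = char (normal_law 0 \<sigma>) t" for t
  proof -
    have "char (normal_law 0 \<sigma>) t = char std_normal_distribution (t * \<sigma>)"
      unfolding normal_law_eq_distr[OF \<sigma>] char_def by (subst integral_distr) (simp_all add: mult.assoc)
    also have "\<dots> = exp (- complex_of_real ((t * \<sigma>)\<^sup>2) / 2)"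
      by (simp add: char_std_normal_distribution flip: exp_of_real)
    also have "\<dots> = (\<integral>x. iexp (t * X x) \<partial>N)" by (rule char[symmetric])
    also have "\<dots> = char (distr N borel X) t"
      unfolding char_def by (subst integral_distr) simp_all
    finally show ?thesis ..
  qed
  then show ?thesis by (intro Levy_uniqueness 1 2) auto
qed

lemma normal_law_moments:
  fixes X :: "'b \<Rightarrow> real"
  assumes X [measurable]: "X \<in> borel_measurable N" and distr: "distr N borel X = normal_law 0 \<sigma>" and \<sigma>: "0 \<le> \<sigma>"
  shows "integrable N (\<lambda>x. (X x)\<^sup>2)" "(\<integral>x. X x \<partial>N) = 0" "(\<integral>x. (X x)\<^sup>2 \<partial>N) = \<sigma>\<^sup>2"
proof -
  note eq = distr[unfolded normal_law_eq_distr[OF \<sigma>]]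
  have "integrable (distr N borel X) (\<lambda>x. x\<^sup>2)"
    unfolding eq by (subst integrable_distr_eq) (simp_all add: power_mult_distrib integrable_std_normal_distribution_moment)
  then show "integrable N (\<lambda>x. (X x)\<^sup>2)" by (subst (asm) integrable_distr_eq) simp_all
  have "(\<integral>x. X x \<partial>N) = (\<integral>x. x \<partial>distr N borel X)" by (subst integral_distr) simp_all
  also have "\<dots> = \<sigma> * (\<integral>x. x \<partial>std_normal_distribution)" unfolding eq by (subst integral_distr) simp_all
  also have "\<dots> = 0" using integral_std_normal_distribution_moment_odd[of 1] by simp
  finally show "(\<integral>x. X x \<partial>N) = 0" .
  have "(\<integral>x. (X x)\<^sup>2 \<partial>N) = (\<integral>x. x\<^sup>2 \<partial>distr N borel X)" by (subst integral_distr) simp_all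
  also have "\<dots> = \<sigma>\<^sup>2 * (\<integral>x. x\<^sup>2 \<partial>std_normal_distribution)"
    unfolding eq by (subst integral_distr) (simp_all add: power_mult_distrib)
  also have "\<dots> = \<sigma>\<^sup>2" using std_normal_distribution_even_moments(1)[of 1] by (simp add: fact_numeral)
  finally show "(\<integral>x. (X x)\<^sup>2 \<partial>N) = \<sigma>\<^sup>2" .
qed

text \<open>Replacing the orthogonal functions in the expansion of D by independent standard normals
  keeps all second moments; triangularity makes each \<open>G k\<close> a finite sum.\<close>

lemma gaussian_sequence_exists:
  fixes D :: "nat \<Rightarrow> 'a \<Rightarrow> real"
  assumes D [measurable]: "\<And>k. D k \<in> borel_measurable M"
    and sq: "\<And>k. integrable M (\<lambda>x. (D k x)\<^sup>2)"
  obtains G :: "nat \<Rightarrow> (real \<Rightarrow> real) \<Rightarrow> real" where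
    "\<And>k. G k \<in> borel_measurable gauss_space"
    "\<And>n c. (\<integral>x. iexp (\<Sum>k<n. c k * G k x) \<partial>gauss_space)
       = exp (- complex_of_real (\<integral>x. (\<Sum>k<n. c k * D k x)\<^sup>2 \<partial>M) / 2)"
proof -
  obtain a :: "nat \<Rightarrow> nat \<Rightarrow> real" and \<nu> :: "nat \<Rightarrow> real" where
    cov: "\<And>n c. (\<integral>x. (\<Sum>k<n. c k * D k x)\<^sup>2 \<partial>M) = (\<Sum>j<n. (\<nu> j * (\<Sum>k<n. c k * a k j))\<^sup>2)"
    and tri: "\<And>k j. k < j \<Longrightarrow> a k j = 0"
    by (rule gram_schmidt_expansion[of D, OF D sq]) (rule that, assumption+)
  define G where "G k x = (\<Sum>j<Suc k. \<nu> j * a k j * x (real j))" for k and x :: "real \<Rightarrow> real"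
  show thesis
  proof
    show "G k \<in> borel_measurable gauss_space" for k unfolding G_def by measurable
    fix n :: nat and c :: "nat \<Rightarrow> real"
    have "(\<Sum>k<n. c k * G k x) = (\<Sum>j<n. (\<nu> j * (\<Sum>k<n. c k * a k j)) * x (real j))" for x
    proof -
      have "G k x = (\<Sum>j<n. \<nu> j * a k j * x (real j))" if "k < n" for k
        unfolding G_def by (rule sum.mono_neutral_left) (use that in \<open>auto simp: tri\<close>)
      then have "(\<Sum>k<n. c k * G k x) = (\<Sum>k<n. \<Sum>j<n. \<nu> j * (c k * a k j) * x (real j))"
        by (simp add: sum_distrib_left mult.assoc mult.left_commute)
      also have "\<dots> = (\<Sum>j<n. \<Sum>k<n. \<nu> j * (c k * a k j) * x (real j))" by (rule sum.swap)
      also have "\<dots> = (\<Sum>j<n. (\<nu> j * (\<Sum>k<n. c k * a k j)) * x (real j))"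
        by (simp only: sum_distrib_left[symmetric] sum_distrib_right[symmetric])
      finally show ?thesis .
    qed
    then show "(\<integral>x. iexp (\<Sum>k<n. c k * G k x) \<partial>gauss_space)
       = exp (- complex_of_real (\<integral>x. (\<Sum>k<n. c k * D k x)\<^sup>2 \<partial>M) / 2)"
      by (simp only: cov char_gauss_space)
  qed
qed

section \<open>Random series in the space of continuous functions\<close>

lemma topspace_C01: "topspace C01 = {f. f \<in> extensional {0..1} \<and> continuous_on {0..1} f}"
proof -
  have "bounded (f ` {0..1})" if "continuous_on {0..1} f" for f :: "real \<Rightarrow> real"
    using that by (intro compact_imp_bounded compact_continuous_image) auto
  then show ?thesis
    by (auto simp: C01_def)
qed

lemma restrict_in_C01: "continuous_on {0..1} f \<Longrightarrow> restrict f {0..1} \<in> topspace C01"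
  by (auto simp: topspace_C01 elim: continuous_on_eq)

abbreviation "C01_space \<equiv> cfunspace (top_of_set {0..1::real}) (euclidean_metric :: real metric)"

lemma mspace_C01: "mspace C01_space = topspace C01"
  by (simp add: C01_def)

lemma continuous_map_into_C01:
  fixes \<Phi> :: "'x::topological_space \<Rightarrow> real \<Rightarrow> real"
  assumes top: "\<And>x. x \<in> K \<Longrightarrow> \<Phi> x \<in> topspace C01"
    and unif: "\<And>x e. x \<in> K \<Longrightarrow> 0 < e \<Longrightarrow>
      \<exists>U. open U \<and> x \<in> U \<and> (\<forall>y\<in>U \<inter> K. \<forall>u\<in>{0..1}. \<bar>\<Phi> x u - \<Phi> y u\<bar> \<le> e)"
  shows "continuous_map (top_of_set K) C01 \<Phi>"
proof -
  interpret Metric_space "mspace C01_space" "mdist C01_space" by (rule Metric_space_mspace_mdist)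
  show ?thesis
    unfolding C01_def mtopology_of_def continuous_map_to_metric
  proof (intro ballI allI impI)
    fix x and e :: real assume x: "x \<in> topspace (top_of_set K)" and e: "0 < e"
    then obtain U where U: "open U" "x \<in> U" "\<And>y u. y \<in> U \<inter> K \<Longrightarrow> u \<in> {0..1} \<Longrightarrow> \<bar>\<Phi> x u - \<Phi> y u\<bar> \<le> e / 2"
      using unif[of x "e / 2"] by auto
    show "\<exists>U. openin (top_of_set K) U \<and> x \<in> U \<and> (\<forall>y\<in>U. \<Phi> y \<in> mball (\<Phi> x) e)"
    proof (intro exI[of _ "K \<inter> U"] conjI ballI)
      fix y assume y: "y \<in> K \<inter> U"
      have "mdist C01_space (\<Phi> x) (\<Phi> y) \<le> e / 2"
        using e U(3)[of y] y by (intro mdist_cfunspace_le) (auto simp: dist_real_def)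
      moreover have "\<Phi> x \<in> mspace C01_space" "\<Phi> y \<in> mspace C01_space"
        unfolding mspace_C01 using x y top by auto
      ultimately show "\<Phi> y \<in> mball (\<Phi> x) e"
        using e unfolding in_mball by linarith
    qed (use U x in auto)
  qed
qed

lemma continuous_map_from_C01:
  fixes F :: "(real \<Rightarrow> real) \<Rightarrow> real"
  assumes "\<And>f e. f \<in> topspace C01 \<Longrightarrow> 0 < e \<Longrightarrow>
     \<exists>d>0. \<forall>g\<in>topspace C01. (\<forall>u\<in>{0..1}. \<bar>f u - g u\<bar> \<le> d) \<longrightarrow> \<bar>F f - F g\<bar> < e"
  shows "continuous_map C01 euclideanreal F"
proof -
  interpret Metric_space "mspace C01_space" "mdist C01_space" by (rule Metric_space_mspace_mdist)
  have "\<exists>d>0. \<forall>g. g \<in> mspace C01_space \<and> mdist C01_space f g < d \<longrightarrow> dist (F f) (F g) < e"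
    if f: "f \<in> mspace C01_space" and e: "0 < e" for f e
  proof -
    obtain d where d: "d > 0"
        "\<And>g. g \<in> topspace C01 \<Longrightarrow> (\<And>u. u \<in> {0..1} \<Longrightarrow> \<bar>f u - g u\<bar> \<le> d) \<Longrightarrow> \<bar>F f - F g\<bar> < e"
      using assms[of f e] f e unfolding mspace_C01 by blast
    have "dist (F f) (F g) < e" if g: "g \<in> mspace C01_space" and fg: "mdist C01_space f g < d" for g
      unfolding dist_real_def
    proof (rule d(2))
      show "g \<in> topspace C01" using g unfolding mspace_C01 .
      fix u :: real assume "u \<in> {0..1}"
      then show "\<bar>f u - g u\<bar> \<le> d"
        using mdist_cfunspace_imp_mdist_le[OF f g less_imp_le[OF fg], of u] by (simp add: dist_real_def)
    qed
    with d(1) show ?thesis by blast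
  qed
  then have "continuous_map mtopology Met_TC.mtopology F"
    unfolding metric_continuous_map[OF Met_TC.Metric_space_axioms] by blast
  then show ?thesis by (simp only: C01_def mtopology_of_def mtopology_is_euclidean)
qed

lemma space_borel_of [simp]: "space (borel_of S) = topspace S"
  and sets_borel_of_openin: "openin S U \<Longrightarrow> U \<in> sets (borel_of S)"
proof -
  have sub: "{U. openin S U} \<subseteq> Pow (topspace S)" by (auto dest: openin_subset)
  show "space (borel_of S) = topspace S" unfolding borel_of_def by (simp add: space_measure_of_conv)
  show "openin S U \<Longrightarrow> U \<in> sets (borel_of S)"
    unfolding borel_of_def sets_measure_of[OF sub] by auto
qed

lemma measurable_borel_ofI:
  assumes "\<And>x. x \<in> space M \<Longrightarrow> f x \<in> topspace S"
    and "\<And>U. openin S U \<Longrightarrow> f -` U \<inter> space M \<in> sets M"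
  shows "f \<in> M \<rightarrow>\<^sub>M borel_of S"
  unfolding borel_of_def by (rule measurable_measure_of) (use assms in \<open>auto dest: openin_subset\<close>)

lemma continuous_map_borel_of:
  fixes F :: "'c \<Rightarrow> real"
  assumes "continuous_map S euclideanreal F" shows "F \<in> borel_measurable (borel_of S)"
proof (rule borel_measurableI)
  fix U :: "real set" assume "open U"
  then have "openin S {x \<in> topspace S. F x \<in> U}"
    using assms by (auto simp: continuous_map_def)
  then show "F -` U \<inter> space (borel_of S) \<in> sets (borel_of S)"
    by (intro sets_borel_of_openin) (auto simp: vimage_def Int_def conj_commute)
qed

text \<open>Meant for path-valued functions of discrete data: when every set of data values is
  measurable, a map of them into any topological space is Borel measurable.\<close>

lemma measurable_countable_range_borel_of:
  assumes f: "f \<in> M \<rightarrow>\<^sub>M count_space UNIV" and "\<And>x. x \<in> space M \<Longrightarrow> g (f x) \<in> topspace S"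
  shows "(\<lambda>x. g (f x)) \<in> M \<rightarrow>\<^sub>M borel_of S"
proof (rule measurable_borel_ofI)
  fix U assume "openin S U"
  have "f -` (g -` U) \<inter> space M \<in> sets M" by (rule measurable_sets[OF f]) simp
  then show "(\<lambda>x. g (f x)) -` U \<inter> space M \<in> sets M" by (simp add: vimage_def)
qed (use assms in auto)

section \<open>Geometric boxes and series with coefficients in them\<close>

definition geom_box :: "real \<Rightarrow> real \<Rightarrow> (nat \<Rightarrow> real) set" where
  "geom_box \<rho> R = {x. \<forall>k. \<bar>x k\<bar> \<le> R * \<rho> ^ k}"

lemma compact_geom_box: "compact (geom_box \<rho> R)"
  unfolding geom_box_def by (rule compact_box)

text \<open>Chebyshev in each coordinate and a union bound: dividing \<open>\<rho> ^ (4 * k)\<close>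
  by the square of the side leaves the k-th power of \<open>\<rho>\<^sup>2\<close>, whose sum is the
  factor \<open>1 / (1 - \<rho>\<^sup>2)\<close>.\<close>

lemma (in prob_space) prob_not_in_geom_box:
  fixes Z :: "'a \<Rightarrow> nat \<Rightarrow> real"
  assumes Z [measurable]: "\<And>k. (\<lambda>\<omega>. Z \<omega> k) \<in> borel_measurable M"
    and sq: "\<And>k. integrable M (\<lambda>\<omega>. (Z \<omega> k)\<^sup>2)" "\<And>k. (\<integral>\<omega>. (Z \<omega> k)\<^sup>2 \<partial>M) \<le> C * \<rho> ^ (4 * k)"
    and \<rho>: "0 < \<rho>" "\<rho> < 1" and R: "0 < R"
  shows "prob {\<omega> \<in> space M. Z \<omega> \<notin> geom_box \<rho> R} \<le> C / (R\<^sup>2 * (1 - \<rho>\<^sup>2))"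
proof -
  let ?A = "\<lambda>k. {\<omega> \<in> space M. R * \<rho> ^ k \<le> \<bar>Z \<omega> k\<bar>}"
  have le: "prob (?A k) \<le> C / R\<^sup>2 * (\<rho>\<^sup>2) ^ k" for k
  proof -
    have "prob (?A k) \<le> (\<integral>\<omega>. (Z \<omega> k)\<^sup>2 \<partial>M) / (R * \<rho> ^ k)\<^sup>2"
      using R \<rho> by (intro second_moment_method sq Z) auto
    also have "\<dots> \<le> C * \<rho> ^ (4 * k) / (R * \<rho> ^ k)\<^sup>2"
      by (intro divide_right_mono sq) auto
    also have "\<dots> = C / R\<^sup>2 * (\<rho>\<^sup>2) ^ k"
    proof -
      have "\<rho> ^ (4 * k) = (\<rho> ^ k)\<^sup>2 * (\<rho>\<^sup>2) ^ k" by (simp flip: power_mult power_add)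
      then show ?thesis using \<rho> R by (simp add: power_mult_distrib)
    qed
    finally show ?thesis .
  qed
  have r: "\<bar>\<rho>\<^sup>2\<bar> < 1" using \<rho> by (simp add: power_less_one_iff abs_square_less_1)
  have sm: "summable (\<lambda>k. C / R\<^sup>2 * (\<rho>\<^sup>2) ^ k)"
    using r by (intro summable_mult summable_geometric) simp
  have sA: "summable (\<lambda>k. prob (?A k))"
    by (rule summable_comparison_test'[OF sm]) (use le in simp)
  have "prob {\<omega> \<in> space M. Z \<omega> \<notin> geom_box \<rho> R} \<le> prob (\<Union>k. ?A k)"
    by (intro finite_measure_mono) (auto simp: geom_box_def not_le intro: less_imp_le)
  also have "\<dots> \<le> (\<Sum>k. prob (?A k))"
    by (intro finite_measure_subadditive_countably sA) auto
  also have "\<dots> \<le> (\<Sum>k. C / R\<^sup>2 * (\<rho>\<^sup>2) ^ k)" by (intro suminf_le le sA sm)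
  also have "\<dots> = C / R\<^sup>2 * (1 / (1 - \<rho>\<^sup>2))"
    using r by (subst suminf_mult) (simp_all add: suminf_geometric summable_geometric)
  finally show ?thesis by simp
qed

definition series_path :: "(nat \<Rightarrow> real \<Rightarrow> real) \<Rightarrow> (nat \<Rightarrow> real) \<Rightarrow> real \<Rightarrow> real" where
  "series_path \<phi> x = (\<lambda>u\<in>{0..1}. \<Sum>k. \<phi> k u * x k)"

text \<open>On a box the series is dominated by one geometric series, uniformly in x and u. Tails
  are therefore uniformly small, and a product neighbourhood that restricts finitely many
  coordinates already controls the supremum norm.\<close>

lemma
  assumes \<phi>: "\<And>k. continuous_on {0..1} (\<phi> k)" "\<And>k u. u \<in> {0..1} \<Longrightarrow> \<bar>\<phi> k u\<bar> \<le> B"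
    and \<rho>: "0 < \<rho>" "\<rho> < 1"
  shows series_path_summable: "x \<in> geom_box \<rho> R \<Longrightarrow> u \<in> {0..1} \<Longrightarrow> summable (\<lambda>k. \<phi> k u * x k)"
    and series_path_bound: "x \<in> geom_box \<rho> R \<Longrightarrow> u \<in> {0..1} \<Longrightarrow> \<bar>\<Sum>k. \<phi> k u * x k\<bar> \<le> B * R / (1 - \<rho>)"
    and series_path_in_C01: "x \<in> geom_box \<rho> R \<Longrightarrow> series_path \<phi> x \<in> topspace C01"
    and series_path_continuous: "continuous_map (top_of_set (geom_box \<rho> R)) C01 (series_path \<phi>)"
proof -
  have B: "0 \<le> B" using \<phi>(2)[of 0 0] by auto
  have bd: "\<bar>\<phi> k u * x k\<bar> \<le> B * R * \<rho> ^ k" if "x \<in> geom_box \<rho> R" "u \<in> {0..1}" for x k u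
  proof -
    have "\<bar>\<phi> k u\<bar> * \<bar>x k\<bar> \<le> B * (R * \<rho> ^ k)"
      using that \<phi>(2)[of u k] B by (intro mult_mono) (auto simp: geom_box_def)
    then show ?thesis by (simp add: abs_mult mult_ac)
  qed
  have sg: "summable (\<lambda>k. B * R * \<rho> ^ k)" using \<rho> by (intro summable_mult summable_geometric) simp
  have sa: "summable (\<lambda>k. \<bar>\<phi> k u * x k\<bar>)" if "x \<in> geom_box \<rho> R" "u \<in> {0..1}" for x u
    by (rule summable_comparison_test'[OF sg]) (use bd[OF that] in simp)
  show summ: "summable (\<lambda>k. \<phi> k u * x k)" if "x \<in> geom_box \<rho> R" "u \<in> {0..1}" for x u
    using sa[OF that] by (rule summable_rabs_cancel)
  show "\<bar>\<Sum>k. \<phi> k u * x k\<bar> \<le> B * R / (1 - \<rho>)" if "x \<in> geom_box \<rho> R" "u \<in> {0..1}" for x u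
  proof -
    have "\<bar>\<Sum>k. \<phi> k u * x k\<bar> \<le> (\<Sum>k. \<bar>\<phi> k u * x k\<bar>)" by (rule summable_rabs[OF sa[OF that]])
    also have "\<dots> \<le> (\<Sum>k. B * R * \<rho> ^ k)" by (intro suminf_le bd[OF that] sa[OF that] sg)
    also have "\<dots> = B * R / (1 - \<rho>)" using \<rho> by (subst suminf_mult) (simp_all add: suminf_geometric)
    finally show ?thesis .
  qed
  show top: "series_path \<phi> x \<in> topspace C01" if x: "x \<in> geom_box \<rho> R" for x
    unfolding series_path_def
  proof (rule restrict_in_C01, rule uniform_limit_theorem[where F = sequentially])
    show "uniform_limit {0..1} (\<lambda>n u. \<Sum>k<n. \<phi> k u * x k) (\<lambda>u. \<Sum>k. \<phi> k u * x k) sequentially"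
      by (rule Weierstrass_m_test[OF _ sg]) (use bd[OF x] in auto)
    show "\<forall>\<^sub>F n in sequentially. continuous_on {0..1} (\<lambda>u. \<Sum>k<n. \<phi> k u * x k)"
      by (intro always_eventually allI continuous_intros \<phi>(1))
  qed simp
  show "continuous_map (top_of_set (geom_box \<rho> R)) C01 (series_path \<phi>)"
  proof (rule continuous_map_into_C01[OF top])
    fix x and e :: real assume x: "x \<in> geom_box \<rho> R" and e: "0 < e"
    have "(\<lambda>n. 2 * (\<Sum>k. B * R * \<rho> ^ (k + n))) \<longlonglongrightarrow> 2 * 0"
      by (intro tendsto_intros suminf_exist_split2 sg)
    then have "\<forall>\<^sub>F n in sequentially. 2 * (\<Sum>k. B * R * \<rho> ^ (k + n)) < e / 2"
      by (rule order_tendstoD(2)) (use e in simp)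
    then obtain n where n: "2 * (\<Sum>k. B * R * \<rho> ^ (k + n)) < e / 2"
      by (auto simp: eventually_sequentially)
    \<comment> \<open>The tails of x and y beyond n account for e/2, the first n coordinates for at
      most n(B+1)s, again below e/2; adding 1 to B and to n avoids division by zero.\<close>
    define s where "s = e / (2 * (B + 1) * (real n + 1))"
    have s: "s > 0" using e B by (simp add: s_def)
    define U where "U = PiE UNIV (\<lambda>k. if k < n then {x k - s<..<x k + s} else UNIV)"
    have "open U" unfolding U_def by (rule open_PiE) (auto intro: finite_subset[of _ "{..<n}"] split: if_splits)
    moreover have "x \<in> U" unfolding U_def using s by auto
    moreover have "\<bar>series_path \<phi> x u - series_path \<phi> y u\<bar> \<le> e" if y: "y \<in> U \<inter> geom_box \<rho> R" and u: "u \<in> {0..1}" for y u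
    proof -
      have yb: "y \<in> geom_box \<rho> R" using y by simp
      have ys: "\<bar>x k - y k\<bar> \<le> s" if "k < n" for k
      proof -
        have "y k \<in> {x k - s<..<x k + s}"
          using y that PiE_mem[of y UNIV "\<lambda>k. if k < n then {x k - s<..<x k + s} else UNIV" k]
          unfolding U_def by simp
        then show ?thesis by (simp add: abs_le_iff)
      qed
      let ?f = "\<lambda>k. \<phi> k u * x k - \<phi> k u * y k"
      have sf: "summable ?f" by (intro summable_diff summ x yb u)
      have "series_path \<phi> x u - series_path \<phi> y u = (\<Sum>k. ?f k)"
        using u by (simp add: series_path_def suminf_diff summ x yb)
      also have "\<dots> = (\<Sum>k. ?f (k + n)) + (\<Sum>k<n. ?f k)" by (rule suminf_split_initial_segment[OF sf])
      finally have split: "series_path \<phi> x u - series_path \<phi> y u = (\<Sum>k. ?f (k + n)) + (\<Sum>k<n. ?f k)" .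
      have "\<bar>\<Sum>k. ?f (k + n)\<bar> \<le> e / 2"
      proof -
        have fb: "\<bar>?f k\<bar> \<le> 2 * (B * R * \<rho> ^ k)" for k
          using bd[OF x u, of k] bd[OF yb u, of k] by linarith
        have s2: "summable (\<lambda>k. 2 * (B * R * \<rho> ^ (k + n)))"
          using sg by (intro summable_mult[of "\<lambda>k. B * R * \<rho> ^ (k + n)"]) (subst summable_iff_shift)
        have s1: "summable (\<lambda>k. \<bar>?f (k + n)\<bar>)"
          by (rule summable_comparison_test'[OF s2]) (use fb in simp)
        have "\<bar>\<Sum>k. ?f (k + n)\<bar> \<le> (\<Sum>k. \<bar>?f (k + n)\<bar>)" by (rule summable_rabs[OF s1])
        also have "\<dots> \<le> (\<Sum>k. 2 * (B * R * \<rho> ^ (k + n)))" by (intro suminf_le fb s1 s2)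
        also have "\<dots> = 2 * (\<Sum>k. B * R * \<rho> ^ (k + n))"
          using sg by (intro suminf_mult) (subst summable_iff_shift)
        finally show ?thesis using n by simp
      qed
      moreover have "\<bar>\<Sum>k<n. ?f k\<bar> \<le> e / 2"
      proof -
        have "\<bar>\<Sum>k<n. ?f k\<bar> \<le> (\<Sum>k<n. \<bar>?f k\<bar>)" by (rule sum_abs)
        also have "\<dots> \<le> (\<Sum>k<n. (B + 1) * s)"
        proof (intro sum_mono)
          fix k assume "k \<in> {..<n}"
          then have "\<bar>\<phi> k u\<bar> * \<bar>x k - y k\<bar> \<le> (B + 1) * s"
            using \<phi>(2)[OF u, of k] ys[of k] B by (intro mult_mono) auto
          then show "\<bar>?f k\<bar> \<le> (B + 1) * s" by (simp add: abs_mult flip: right_diff_distrib)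
        qed
        also have "\<dots> = real n * ((B + 1) * s)" by simp
        also have "\<dots> \<le> (real n + 1) * ((B + 1) * s)" using B s by (intro mult_right_mono) auto
        also have "\<dots> = e / 2" using B by (simp add: s_def divide_simps)
        finally show ?thesis .
      qed
      ultimately show ?thesis unfolding split by linarith
    qed
    ultimately show "\<exists>U. open U \<and> x \<in> U \<and> (\<forall>y\<in>U \<inter> geom_box \<rho> R. \<forall>u\<in>{0..1}. \<bar>series_path \<phi> x u - series_path \<phi> y u\<bar> \<le> e)"
      by blast
  qed
qed


text \<open>\<open>W T\<close> stands for the coefficients of the process at sample size T,
  \<open>D\<close> for those of a single summand, whose second moments determine the limit. The
  square integrable H dominates all absolute partial sums of D, so second moments pass from partial
  sums to the full series.\<close>

locale gaussian_series_limit = prob_space M for M :: "'a measure" +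
  fixes W :: "nat \<Rightarrow> 'a \<Rightarrow> nat \<Rightarrow> real" and D :: "nat \<Rightarrow> 'a \<Rightarrow> real" and \<phi> :: "nat \<Rightarrow> real \<Rightarrow> real"
    and H :: "'a \<Rightarrow> real" and B C \<rho> :: real
  assumes W_meas [measurable]: "\<And>T k. (\<lambda>\<omega>. W T \<omega> k) \<in> borel_measurable M"
    and W_sq: "\<And>T k. integrable M (\<lambda>\<omega>. (W T \<omega> k)\<^sup>2)" "\<And>T k. (\<integral>\<omega>. (W T \<omega> k)\<^sup>2 \<partial>M) \<le> C * \<rho> ^ (4 * k)"
    and D_meas [measurable]: "\<And>k. D k \<in> borel_measurable M"
    and D_var: "\<And>k. (\<integral>\<omega>. (D k \<omega>)\<^sup>2 \<partial>M) \<le> C * \<rho> ^ (4 * k)"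
    and H_meas [measurable]: "H \<in> borel_measurable M"
    and H_sq: "integrable M (\<lambda>\<omega>. (H \<omega>)\<^sup>2)"
    and D_dom: "\<And>n \<omega>. \<omega> \<in> space M \<Longrightarrow> (\<Sum>k<n. \<bar>D k \<omega>\<bar>) \<le> H \<omega>"
    and \<rho>: "0 < \<rho>" "\<rho> < 1"
    and \<phi>_cont: "\<And>k. continuous_on {0..1} (\<phi> k)"
    and \<phi>_bd: "\<And>k u. u \<in> {0..1} \<Longrightarrow> \<bar>\<phi> k u\<bar> \<le> B"
    and char: "\<And>n c. (\<lambda>T. \<integral>\<omega>. iexp (\<Sum>k<n. c k * W T \<omega> k) \<partial>M)
       \<longlonglongrightarrow> exp (- complex_of_real (\<integral>\<omega>. (\<Sum>k<n. c k * D k \<omega>)\<^sup>2 \<partial>M) / 2)"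
begin

lemma B_nonneg: "0 \<le> B" using \<phi>_bd[of 0 0] by auto

lemma D_sq: "integrable M (\<lambda>\<omega>. (D k \<omega>)\<^sup>2)"
proof (rule Bochner_Integration.integrable_bound[OF H_sq])
  show "AE \<omega> in M. norm ((D k \<omega>)\<^sup>2) \<le> norm ((H \<omega>)\<^sup>2)"
  proof (rule AE_I2)
    fix \<omega> assume "\<omega> \<in> space M"
    then have "(\<Sum>k<Suc k. \<bar>D k \<omega>\<bar>) \<le> H \<omega>" by (rule D_dom)
    moreover have "\<bar>D k \<omega>\<bar> \<le> (\<Sum>k<Suc k. \<bar>D k \<omega>\<bar>)" by (simp add: sum_nonneg)
    ultimately have "\<bar>D k \<omega>\<bar> \<le> H \<omega>" by linarith
    then have "\<bar>D k \<omega>\<bar>\<^sup>2 \<le> (H \<omega>)\<^sup>2" by (intro power_mono) auto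
    then show "norm ((D k \<omega>)\<^sup>2) \<le> norm ((H \<omega>)\<^sup>2)" by simp
  qed
qed measurable

definition target :: "real \<Rightarrow> 'a \<Rightarrow> real" where
  "target u \<omega> = (\<Sum>k. \<phi> k u * D k \<omega>)"

definition G :: "nat \<Rightarrow> (real \<Rightarrow> real) \<Rightarrow> real" where
  "G = (SOME G. (\<forall>k. G k \<in> borel_measurable gauss_space) \<and>
    (\<forall>n c. (\<integral>x. iexp (\<Sum>k<n. c k * G k x) \<partial>gauss_space)
       = exp (- complex_of_real (\<integral>\<omega>. (\<Sum>k<n. c k * D k \<omega>)\<^sup>2 \<partial>M) / 2)))"

lemma G_meas [measurable]: "G k \<in> borel_measurable gauss_space"
  and G_char: "(\<integral>x. iexp (\<Sum>k<n. c k * G k x) \<partial>gauss_space)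
       = exp (- complex_of_real (\<integral>\<omega>. (\<Sum>k<n. c k * D k \<omega>)\<^sup>2 \<partial>M) / 2)"
proof -
  have "\<exists>G. (\<forall>k. G k \<in> borel_measurable gauss_space) \<and>
    (\<forall>n c. (\<integral>x. iexp (\<Sum>k<n. c k * G k x) \<partial>gauss_space)
       = exp (- complex_of_real (\<integral>\<omega>. (\<Sum>k<n. c k * D k \<omega>)\<^sup>2 \<partial>M) / 2))"
    by (rule gaussian_sequence_exists[of D M, OF D_meas D_sq]) blast
  from someI_ex[OF this] show "G k \<in> borel_measurable gauss_space"
    "(\<integral>x. iexp (\<Sum>k<n. c k * G k x) \<partial>gauss_space)
       = exp (- complex_of_real (\<integral>\<omega>. (\<Sum>k<n. c k * D k \<omega>)\<^sup>2 \<partial>M) / 2)"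
    unfolding G_def by auto
qed

interpretation N: prob_space gauss_space by (rule prob_space_gauss_space)

lemma G_distr: "distr gauss_space borel (G k) = normal_law 0 (sqrt (\<integral>\<omega>. (D k \<omega>)\<^sup>2 \<partial>M))"
proof (rule distr_eq_normal_law[OF prob_space_gauss_space G_meas])
  fix t :: real
  let ?c = "\<lambda>j. if j = k then t else 0"
  have "(\<Sum>j<Suc k. ?c j * z j) = t * z k" for z :: "nat \<Rightarrow> real"
    by (simp add: if_distrib[of "\<lambda>x. x * _"] cong: if_cong)
  from G_char[where n = "Suc k" and c = ?c, unfolded this]
  show "(\<integral>x. iexp (t * G k x) \<partial>gauss_space)
      = exp (- complex_of_real ((t * sqrt (\<integral>\<omega>. (D k \<omega>)\<^sup>2 \<partial>M))\<^sup>2) / 2)"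
    by (simp add: power_mult_distrib del: of_real_mult of_real_power)
qed simp

lemma G_sq: "integrable gauss_space (\<lambda>x. (G k x)\<^sup>2)" "(\<integral>x. (G k x)\<^sup>2 \<partial>gauss_space) \<le> C * \<rho> ^ (4 * k)"
  using normal_law_moments[OF G_meas G_distr] D_var by auto

text \<open>One box serves every T and the Gaussian sequence, since all obey the same variance
  bound. R is a natural number so that the boxes exhausting the coefficient space are countably
  many.\<close>

lemma tightness:
  assumes "0 < e"
  obtains R :: nat where "\<And>T. prob {\<omega> \<in> space M. W T \<omega> \<notin> geom_box \<rho> R} \<le> e"
    "N.prob {x \<in> space gauss_space. (\<lambda>k. G k x) \<notin> geom_box \<rho> R} \<le> e"
proof -
  have r: "1 - \<rho>\<^sup>2 > 0" using \<rho> by (simp add: abs_square_less_1)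
  have "0 \<le> (\<integral>\<omega>. (D 0 \<omega>)\<^sup>2 \<partial>M)" by simp
  then have C: "0 \<le> C" using D_var[of 0] by (simp only: mult_0_right power_0 mult_1_right)
  obtain R :: nat where R: "real R > max 1 (C / (e * (1 - \<rho>\<^sup>2)))" using reals_Archimedean2 by blast
  have "C / ((real R)\<^sup>2 * (1 - \<rho>\<^sup>2)) \<le> C / (real R * (1 - \<rho>\<^sup>2))"
    using R r C by (intro divide_left_mono mult_right_mono) (auto simp: power2_eq_square)
  also have "\<dots> \<le> e" using R r assms by (simp add: field_simps)
  finally have le: "C / ((real R)\<^sup>2 * (1 - \<rho>\<^sup>2)) \<le> e" .
  show thesis
  proof
    show "prob {\<omega> \<in> space M. W T \<omega> \<notin> geom_box \<rho> R} \<le> e" for T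
      using R by (intro order_trans[OF prob_not_in_geom_box le] W_sq \<rho>) auto
    show "N.prob {x \<in> space gauss_space. (\<lambda>k. G k x) \<notin> geom_box \<rho> R} \<le> e"
      using R by (intro order_trans[OF N.prob_not_in_geom_box le] G_sq \<rho>) auto
  qed
qed

lemma G_seq_meas [measurable]: "(\<lambda>x k. G k x) \<in> borel_measurable gauss_space"
  by (rule measurable_coordinatewise_then_product) simp

lemma geom_box_sets [measurable]: "geom_box \<rho> R \<in> sets borel"
  by (intro borel_closed compact_imp_closed compact_geom_box)

definition good :: "(real \<Rightarrow> real) set" where
  "good = {x. \<exists>R::nat. (\<lambda>k. G k x) \<in> geom_box \<rho> R}"

lemma good_meas [measurable]: "good \<inter> space gauss_space \<in> sets gauss_space"
proof -
  have "good \<inter> space gauss_space = (\<Union>R::nat. {x \<in> space gauss_space. (\<lambda>k. G k x) \<in> geom_box \<rho> R})"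
    by (auto simp: good_def)
  also have "\<dots> \<in> sets gauss_space" by measurable
  finally show ?thesis .
qed

lemma AE_good: "AE x in gauss_space. x \<in> good"
proof -
  have "N.prob {x \<in> space gauss_space. x \<notin> good} \<le> e" if "0 < e" for e
  proof (rule tightness[OF that])
    fix R :: nat
    assume le: "N.prob {x \<in> space gauss_space. (\<lambda>k. G k x) \<notin> geom_box \<rho> R} \<le> e"
    have "N.prob {x \<in> space gauss_space. x \<notin> good} \<le> N.prob {x \<in> space gauss_space. (\<lambda>k. G k x) \<notin> geom_box \<rho> R}"
      by (intro N.finite_measure_mono) (auto simp: good_def)
    with le show ?thesis by simp
  qed
  then have "N.prob {x \<in> space gauss_space. x \<notin> good} = 0"
    by (meson dense_le_bounded leD measure_nonneg not_less_iff_gr_or_eq order_antisym_conv field_le_epsilon dense)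
  moreover have "{x \<in> space gauss_space. x \<notin> good} = space gauss_space - (good \<inter> space gauss_space)" by auto
  then have "{x \<in> space gauss_space. x \<notin> good} \<in> sets gauss_space" by simp
  ultimately show ?thesis by (intro AE_I[where N = "{x \<in> space gauss_space. x \<notin> good}"]) (auto simp: N.emeasure_eq_measure)
qed

text \<open>The value 0 outside \<open>good\<close>, an event of probability one, makes every path
  continuous, as a random element of C[0,1] must be.\<close>

definition V :: "real \<Rightarrow> (real \<Rightarrow> real) \<Rightarrow> real" where
  "V u x = (if x \<in> good then \<Sum>k. \<phi> k u * G k x else 0)"

lemma path_V: "restrict (\<lambda>u. V u x) {0..1} = (if x \<in> good then series_path \<phi> (\<lambda>k. G k x) else restrict (\<lambda>u. 0) {0..1})"
  by (auto simp: V_def series_path_def)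

text \<open>On each box \<open>series_path\<close> is continuous, so the preimage of an open set of
  paths is the trace of an open set of coefficient sequences; \<open>good\<close> is the union of
  countably many such boxes.\<close>

lemma path_V_meas: "(\<lambda>x. restrict (\<lambda>u. V u x) {0..1}) \<in> gauss_space \<rightarrow>\<^sub>M borel_of C01"
proof (rule measurable_borel_ofI)
  show "restrict (\<lambda>u. V u x) {0..1} \<in> topspace C01" for x
    unfolding path_V using series_path_in_C01[where \<phi> = \<phi>, OF \<phi>_cont \<phi>_bd \<rho>]
    by (auto simp: good_def intro: restrict_in_C01)
  fix U assume U: "openin C01 U"
  have "\<exists>Q. open Q \<and> (\<forall>x\<in>geom_box \<rho> R. series_path \<phi> x \<in> U \<longleftrightarrow> x \<in> Q)" for R
  proof -
    have "openin (top_of_set (geom_box \<rho> R)) {x \<in> geom_box \<rho> R. series_path \<phi> x \<in> U}"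
      using series_path_continuous[where \<phi> = \<phi>, OF \<phi>_cont \<phi>_bd \<rho>, of R] U by (auto simp: continuous_map_def)
    then obtain Q where "open Q" "{x \<in> geom_box \<rho> R. series_path \<phi> x \<in> U} = geom_box \<rho> R \<inter> Q"
      by (auto simp: openin_open)
    then show ?thesis by blast
  qed
  then obtain Q where Q: "\<And>R. open (Q R)" "\<And>R x. x \<in> geom_box \<rho> R \<Longrightarrow> series_path \<phi> x \<in> U \<longleftrightarrow> x \<in> Q R"
    by metis
  have [measurable]: "Q R \<in> sets borel" for R using Q by (intro borel_open)
  have "(\<lambda>x. restrict (\<lambda>u. V u x) {0..1}) -` U \<inter> space gauss_space
     = (\<Union>R::nat. {x \<in> space gauss_space. (\<lambda>k. G k x) \<in> geom_box \<rho> R \<and> (\<lambda>k. G k x) \<in> Q R})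
       \<union> (if restrict (\<lambda>u. 0) {0..1} \<in> U then space gauss_space - good \<inter> space gauss_space else {})"
    unfolding path_V using Q(2) by (auto simp: good_def split: if_splits)
  also have "\<dots> \<in> sets gauss_space" by (intro sets.Un sets.countable_UN) auto
  finally show "(\<lambda>x. restrict (\<lambda>u. V u x) {0..1}) -` U \<inter> space gauss_space \<in> sets gauss_space" .
qed

lemma V_meas [measurable]: "V u \<in> borel_measurable gauss_space"
proof -
  have "(\<lambda>x. if x \<in> good \<inter> space gauss_space then \<Sum>k. \<phi> k u * G k x else 0) \<in> borel_measurable gauss_space"
    by measurable
  then show ?thesis by (rule measurable_cong[THEN iffD1, rotated]) (auto simp: V_def)
qed

text \<open>A combination of values of V is the limit of combinations of the \<open>G k\<close> with
  coefficients \<open>b k\<close>. Their characteristic functions are known; the exponentials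
  converge almost surely on \<open>good\<close>, and the variances converge by domination through H.
  This covers combinations of variance zero as well.\<close>

theorem V_combination:
  assumes J: "finite J" "J \<subseteq> {0..1}"
  shows "distr gauss_space borel (\<lambda>x. \<Sum>u\<in>J. c u * V u x)
     = normal_law 0 (sqrt (\<integral>\<omega>. (\<Sum>u\<in>J. c u * target u \<omega>)\<^sup>2 \<partial>M))"
proof (rule distr_eq_normal_law[OF prob_space_gauss_space])
  fix t :: real
  define b where "b k = (\<Sum>u\<in>J. c u * \<phi> k u)" for k
  have swap: "(\<Sum>k<n. b k * z k) = (\<Sum>u\<in>J. c u * (\<Sum>k<n. \<phi> k u * z k))" for n and z :: "nat \<Rightarrow> real"
  proof -
    have "(\<Sum>k<n. b k * z k) = (\<Sum>k<n. \<Sum>u\<in>J. c u * \<phi> k u * z k)" by (simp add: b_def sum_distrib_right)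
    also have "\<dots> = (\<Sum>u\<in>J. \<Sum>k<n. c u * \<phi> k u * z k)" by (rule sum.swap)
    finally show ?thesis by (simp add: sum_distrib_left mult.assoc)
  qed
  have summ: "summable (\<lambda>k. \<phi> k u * D k \<omega>)" if "\<omega> \<in> space M" "u \<in> {0..1}" for \<omega> u
  proof -
    have "summable (\<lambda>k. \<bar>D k \<omega>\<bar>)" by (rule bounded_imp_summable[OF _ D_dom[OF that(1), of "Suc _", unfolded lessThan_Suc_atMost]]) simp
    then have "summable (\<lambda>k. B * \<bar>D k \<omega>\<bar>)" by (rule summable_mult)
    then show ?thesis
      by (rule summable_comparison_test') (use \<phi>_bd[OF that(2)] in \<open>auto simp: abs_mult intro!: mult_right_mono\<close>)
  qed
  have "(\<lambda>n. \<integral>\<omega>. (\<Sum>k<n. b k * D k \<omega>)\<^sup>2 \<partial>M) \<longlonglongrightarrow> (\<integral>\<omega>. (\<Sum>u\<in>J. c u * target u \<omega>)\<^sup>2 \<partial>M)"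
  proof (rule integral_dominated_convergence[where w = "\<lambda>\<omega>. ((\<Sum>u\<in>J. \<bar>c u\<bar> * B) * H \<omega>)\<^sup>2"])
    show "integrable M (\<lambda>\<omega>. ((\<Sum>u\<in>J. \<bar>c u\<bar> * B) * H \<omega>)\<^sup>2)" using H_sq by (simp add: power_mult_distrib)
    show "AE \<omega> in M. (\<lambda>n. (\<Sum>k<n. b k * D k \<omega>)\<^sup>2) \<longlonglongrightarrow> (\<Sum>u\<in>J. c u * target u \<omega>)\<^sup>2"
      unfolding swap target_def using J summ
      by (intro AE_I2 tendsto_intros summable_LIMSEQ) auto
    show "AE \<omega> in M. norm ((\<Sum>k<n. b k * D k \<omega>)\<^sup>2) \<le> ((\<Sum>u\<in>J. \<bar>c u\<bar> * B) * H \<omega>)\<^sup>2" for n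
    proof (rule AE_I2)
      fix \<omega> assume \<omega>: "\<omega> \<in> space M"
      have bk: "\<bar>b k\<bar> \<le> (\<Sum>u\<in>J. \<bar>c u\<bar> * B)" for k
        unfolding b_def using J \<phi>_bd
        by (intro order_trans[OF sum_abs] sum_mono) (auto simp: abs_mult intro!: mult_left_mono)
      have "\<bar>\<Sum>k<n. b k * D k \<omega>\<bar> \<le> (\<Sum>k<n. (\<Sum>u\<in>J. \<bar>c u\<bar> * B) * \<bar>D k \<omega>\<bar>)"
        by (intro order_trans[OF sum_abs] sum_mono) (simp add: abs_mult mult_right_mono bk)
      also have "\<dots> \<le> (\<Sum>u\<in>J. \<bar>c u\<bar> * B) * H \<omega>"
        unfolding sum_distrib_left[symmetric] using D_dom[OF \<omega>, of n] B_nonneg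
        by (intro mult_left_mono) (auto intro: sum_nonneg)
      finally have "\<bar>\<Sum>k<n. b k * D k \<omega>\<bar>\<^sup>2 \<le> ((\<Sum>u\<in>J. \<bar>c u\<bar> * B) * H \<omega>)\<^sup>2" by (intro power_mono) auto
      then show "norm ((\<Sum>k<n. b k * D k \<omega>)\<^sup>2) \<le> ((\<Sum>u\<in>J. \<bar>c u\<bar> * B) * H \<omega>)\<^sup>2" by simp
    qed
  qed (simp_all add: target_def)
  then have "(\<lambda>n. exp (- complex_of_real (t\<^sup>2 * (\<integral>\<omega>. (\<Sum>k<n. b k * D k \<omega>)\<^sup>2 \<partial>M)) / 2))
      \<longlonglongrightarrow> exp (- complex_of_real (t\<^sup>2 * (\<integral>\<omega>. (\<Sum>u\<in>J. c u * target u \<omega>)\<^sup>2 \<partial>M)) / 2)"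
    by (intro tendsto_intros) simp_all
  moreover have "exp (- complex_of_real (t\<^sup>2 * (\<integral>\<omega>. (\<Sum>k<n. b k * D k \<omega>)\<^sup>2 \<partial>M)) / 2)
      = (\<integral>x. iexp (t * (\<Sum>k<n. b k * G k x)) \<partial>gauss_space)" for n
    using G_char[where n = n and c = "\<lambda>k. t * b k"]
    by (simp add: mult.assoc power_mult_distrib del: of_real_sum of_real_mult flip: sum_distrib_left)
  ultimately have l1: "(\<lambda>n. \<integral>x. iexp (t * (\<Sum>k<n. b k * G k x)) \<partial>gauss_space)
      \<longlonglongrightarrow> exp (- complex_of_real (t\<^sup>2 * (\<integral>\<omega>. (\<Sum>u\<in>J. c u * target u \<omega>)\<^sup>2 \<partial>M)) / 2)" by simp
  have l2: "(\<lambda>n. \<integral>x. iexp (t * (\<Sum>k<n. b k * G k x)) \<partial>gauss_space)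
      \<longlonglongrightarrow> (\<integral>x. iexp (t * (\<Sum>u\<in>J. c u * V u x)) \<partial>gauss_space)"
  proof (rule integral_dominated_convergence[where w = "\<lambda>_. 1"])
    show "AE x in gauss_space. (\<lambda>n. iexp (t * (\<Sum>k<n. b k * G k x))) \<longlonglongrightarrow> iexp (t * (\<Sum>u\<in>J. c u * V u x))"
      using AE_good
    proof eventually_elim
      fix x assume x: "x \<in> good"
      then obtain R :: nat where R: "(\<lambda>k. G k x) \<in> geom_box \<rho> R" by (auto simp: good_def)
      have "(\<lambda>n. t * (\<Sum>k<n. b k * G k x)) \<longlonglongrightarrow> t * (\<Sum>u\<in>J. c u * V u x)"
        unfolding swap V_def using J x series_path_summable[where \<phi> = \<phi>, OF \<phi>_cont \<phi>_bd \<rho> R]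
        by (auto intro!: tendsto_intros summable_LIMSEQ)
      then show "(\<lambda>n. iexp (t * (\<Sum>k<n. b k * G k x))) \<longlonglongrightarrow> iexp (t * (\<Sum>u\<in>J. c u * V u x))"
        by (rule tendsto_exp[OF tendsto_mult_left[OF tendsto_of_real]])
    qed
  qed auto
  show "(\<integral>x. iexp (t * (\<Sum>u\<in>J. c u * V u x)) \<partial>gauss_space)
      = exp (- complex_of_real ((t * sqrt (\<integral>\<omega>. (\<Sum>u\<in>J. c u * target u \<omega>)\<^sup>2 \<partial>M))\<^sup>2) / 2)"
    using LIMSEQ_unique[OF l2 l1] by (simp add: power_mult_distrib del: of_real_mult of_real_power)
qed simp_all

lemma gaussian_process_V: "gaussian_process gauss_space {0..1} V"
  unfolding gaussian_process_def
proof safe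
  fix J :: "real set" and c :: "real \<Rightarrow> real" assume "finite J" "J \<subseteq> {0..1}"
  from V_combination[OF this, of c]
  show "\<exists>m. \<exists>\<sigma>\<ge>0. distr gauss_space borel (\<lambda>\<omega>. \<Sum>i\<in>J. c i * V i \<omega>) = normal_law m \<sigma>"
    by (intro exI[of _ 0] exI[of _ "sqrt (\<integral>\<omega>. (\<Sum>u\<in>J. c u * target u \<omega>)\<^sup>2 \<partial>M)"]) simp
qed (rule V_meas)

lemma target_meas [measurable]: "target u \<in> borel_measurable M"
  unfolding target_def by measurable

lemma target_sq: 
  assumes "u \<in> {0..1}" shows "integrable M (\<lambda>\<omega>. (target u \<omega>)\<^sup>2)"
proof (rule Bochner_Integration.integrable_bound[of _ "\<lambda>\<omega>. (B * H \<omega>)\<^sup>2"])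
  show "AE \<omega> in M. norm ((target u \<omega>)\<^sup>2) \<le> norm ((B * H \<omega>)\<^sup>2)"
  proof (rule AE_I2)
    fix \<omega> assume \<omega>: "\<omega> \<in> space M"
    have s: "summable (\<lambda>k. \<bar>D k \<omega>\<bar>)"
      by (rule bounded_imp_summable[OF _ D_dom[OF \<omega>, of "Suc _", unfolded lessThan_Suc_atMost]]) simp
    have le: "\<bar>\<phi> k u * D k \<omega>\<bar> \<le> B * \<bar>D k \<omega>\<bar>" for k
      using \<phi>_bd[OF assms] by (simp add: abs_mult mult_right_mono)
    have sa: "summable (\<lambda>k. \<bar>\<phi> k u * D k \<omega>\<bar>)"
      by (rule summable_comparison_test'[OF summable_mult[OF s, of B]]) (use le in simp)
    have "\<bar>target u \<omega>\<bar> \<le> (\<Sum>k. \<bar>\<phi> k u * D k \<omega>\<bar>)" unfolding target_def by (rule summable_rabs[OF sa])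
    also have "\<dots> \<le> (\<Sum>k. B * \<bar>D k \<omega>\<bar>)" by (intro suminf_le le sa summable_mult s)
    also have "\<dots> = B * (\<Sum>k. \<bar>D k \<omega>\<bar>)" by (rule suminf_mult[OF s])
    also have "\<dots> \<le> B * H \<omega>"
      by (intro mult_left_mono B_nonneg suminf_le_const s D_dom \<omega>)
    finally have "\<bar>target u \<omega>\<bar>\<^sup>2 \<le> (B * H \<omega>)\<^sup>2" by (intro power_mono) auto
    then show "norm ((target u \<omega>)\<^sup>2) \<le> norm ((B * H \<omega>)\<^sup>2)" by simp
  qed
qed (use H_sq in \<open>simp_all add: power_mult_distrib\<close>)

lemma target_mult: "u \<in> {0..1} \<Longrightarrow> v \<in> {0..1} \<Longrightarrow> integrable M (\<lambda>\<omega>. target u \<omega> * target v \<omega>)"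
  by (intro integrable_mult_L2 target_sq target_meas)

lemma V_mean: "u \<in> {0..1} \<Longrightarrow> (\<integral>x. V u x \<partial>gauss_space) = 0"
  using normal_law_moments(2)[OF _ V_combination[of "{u}" "\<lambda>_. 1"]] by simp

text \<open>\<open>V_combination\<close> yields second moments only, so the covariance comes by
  polarisation with coefficients 1 and -1. The case u = v is separate because the set of the two
  points collapses.\<close>

lemma V_cov:
  assumes u: "u \<in> {0..1}" "v \<in> {0..1}"
  shows "(\<integral>x. V u x * V v x \<partial>gauss_space) = (\<integral>\<omega>. target u \<omega> * target v \<omega> \<partial>M)"
proof (cases "u = v")
  case True
  then show ?thesis
    using normal_law_moments(3)[OF _ V_combination[of "{u}" "\<lambda>_. 1"]] u
    by (simp add: power2_eq_square)
next
  case False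
  have pol: "integrable gauss_space (\<lambda>x. (V u x + s * V v x)\<^sup>2)"
    "(\<integral>x. (V u x + s * V v x)\<^sup>2 \<partial>gauss_space) = (\<integral>\<omega>. (target u \<omega> + s * target v \<omega>)\<^sup>2 \<partial>M)" for s
    using normal_law_moments(1,3)[OF _ V_combination[of "{u, v}" "\<lambda>z. if z = u then 1 else s"]] u False
    by (simp_all add: False[symmetric])
  have "(\<integral>x. V u x * V v x \<partial>gauss_space)
     = (\<integral>x. ((V u x + 1 * V v x)\<^sup>2 - (V u x + (-1) * V v x)\<^sup>2) / 4 \<partial>gauss_space)"
    by (intro Bochner_Integration.integral_cong) (simp_all add: power2_eq_square algebra_simps)
  also have "\<dots> = ((\<integral>x. (V u x + 1 * V v x)\<^sup>2 \<partial>gauss_space) - (\<integral>x. (V u x + (-1) * V v x)\<^sup>2 \<partial>gauss_space)) / 4"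
    using pol(1)[of 1] pol(1)[of "-1"] by simp
  also have "\<dots> = ((\<integral>\<omega>. (target u \<omega> + 1 * target v \<omega>)\<^sup>2 \<partial>M) - (\<integral>\<omega>. (target u \<omega> + (-1) * target v \<omega>)\<^sup>2 \<partial>M)) / 4"
    unfolding pol(2) ..
  also have "\<dots> = (\<integral>\<omega>. target u \<omega> * target v \<omega> \<partial>M)"
    using target_sq[OF u(1)] target_sq[OF u(2)] target_mult[OF u]
    by (simp add: power2_sum power2_diff mult.assoc)
  finally show ?thesis .
qed

text \<open>Convergence of paths is reduced to convergence of coefficients: on a box the functional
  composed with \<open>series_path\<close> is the continuous function that
  \<open>tendsto_integral_of_trig_poly\<close> asks for.\<close>

theorem tendsto_functional:
  fixes F :: "(real \<Rightarrow> real) \<Rightarrow> real"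
  assumes F: "continuous_map C01 euclideanreal F" and Fb: "\<And>f. f \<in> topspace C01 \<Longrightarrow> \<bar>F f\<bar> \<le> b"
    and X: "\<And>T. X T \<in> M \<rightarrow>\<^sub>M borel_of C01"
    and XW: "\<And>T \<omega>. \<omega> \<in> space M \<Longrightarrow> X T \<omega> = series_path \<phi> (W T \<omega>)"
  shows "(\<lambda>T. \<integral>\<omega>. F (X T \<omega>) \<partial>M) \<longlonglongrightarrow> (\<integral>x. F (restrict (\<lambda>u. V u x) {0..1}) \<partial>gauss_space)"
proof (rule tendsto_integral_of_trig_poly[where W = W and G = "\<lambda>x k. G k x" and B = b])
  note Fm = continuous_map_borel_of[OF F]
  show "(\<lambda>\<omega>. F (X T \<omega>)) \<in> borel_measurable M" for T by (rule measurable_compose[OF X Fm])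
  show "(\<lambda>x. F (restrict (\<lambda>u. V u x) {0..1})) \<in> borel_measurable gauss_space"
    by (rule measurable_compose[OF path_V_meas Fm])
  show "\<bar>F (X T \<omega>)\<bar> \<le> b" if "\<omega> \<in> space M" for T \<omega>
    using measurable_space[OF X that] by (intro Fb) simp
  show "\<bar>F (restrict (\<lambda>u. V u x) {0..1})\<bar> \<le> b" if "x \<in> space gauss_space" for x
    using measurable_space[OF path_V_meas that] by (intro Fb) simp
  show "(\<lambda>T. \<integral>\<omega>. iexp (\<Sum>k<n. c k * W T \<omega> k) \<partial>M) \<longlonglongrightarrow> (\<integral>x. iexp (\<Sum>k<n. c k * G k x) \<partial>gauss_space)" for n c
    unfolding G_char by (rule char)
  fix e :: real assume "0 < e"
  then obtain R :: nat where R: "\<And>T. prob {\<omega> \<in> space M. W T \<omega> \<notin> geom_box \<rho> R} \<le> e"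
    "N.prob {x \<in> space gauss_space. (\<lambda>k. G k x) \<notin> geom_box \<rho> R} \<le> e"
    by (rule tightness) (rule that, assumption+)
  show "\<exists>K f. compact K \<and> continuous_on K f \<and> (\<forall>x\<in>K. \<bar>f x\<bar> \<le> b) \<and>
      (\<forall>T. prob {\<omega> \<in> space M. W T \<omega> \<notin> K} \<le> e) \<and> N.prob {x \<in> space gauss_space. (\<lambda>k. G k x) \<notin> K} \<le> e \<and>
      (\<forall>T. \<forall>\<omega>\<in>space M. W T \<omega> \<in> K \<longrightarrow> F (X T \<omega>) = f (W T \<omega>)) \<and>
      (\<forall>x\<in>space gauss_space. (\<lambda>k. G k x) \<in> K \<longrightarrow> F (restrict (\<lambda>u. V u x) {0..1}) = f (\<lambda>k. G k x))"
  proof (intro exI[of _ "geom_box \<rho> R"] exI[of _ "\<lambda>x. F (series_path \<phi> x)"] conjI)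
    show "continuous_on (geom_box \<rho> R) (\<lambda>x. F (series_path \<phi> x))"
      using continuous_map_compose[OF series_path_continuous[where \<phi> = \<phi>, OF \<phi>_cont \<phi>_bd \<rho>, of R] F]
      by (simp only: comp_def continuous_map_iff_continuous)
    show "\<forall>x\<in>geom_box \<rho> R. \<bar>F (series_path \<phi> x)\<bar> \<le> b"
      by (intro ballI Fb series_path_in_C01[where \<phi> = \<phi>, OF \<phi>_cont \<phi>_bd \<rho>])
    show "\<forall>x\<in>space gauss_space. (\<lambda>k. G k x) \<in> geom_box \<rho> R \<longrightarrow> F (restrict (\<lambda>u. V u x) {0..1}) = F (series_path \<phi> (\<lambda>k. G k x))"
      unfolding path_V by (auto simp: good_def)
  qed (use R XW compact_geom_box in auto)
qed (auto intro: prob_space_axioms prob_space_gauss_space)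

end

section \<open>The Poisson INARCH(1) process\<close>

lemma poisson_sums_exp:
  assumes "0 < r" shows "(\<lambda>k. z ^ k * pmf (poisson_pmf r) k) sums exp (r * (z - 1))"
proof -
  have "(\<lambda>k. (z * r) ^ k /\<^sub>R fact k * exp (- r)) sums (exp (z * r) * exp (- r))"
    by (intro sums_mult2 exp_converges)
  moreover have "(\<lambda>k. (z * r) ^ k /\<^sub>R fact k * exp (- r)) = (\<lambda>k. z ^ k * pmf (poisson_pmf r) k)"
    using assms by (simp add: power_mult_distrib divide_inverse mult_ac)
  ultimately show ?thesis by (simp add: algebra_simps flip: exp_add)
qed

text \<open>The left side is the conditional mean of exp(sY) given the previous value y. Since
  \<open>\<theta>2 < 1\<close> and exp(s) - 1 is close to s, its exponent grows in y with slope
  below s, so it drops below half of exp(sy) for large y; C takes care of the small y.\<close>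

lemma exponential_drift:
  fixes \<theta>1 \<theta>2 :: real
  assumes "0 < \<theta>1" "0 \<le> \<theta>2" "\<theta>2 < 1"
  obtains s C where "0 < s" "0 \<le> C"
    "\<And>y::nat. exp ((\<theta>1 + \<theta>2 * real y) * (exp s - 1)) \<le> exp (s * real y) / 2 + C"
proof -
  \<comment> \<open>With s at most 1, exp(s) - 1 is at most s + s^2, and this s satisfies
    \<open>\<theta>2 + s < 1\<close>; together they make the gap \<open>\<delta>\<close>
    positive.\<close>
  define s where "s = (1 - \<theta>2) / 2"
  have s: "0 < s" "s \<le> 1" using assms by (auto simp: s_def)
  define \<delta> where "\<delta> = s - \<theta>2 * (exp s - 1)"
  have "exp s - 1 \<le> s + s\<^sup>2" using exp_bound[of s] s by simp
  then have "\<theta>2 * (exp s - 1) \<le> \<theta>2 * (s + s\<^sup>2)" using assms by (intro mult_left_mono)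
  also have "\<dots> = s * (\<theta>2 + \<theta>2 * s)" by (simp add: algebra_simps power2_eq_square)
  also have "\<dots> < s * 1"
  proof (intro mult_strict_left_mono s)
    have "\<theta>2 * s \<le> 1 * s" using assms s by (intro mult_right_mono) auto
    moreover have "\<theta>2 + s < 1" using assms by (simp add: s_def field_simps)
    ultimately show "\<theta>2 + \<theta>2 * s < 1" by linarith
  qed
  finally have \<delta>: "0 < \<delta>" by (simp add: \<delta>_def)
  define A where "A = exp (\<theta>1 * (exp s - 1))"
  have A: "0 < A" by (simp add: A_def)
  \<comment> \<open>Beyond \<open>ln (2 * A) / \<delta>\<close> the gap pays for the factor 2A; up
    to there y is bounded and this C suffices.\<close>
  define C where "C = A * exp (s * (\<bar>ln (2 * A)\<bar> / \<delta>))"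
  show thesis
  proof
    show "0 < s" by (rule s)
    show "0 \<le> C" using A by (simp add: C_def)
    fix y :: nat
    have eq: "exp ((\<theta>1 + \<theta>2 * real y) * (exp s - 1)) = A * exp ((s - \<delta>) * real y)"
      by (simp add: A_def \<delta>_def algebra_simps flip: exp_add)
    show "exp ((\<theta>1 + \<theta>2 * real y) * (exp s - 1)) \<le> exp (s * real y) / 2 + C"
    proof (cases "ln (2 * A) \<le> \<delta> * real y")
      case True
      then have "exp (ln (2 * A)) \<le> exp (\<delta> * real y)" by simp
      then have "2 * A \<le> exp (\<delta> * real y)" using A by simp
      then have "2 * A * exp ((s - \<delta>) * real y) \<le> exp (\<delta> * real y) * exp ((s - \<delta>) * real y)"
        by (intro mult_right_mono) auto
      also have "\<dots> = exp (s * real y)" by (simp add: algebra_simps flip: exp_add)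
      finally show ?thesis using A unfolding eq C_def by (simp add: add_increasing2)
    next
      case False
      then have "real y \<le> \<bar>ln (2 * A)\<bar> / \<delta>" using \<delta> by (simp add: field_simps)
      then have "s * real y \<le> s * (\<bar>ln (2 * A)\<bar> / \<delta>)" using s by (intro mult_left_mono) auto
      moreover have "(s - \<delta>) * real y \<le> s * real y" using \<delta> by (intro mult_right_mono) auto
      ultimately have "A * exp ((s - \<delta>) * real y) \<le> C"
        unfolding C_def using A by (intro mult_left_mono) auto
      then show ?thesis unfolding eq by (simp add: add_increasing)
    qed
  qed
qed

locale inarch = prob_space M for M :: "'a measure" +
  fixes Y :: "int \<Rightarrow> 'a \<Rightarrow> nat" and \<theta>1 \<theta>2 :: real
  assumes \<theta>1: "0 < \<theta>1" and \<theta>2: "0 \<le> \<theta>2" "\<theta>2 < 1"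
    and model: "poisson_inarch1 M Y \<theta>1 \<theta>2"
    and stationary: "strictly_stationary M Y"
    and ergodic: "ergodic_process M Y"
begin

lemma Y_meas [measurable]: "Y t \<in> M \<rightarrow>\<^sub>M count_space UNIV"
  using model by (simp add: poisson_inarch1_def)

text \<open>The whole path seen from time k: a quantity attached to time t is a fixed function of
  \<open>sh t\<close>, so stationarity becomes one identity of image measures.\<close>

definition sh :: "int \<Rightarrow> 'a \<Rightarrow> int \<Rightarrow> nat" where "sh k \<omega> t = Y (t + k) \<omega>"

lemma sh_meas [measurable]: "sh k \<in> M \<rightarrow>\<^sub>M seq_space"
  unfolding sh_def[abs_def] by (rule measurable_PiM_single') auto

lemma distr_sh: "distr M seq_space (sh k) = distr M seq_space (sh 0)"
  using stationary unfolding strictly_stationary_def sh_def[abs_def] by simp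

lemma integral_sh:
  fixes f :: "(int \<Rightarrow> nat) \<Rightarrow> real"
  assumes [measurable]: "f \<in> borel_measurable seq_space"
  shows "(\<integral>\<omega>. f (sh k \<omega>) \<partial>M) = (\<integral>\<omega>. f (sh 0 \<omega>) \<partial>M)"
  using distr_sh[of k] by (simp add: integral_distr[symmetric, OF sh_meas assms])

lemma integrable_sh:
  fixes f :: "(int \<Rightarrow> nat) \<Rightarrow> real"
  assumes [measurable]: "f \<in> borel_measurable seq_space"
  shows "integrable M (\<lambda>\<omega>. f (sh k \<omega>)) \<longleftrightarrow> integrable M (\<lambda>\<omega>. f (sh 0 \<omega>))"
  using distr_sh[of k] by (simp add: integrable_distr_eq[symmetric, OF sh_meas assms])

lemma coordinate_meas: "(\<lambda>y. f (y s)) \<in> borel_measurable seq_space" for f :: "nat \<Rightarrow> real"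
  by (rule measurable_compose[OF measurable_component_singleton]) simp_all

lemma Y_fun_meas: "(\<lambda>\<omega>. f (Y t \<omega>)) \<in> borel_measurable M" for f :: "nat \<Rightarrow> real"
  by (rule measurable_compose[OF Y_meas]) simp

lemma integral_Y: "(\<integral>\<omega>. f (Y t \<omega>) \<partial>M) = (\<integral>\<omega>. f (Y 1 \<omega>) \<partial>M)" for f :: "nat \<Rightarrow> real"
  using integral_sh[OF coordinate_meas[of f 0], of t] integral_sh[OF coordinate_meas[of f 0], of 1] by (simp add: sh_def)

lemma integrable_Y: "integrable M (\<lambda>\<omega>. f (Y t \<omega>)) \<longleftrightarrow> integrable M (\<lambda>\<omega>. f (Y 1 \<omega>))" for f :: "nat \<Rightarrow> real"
  using integrable_sh[OF coordinate_meas[of f 0], of t] integrable_sh[OF coordinate_meas[of f 0], of 1] by (simp add: sh_def)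

text \<open>The underlying probability space need not carry a shift, so the ergodic theorem is
  applied to the law of the path on \<open>seq_space\<close>, where the shift is a genuine
  transformation, and then pulled back.\<close>

lemma ergodic_average:
  fixes f :: "(int \<Rightarrow> nat) \<Rightarrow> real"
  assumes [measurable]: "f \<in> borel_measurable seq_space" and f: "integrable M (\<lambda>\<omega>. f (sh 0 \<omega>))"
  shows "AE \<omega> in M. (\<lambda>n. (\<Sum>i<n. f (sh (int i) \<omega>)) / real n) \<longlonglongrightarrow> (\<integral>\<omega>. f (sh 0 \<omega>) \<partial>M)"
proof -
  define Q where "Q = distr M seq_space (sh 0)"
  define S :: "(int \<Rightarrow> nat) \<Rightarrow> int \<Rightarrow> nat" where "S y t = y (t + 1)" for y t
  have Sm: "S \<in> seq_space \<rightarrow>\<^sub>M seq_space"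
    unfolding S_def[abs_def] by (rule measurable_PiM_single') (auto simp: space_PiM)
  interpret Qp: prob_space Q unfolding Q_def by (rule prob_space_distr) simp
  interpret Q: ergodic_transformation Q S
  proof
    show "S \<in> Q \<rightarrow>\<^sub>M Q" using Sm by (simp add: Q_def)
    have "distr Q Q S = distr Q seq_space S" by (rule distr_cong) (simp_all add: Q_def)
    also have "\<dots> = distr M seq_space (S \<circ> sh 0)"
      unfolding Q_def by (rule distr_distr[OF Sm sh_meas])
    also have "S \<circ> sh 0 = sh 1" by (auto simp: S_def sh_def fun_eq_iff)
    finally show "distr Q Q S = Q" by (simp add: Q_def distr_sh[of 1])
    fix A assume A: "A \<in> sets Q" "S -` A \<inter> space Q = A"
    have "A \<in> sets seq_space" using A(1) by (simp add: Q_def)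
    moreover have "(\<lambda>y t. y (t + 1)) -` A = A"
      using A(2) by (simp add: Q_def S_def[abs_def] space_PiM)
    ultimately have "measure M {\<omega> \<in> space M. (\<lambda>t. Y t \<omega>) \<in> A} \<in> {0, 1}"
      using ergodic unfolding ergodic_process_def by blast
    moreover have "measure Q A = measure M {\<omega> \<in> space M. (\<lambda>t. Y t \<omega>) \<in> A}"
      using A(1) unfolding Q_def
      by (subst measure_distr[OF sh_meas]) (auto simp: sh_def[abs_def] vimage_def Int_def conj_commute)
    ultimately show "measure Q A = 0 \<or> measure Q A = 1" by simp
  qed
  have Spow: "(S ^^ i) y = (\<lambda>t. y (t + int i))" for i y
    by (induction i arbitrary: y) (simp_all add: S_def fun_eq_iff add_ac)
  have "integrable Q f" unfolding Q_def using f by (simp add: integrable_distr_eq)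
  from Q.AE_birkhoff_average[OF this]
  have "AE y in Q. (\<lambda>n. (\<Sum>i<n. f (\<lambda>t. y (t + int i))) / real n) \<longlonglongrightarrow> (\<integral>\<omega>. f (sh 0 \<omega>) \<partial>M)"
    unfolding Spow by (simp add: Q_def integral_distr)
  then have "AE \<omega> in M. (\<lambda>n. (\<Sum>i<n. f (\<lambda>t. sh 0 \<omega> (t + int i))) / real n) \<longlonglongrightarrow> (\<integral>\<omega>. f (sh 0 \<omega>) \<partial>M)"
    unfolding Q_def by (rule AE_distrD[OF sh_meas])
  then show ?thesis by (simp add: sh_def[abs_def])
qed

lemma past_subalgebra: "subalgebra M (past M Y t)"
proof -
  have sub: "{Y s -` A \<inter> space M | s A. s \<le> t} \<subseteq> sets M"
    by (auto intro!: measurable_sets[OF Y_meas])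
  moreover have pow: "{Y s -` A \<inter> space M | s A. s \<le> t} \<subseteq> Pow (space M)" by auto
  ultimately show ?thesis
    unfolding subalgebra_def past_def
    by (simp add: space_measure_of_conv sets_measure_of[OF pow] sets.sigma_sets_subset)
qed

lemma space_past [simp]: "space (past M Y t) = space M"
  by (simp add: past_def space_measure_of_conv)

lemma past_mono:
  assumes "s \<le> t" shows "sets (past M Y s) \<subseteq> sets (past M Y t)"
proof -
  have pow: "{Y s -` A \<inter> space M | s A. s \<le> t} \<subseteq> Pow (space M)" for t by auto
  have "{Y r -` A \<inter> space M | r A. r \<le> s} \<subseteq> {Y r -` A \<inter> space M | r A. r \<le> t}"
    using assms by force
  then show ?thesis unfolding past_def sets_measure_of[OF pow] by (rule sigma_sets_mono')
qed

lemma Y_past: "s \<le> t \<Longrightarrow> Y s \<in> past M Y t \<rightarrow>\<^sub>M count_space UNIV"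
proof (rule measurableI)
  fix A assume "s \<le> t"
  have pow: "{Y s -` A \<inter> space M | s A. s \<le> t} \<subseteq> Pow (space M)" by auto
  show "Y s -` A \<inter> space (past M Y t) \<in> sets (past M Y t)"
    unfolding past_def sets_measure_of[OF pow] using \<open>s \<le> t\<close> by (auto simp: space_measure_of_conv)
qed simp

lemma past_measurable: "f \<in> borel_measurable (past M Y t) \<Longrightarrow> f \<in> borel_measurable M"
  using past_subalgebra measurable_from_subalg by blast

lemma sigma_finite_past: "sigma_finite_subalgebra M (past M Y t)"
  by (intro finite_measure_subalgebra_is_sigma_finite finite_measure_subalgebra.intro
      finite_measure_axioms finite_measure_subalgebra_axioms.intro past_subalgebra)

definition rate :: "nat \<Rightarrow> real" where "rate y = \<theta>1 + \<theta>2 * real y"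

lemma rate_pos: "0 < rate y"
  unfolding rate_def using \<theta>1 \<theta>2 by (simp add: add_pos_nonneg)

abbreviation kern :: "nat \<Rightarrow> nat \<Rightarrow> real" where
  "kern y k \<equiv> pmf (poisson_pmf (rate y)) k"

lemma kern_meas [measurable]: "(\<lambda>\<omega>. kern (Y s \<omega>) k) \<in> borel_measurable M"
  by (rule Y_fun_meas)

lemma ind_meas [measurable]: "(\<lambda>\<omega>. indicator {k} (Y s \<omega>) :: real) \<in> borel_measurable M"
  by (rule Y_fun_meas)

lemma conditional_pmf:
  fixes Z :: "'a \<Rightarrow> real"
  assumes Z: "Z \<in> borel_measurable (past M Y (t - 1))" and Zi: "integrable M Z"
  shows "(\<integral>\<omega>. Z \<omega> * indicator {k} (Y t \<omega>) \<partial>M) = (\<integral>\<omega>. Z \<omega> * kern (Y (t - 1) \<omega>) k \<partial>M)"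
    and "integrable M (\<lambda>\<omega>. Z \<omega> * indicator {k} (Y t \<omega>))" "integrable M (\<lambda>\<omega>. Z \<omega> * kern (Y (t - 1) \<omega>) k)"
proof -
  interpret F: sigma_finite_subalgebra M "past M Y (t - 1)" by (rule sigma_finite_past)
  have [measurable]: "Z \<in> borel_measurable M" by (rule past_measurable[OF Z])
  let ?I = "indicator {\<omega> \<in> space M. Y t \<omega> = k} :: 'a \<Rightarrow> real"
  have [measurable]: "{\<omega> \<in> space M. Y t \<omega> = k} \<in> sets M" by measurable
  show i: "integrable M (\<lambda>\<omega>. Z \<omega> * indicator {k} (Y t \<omega>))"
    by (rule Bochner_Integration.integrable_bound[OF Zi]) (auto split: split_indicator)
  show "integrable M (\<lambda>\<omega>. Z \<omega> * kern (Y (t - 1) \<omega>) k)"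
    by (rule Bochner_Integration.integrable_bound[OF Zi])
       (auto simp: abs_mult pmf_le_1 intro!: AE_I2 mult_right_le_one_le)
  have eq: "Z \<omega> * indicator {k} (Y t \<omega>) = Z \<omega> * ?I \<omega>" if "\<omega> \<in> space M" for \<omega>
    using that by (auto split: split_indicator)
  then have i': "integrable M (\<lambda>\<omega>. Z \<omega> * ?I \<omega>)"
    using i by (subst (asm) Bochner_Integration.integrable_cong[OF refl eq]) auto
  have "(\<integral>\<omega>. Z \<omega> * indicator {k} (Y t \<omega>) \<partial>M) = (\<integral>\<omega>. Z \<omega> * ?I \<omega> \<partial>M)"
    by (rule Bochner_Integration.integral_cong) (simp_all add: eq)
  also have "\<dots> = (\<integral>\<omega>. Z \<omega> * real_cond_exp M (past M Y (t - 1)) ?I \<omega> \<partial>M)"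
    by (rule F.real_cond_exp_intg(2)[symmetric, OF i' Z]) measurable
  also have "\<dots> = (\<integral>\<omega>. Z \<omega> * kern (Y (t - 1) \<omega>) k \<partial>M)"
  proof (rule integral_cong_AE)
    have "AE \<omega> in M. real_cond_exp M (past M Y (t - 1)) ?I \<omega> = kern (Y (t - 1) \<omega>) k"
      using model unfolding poisson_inarch1_def rate_def by blast
    then show "AE \<omega> in M. Z \<omega> * real_cond_exp M (past M Y (t - 1)) ?I \<omega> = Z \<omega> * kern (Y (t - 1) \<omega>) k"
      by eventually_elim simp
    show "(\<lambda>\<omega>. Z \<omega> * real_cond_exp M (past M Y (t - 1)) ?I \<omega>) \<in> borel_measurable M"
      using past_measurable[OF Z] borel_measurable_cond_exp2[of M "past M Y (t - 1)" ?I]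
      by (rule borel_measurable_times)
  qed measurable
  finally show "(\<integral>\<omega>. Z \<omega> * indicator {k} (Y t \<omega>) \<partial>M) = (\<integral>\<omega>. Z \<omega> * kern (Y (t - 1) \<omega>) k \<partial>M)" .
qed

lemma prob_Y_eq: "prob {\<omega> \<in> space M. Y t \<omega> = k} = (\<integral>\<omega>. kern (Y (t - 1) \<omega>) k \<partial>M)"
proof -
  have "prob {\<omega> \<in> space M. Y t \<omega> = k} = (\<integral>\<omega>. indicator {\<omega> \<in> space M. Y t \<omega> = k} \<omega> \<partial>M)" by simp
  also have "\<dots> = (\<integral>\<omega>. 1 * indicator {k} (Y t \<omega>) \<partial>M)"
    by (intro Bochner_Integration.integral_cong) (auto split: split_indicator)
  also have "\<dots> = (\<integral>\<omega>. 1 * kern (Y (t - 1) \<omega>) k \<partial>M)" by (rule conditional_pmf) simp_all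
  also have "\<dots> = (\<integral>\<omega>. kern (Y (t - 1) \<omega>) k \<partial>M)" by simp
  finally show ?thesis .
qed

text \<open>For extended nonnegative values sum and integral may be exchanged without integrability,
  and no moment of Y is known to be finite at this stage.\<close>

lemma nn_integral_Y:
  fixes f :: "nat \<Rightarrow> ennreal"
  shows "(\<integral>\<^sup>+\<omega>. f (Y t \<omega>) \<partial>M) = (\<integral>\<^sup>+\<omega>. (\<Sum>k. f k * ennreal (kern (Y (t - 1) \<omega>) k)) \<partial>M)"
proof -
  have k: "emeasure M {\<omega> \<in> space M. Y t \<omega> = k} = (\<integral>\<^sup>+\<omega>. ennreal (kern (Y (t - 1) \<omega>) k) \<partial>M)" for k
    unfolding emeasure_eq_measure prob_Y_eq
    by (intro nn_integral_eq_integral[symmetric] integrable_const_bound[of _ 1]) (auto simp: pmf_le_1)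
  have "(\<integral>\<^sup>+\<omega>. f (Y t \<omega>) \<partial>M) = (\<integral>\<^sup>+\<omega>. (\<Sum>k. f k * indicator {\<omega> \<in> space M. Y t \<omega> = k} \<omega>) \<partial>M)"
  proof (rule nn_integral_cong)
    fix \<omega> assume "\<omega> \<in> space M"
    then have "(\<Sum>k. f k * indicator {\<omega> \<in> space M. Y t \<omega> = k} \<omega>) = (\<Sum>k\<in>{Y t \<omega>}. f k * indicator {\<omega> \<in> space M. Y t \<omega> = k} \<omega>)"
      by (intro suminf_finite) (auto split: split_indicator)
    with \<open>\<omega> \<in> space M\<close> show "f (Y t \<omega>) = (\<Sum>k. f k * indicator {\<omega> \<in> space M. Y t \<omega> = k} \<omega>)" by simp
  qed
  also have "\<dots> = (\<Sum>k. f k * emeasure M {\<omega> \<in> space M. Y t \<omega> = k})"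
    by (subst nn_integral_suminf) (auto simp: nn_integral_cmult_indicator)
  also have "\<dots> = (\<integral>\<^sup>+\<omega>. (\<Sum>k. f k * ennreal (kern (Y (t - 1) \<omega>) k)) \<partial>M)"
    unfolding k by (subst nn_integral_suminf) (auto simp: nn_integral_cmult)
  finally show ?thesis .
qed

end

section \<open>Exponential moments of the stationary distribution\<close>

context inarch begin

text \<open>Stationarity turns the drift inequality for E = exp(sY) into a bound of its mean by half
  of itself plus C, which is empty if the mean is infinite. With truncation at K it says that
  min(E,K) - min(E/2,K) has mean at most C; this difference increases to E/2 as K grows.\<close>

lemma exponential_moment:
  obtains s where "0 < s" "integrable M (\<lambda>\<omega>. exp (s * real (Y 1 \<omega>)))"
proof -
  obtain s C where s: "0 < s" "0 \<le> C"
    and drift: "\<And>y::nat. exp ((\<theta>1 + \<theta>2 * real y) * (exp s - 1)) \<le> exp (s * real y) / 2 + C"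
    using exponential_drift[OF \<theta>1 \<theta>2] by blast
  define g where "g y = exp (rate y * (exp s - 1))" for y
  \<comment> \<open>Truncation is concave, so the conditional mean of the truncated exponential is
    at most the truncated conditional mean; here both bounds, by \<open>g y\<close> and by K, are
    checked directly.\<close>
  have inner: "(\<Sum>k. ennreal (min (exp (s * real k)) K) * ennreal (kern y k)) \<le> ennreal (min (g y) K)"
    if K: "0 \<le> K" for K y
  proof -
    have su: "(\<lambda>k. exp (s * real k) * kern y k) sums g y"
    proof -
      have "exp (s * real k) = exp s ^ k" for k by (simp add: mult.commute flip: exp_of_nat_mult)
      then show ?thesis using poisson_sums_exp[OF rate_pos, of "exp s" y] by (simp add: g_def)
    qed
    have s1: "(\<lambda>k. K * kern y k) sums K"
      using sums_mult[OF poisson_sums_exp[OF rate_pos, of 1 y], of K] by simp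
    have "(\<Sum>k. ennreal (min (exp (s * real k)) K) * ennreal (kern y k)) \<le> (\<Sum>k. ennreal (exp (s * real k) * kern y k))"
      using K by (intro suminf_le) (auto simp: ennreal_mult'[symmetric] intro!: ennreal_leI mult_right_mono)
    also have "\<dots> = ennreal (g y)" using su by (intro suminf_ennreal_eq) auto
    finally have 1: "(\<Sum>k. ennreal (min (exp (s * real k)) K) * ennreal (kern y k)) \<le> ennreal (g y)" .
    have "(\<Sum>k. ennreal (min (exp (s * real k)) K) * ennreal (kern y k)) \<le> (\<Sum>k. ennreal (K * kern y k))"
      using K by (intro suminf_le) (auto simp: ennreal_mult'[symmetric] intro!: ennreal_leI mult_right_mono)
    also have "\<dots> = ennreal K" using s1 K by (intro suminf_ennreal_eq) auto
    finally show ?thesis using 1 by (auto simp: min_def)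
  qed
  let ?e = "\<lambda>\<omega>. exp (s * real (Y 1 \<omega>))"
  have [measurable]: "?e \<in> borel_measurable M" by (rule Y_fun_meas)
  have gm: "(\<lambda>\<omega>. min (g (Y t \<omega>)) K) \<in> borel_measurable M" for t K by (rule Y_fun_meas)
  have em: "(\<lambda>\<omega>. min (?e \<omega>) K) \<in> borel_measurable M" for K by (rule Y_fun_meas)
  have step: "(\<integral>\<omega>. min (?e \<omega>) K - min (?e \<omega> / 2) K \<partial>M) \<le> C" if K: "0 \<le> K" for K
  proof -
    have ib: "integrable M (\<lambda>\<omega>. min (h (Y t \<omega>)) K)" if "\<And>y. 0 \<le> h y" for h t
      by (intro integrable_const_bound[of _ K] Y_fun_meas) (use K that in auto)
    have "ennreal (\<integral>\<omega>. min (?e \<omega>) K \<partial>M) = (\<integral>\<^sup>+\<omega>. ennreal (min (?e \<omega>) K) \<partial>M)"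
      using K by (intro nn_integral_eq_integral[symmetric] ib) auto
    also have "\<dots> = (\<integral>\<^sup>+\<omega>. (\<Sum>k. ennreal (min (exp (s * real k)) K) * ennreal (kern (Y (1 - 1) \<omega>) k)) \<partial>M)"
      by (rule nn_integral_Y)
    also have "\<dots> \<le> (\<integral>\<^sup>+\<omega>. ennreal (min (g (Y 0 \<omega>)) K) \<partial>M)"
      using inner[OF K] by (intro nn_integral_mono) simp
    also have "\<dots> = ennreal (\<integral>\<omega>. min (g (Y 0 \<omega>)) K \<partial>M)"
      using K by (intro nn_integral_eq_integral ib) (auto simp: g_def)
    finally have "(\<integral>\<omega>. min (?e \<omega>) K \<partial>M) \<le> (\<integral>\<omega>. min (g (Y 0 \<omega>)) K \<partial>M)"
      using K by (subst (asm) ennreal_le_iff) (auto intro!: integral_nonneg_AE simp: g_def)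
    also have "\<dots> = (\<integral>\<omega>. min (g (Y 1 \<omega>)) K \<partial>M)" by (rule integral_Y[of "\<lambda>y. min (g y) K"])
    also have "\<dots> \<le> (\<integral>\<omega>. min (?e \<omega> / 2) K + C \<partial>M)"
    proof (rule integral_mono)
      show "min (g (Y 1 \<omega>)) K \<le> min (?e \<omega> / 2) K + C" for \<omega>
        using drift[of "Y 1 \<omega>"] s by (auto simp: g_def rate_def min_def)
      show "integrable M (\<lambda>\<omega>. min (g (Y 1 \<omega>)) K)" by (rule ib) (simp add: g_def)
      show "integrable M (\<lambda>\<omega>. min (?e \<omega> / 2) K + C)"
        using ib[of "\<lambda>y. exp (s * real y) / 2" 1] by simp
    qed
    finally show ?thesis
      using ib[of "\<lambda>y. exp (s * real y) / 2" 1] ib[of "\<lambda>y. exp (s * real y)" 1] by (simp add: prob_space)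
  qed
  \<comment> \<open>For x \<ge> 0 the difference min(x,n) - min(x/2,n) is 0 up to n = x/2, then
    grows linearly to x/2 at n = x and stays there, so monotone convergence applies.\<close>
  let ?f = "\<lambda>n::nat. \<lambda>\<omega>. ennreal (min (?e \<omega>) n - min (?e \<omega> / 2) n)"
  have "(\<integral>\<^sup>+\<omega>. ennreal (?e \<omega> / 2) \<partial>M) \<le> (\<integral>\<^sup>+\<omega>. (SUP n. ?f n \<omega>) \<partial>M)"
  proof (rule nn_integral_mono)
    fix \<omega>
    obtain n :: nat where "?e \<omega> \<le> n" using real_arch_simple by blast
    then have "?f n \<omega> = ennreal (?e \<omega> / 2)" by (simp add: min_def)
    moreover have "?f n \<omega> \<le> (SUP n. ?f n \<omega>)" by (rule SUP_upper) simp
    ultimately show "ennreal (?e \<omega> / 2) \<le> (SUP n. ?f n \<omega>)" by simp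
  qed
  also have "\<dots> = (SUP n. \<integral>\<^sup>+\<omega>. ?f n \<omega> \<partial>M)"
  proof (rule nn_integral_monotone_convergence_SUP)
    have "min x (real m) - min (x / 2) (real m) \<le> min x (real n) - min (x / 2) (real n)" if "m \<le> n" "0 \<le> x" for m n x
      using that by (auto simp: min_def)
    then show "incseq ?f" by (intro incseq_SucI le_funI ennreal_leI) auto
  qed measurable
  also have "\<dots> \<le> ennreal C"
  proof (rule SUP_least)
    fix n :: nat
    have "(\<integral>\<^sup>+\<omega>. ?f n \<omega> \<partial>M) = ennreal (\<integral>\<omega>. min (?e \<omega>) n - min (?e \<omega> / 2) n \<partial>M)"
      by (intro nn_integral_eq_integral integrable_const_bound[of _ n]) (auto simp: min_def)
    also have "\<dots> \<le> ennreal C" by (intro ennreal_leI step) simp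
    finally show "(\<integral>\<^sup>+\<omega>. ?f n \<omega> \<partial>M) \<le> ennreal C" .
  qed
  finally have "(\<integral>\<^sup>+\<omega>. ennreal (norm (?e \<omega> / 2)) \<partial>M) < \<infinity>"
    by (simp add: le_less_trans[OF _ ennreal_less_top])
  then have "integrable M (\<lambda>\<omega>. ?e \<omega> / 2)" by (intro integrableI_bounded) measurable
  from integrable_mult_right[OF this, of 2] have "integrable M ?e" by simp
  with s(1) show thesis by (rule that)
qed

lemma integrable_Y_le_exp:
  assumes "0 < s" "integrable M (\<lambda>\<omega>. exp (s * real (Y 1 \<omega>)))"
    and "\<And>y. \<bar>f y\<bar> \<le> A * exp (s * real y)"
  shows "integrable M (\<lambda>\<omega>. f (Y t \<omega>))"
proof -
  have "integrable M (\<lambda>\<omega>. f (Y 1 \<omega>))"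
  proof (rule Bochner_Integration.integrable_bound)
    show "integrable M (\<lambda>\<omega>. A * exp (s * real (Y 1 \<omega>)))" using assms(2) by simp
    show "AE \<omega> in M. norm (f (Y 1 \<omega>)) \<le> norm (A * exp (s * real (Y 1 \<omega>)))"
      by (intro AE_I2) (simp add: order_trans[OF assms(3) abs_ge_self])
  qed (rule Y_fun_meas)
  then show ?thesis unfolding integrable_Y[of f t] .
qed

lemma integrable_Y_sq: "integrable M (\<lambda>\<omega>. (real (Y t \<omega>))\<^sup>2)"
proof -
  obtain s where s: "0 < s" "integrable M (\<lambda>\<omega>. exp (s * real (Y 1 \<omega>)))" by (rule exponential_moment)
  show ?thesis
  proof (rule integrable_Y_le_exp[OF s, of "\<lambda>y. (real y)\<^sup>2" "2 / s\<^sup>2"])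
    fix y :: nat
    have "1 + s * real y + (s * real y)\<^sup>2 / 2 \<le> exp (s * real y)"
      using s by (intro exp_lower_Taylor_quadratic) simp
    moreover have "0 \<le> 1 + s * real y" using s by simp
    ultimately have "(s * real y)\<^sup>2 \<le> 2 * exp (s * real y)" by linarith
    then show "\<bar>(real y)\<^sup>2\<bar> \<le> 2 / s\<^sup>2 * exp (s * real y)"
      using s by (simp add: field_simps power_mult_distrib)
  qed
qed

lemma integrable_Y_real: "integrable M (\<lambda>\<omega>. real (Y t \<omega>))"
  by (rule square_integrable_imp_integrable[OF Y_fun_meas integrable_Y_sq])

lemma prob_Y: "prob {\<omega> \<in> space M. Y t \<omega> = k} = (\<integral>\<omega>. indicator {k} (Y t \<omega>) \<partial>M)"
proof -
  have "(\<integral>\<omega>. (indicator {k} (Y t \<omega>) :: real) \<partial>M) = (\<integral>\<omega>. indicator {\<omega> \<in> space M. Y t \<omega> = k} \<omega> \<partial>M)"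
    by (intro Bochner_Integration.integral_cong) (auto split: split_indicator)
  then show ?thesis by simp
qed

lemma integrable_indicator_Y: "integrable M (\<lambda>\<omega>. indicator {k} (Y t \<omega>) :: real)"
  by (intro integrable_const_bound[of _ 1]) auto

lemma integrable_kern_Y: "integrable M (\<lambda>\<omega>. kern (Y t \<omega>) k)"
  by (intro integrable_const_bound[of _ 1]) (auto simp: pmf_le_1)

lemma prob_Y_shift: "prob {\<omega> \<in> space M. Y t \<omega> = k} = prob {\<omega> \<in> space M. Y 1 \<omega> = k}"
  unfolding prob_Y by (rule integral_Y)

text \<open>Markov's inequality for exp(sY). The ratio exp(-s/4) is the fourth root of the actual
  rate, so the decay comes in the form that the box estimate consumes.\<close>

lemma prob_Y_decay:
  obtains \<rho> A where "0 < \<rho>" "\<rho> < 1" "0 \<le> A" "\<And>t k. prob {\<omega> \<in> space M. Y t \<omega> = k} \<le> A * \<rho> ^ (4 * k)"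
proof -
  obtain s where s: "0 < s" "integrable M (\<lambda>\<omega>. exp (s * real (Y 1 \<omega>)))" by (rule exponential_moment)
  define A where "A = (\<integral>\<omega>. exp (s * real (Y 1 \<omega>)) \<partial>M)"
  show thesis
  proof
    show "0 < exp (- s / 4)" "exp (- s / 4) < 1" using s by auto
    show "0 \<le> A" by (simp add: A_def)
    fix t k
    have "exp (s * real k) * prob {\<omega> \<in> space M. Y 1 \<omega> = k} = (\<integral>\<omega>. exp (s * real k) * indicator {k} (Y 1 \<omega>) \<partial>M)"
      unfolding prob_Y by simp
    also have "\<dots> \<le> A" unfolding A_def
    proof (rule integral_mono)
      show "integrable M (\<lambda>\<omega>. exp (s * real k) * indicator {k} (Y 1 \<omega>))"
        by (intro integrable_mult_right integrable_indicator_Y)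
    qed (auto simp: s split: split_indicator)
    finally have "prob {\<omega> \<in> space M. Y 1 \<omega> = k} \<le> A * exp (- s * real k)"
      by (simp add: exp_minus field_simps)
    also have "exp (- s * real k) = exp (- s / 4) ^ (4 * k)" by (simp flip: exp_of_nat_mult)
    finally show "prob {\<omega> \<in> space M. Y t \<omega> = k} \<le> A * exp (- s / 4) ^ (4 * k)" unfolding prob_Y_shift[of t] .
  qed
qed

end

text \<open>Lists over a countable type are discrete data again, so arbitrary functions of them,
  such as \<open>l1\<close>, \<open>l2\<close> and the estimators, are measurable.\<close>

lemma measurable_map_list:
  fixes f :: "'i \<Rightarrow> 'a \<Rightarrow> 'b::countable"
  assumes "\<And>i. i \<in> set xs \<Longrightarrow> f i \<in> N \<rightarrow>\<^sub>M count_space UNIV"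
  shows "(\<lambda>\<omega>. map (\<lambda>i. f i \<omega>) xs) \<in> N \<rightarrow>\<^sub>M count_space UNIV"
  using assms
proof (induction xs)
  case (Cons i xs)
  have "(\<lambda>\<omega>. (f i \<omega>, map (\<lambda>i. f i \<omega>) xs)) \<in> N \<rightarrow>\<^sub>M count_space UNIV \<Otimes>\<^sub>M count_space UNIV"
    using Cons by (intro measurable_Pair) auto
  then have "(\<lambda>\<omega>. (f i \<omega>, map (\<lambda>i. f i \<omega>) xs)) \<in> N \<rightarrow>\<^sub>M count_space UNIV"
    by (simp add: pair_measure_countable)
  from measurable_compose[OF this, of "\<lambda>(x, xs). x # xs" "count_space UNIV"] show ?case by simp
qed simp

locale inarch_est = inarch M Y \<theta>1 \<theta>2 for M :: "'a measure" and Y \<theta>1 \<theta>2 +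
  fixes q :: nat and l1 l2 :: "nat list \<Rightarrow> real \<Rightarrow> real \<Rightarrow> real"
  assumes q: "1 \<le> q"
    and l1_mds: "martingale_difference_from M (past M Y) (int q + 1) (\<lambda>t \<omega>. l1 (lag_vec Y q t \<omega>) \<theta>1 \<theta>2)"
    and l2_mds: "martingale_difference_from M (past M Y) (int q + 1) (\<lambda>t \<omega>. l2 (lag_vec Y q t \<omega>) \<theta>1 \<theta>2)"
    and l1_sq: "\<And>t. t \<ge> int q + 1 \<Longrightarrow> integrable M (\<lambda>\<omega>. (l1 (lag_vec Y q t \<omega>) \<theta>1 \<theta>2)\<^sup>2)"
    and l2_sq: "\<And>t. t \<ge> int q + 1 \<Longrightarrow> integrable M (\<lambda>\<omega>. (l2 (lag_vec Y q t \<omega>) \<theta>1 \<theta>2)\<^sup>2)"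
begin

text \<open>The coordinates of the expansion of the process in powers of \<open>u\<close>: the two estimation terms
  come first, followed by the centred indicators of the values of \<open>Y\<close>.\<close>

fun inc :: "nat \<Rightarrow> (int \<Rightarrow> nat) \<Rightarrow> real" where
  "inc 0 y = l1 (map (\<lambda>i. y (- int i)) [0..<Suc q]) \<theta>1 \<theta>2"
| "inc (Suc 0) y = l2 (map (\<lambda>i. y (- int i)) [0..<Suc q]) \<theta>1 \<theta>2"
| "inc (Suc (Suc k)) y = indicator {k} (y 0) - kern (y (- 1)) k"

declare inc.simps [simp del]

lemma lag_vec_sh: "map (\<lambda>i. sh t \<omega> (- int i)) [0..<Suc q] = lag_vec Y q t \<omega>"
  by (simp add: lag_vec_def sh_def add.commute[of "- int _"])

lemma inc_sh:
  "inc 0 (sh t \<omega>) = l1 (lag_vec Y q t \<omega>) \<theta>1 \<theta>2"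
  "inc (Suc 0) (sh t \<omega>) = l2 (lag_vec Y q t \<omega>) \<theta>1 \<theta>2"
  "inc (Suc (Suc k)) (sh t \<omega>) = indicator {k} (Y t \<omega>) - kern (Y (t - 1) \<omega>) k"
  unfolding inc.simps lag_vec_sh by (simp_all add: sh_def)

lemma nat_cases2: obtains "k = 0" | "k = Suc 0" | j where "k = Suc (Suc j)"
  by (metis not0_implies_Suc)

lemma inc_meas [measurable]: "inc k \<in> borel_measurable seq_space"
proof -
  have "(\<lambda>y. map (\<lambda>i. y (- int i)) [0..<Suc q]) \<in> seq_space \<rightarrow>\<^sub>M count_space UNIV"
    by (rule measurable_map_list) (rule measurable_component_singleton, simp)
  from measurable_compose[OF this, of _ borel] have "(\<lambda>y. f (map (\<lambda>i. y (- int i)) [0..<Suc q])) \<in> borel_measurable seq_space"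
    for f :: "nat list \<Rightarrow> real" by simp
  then show ?thesis
    by (cases k rule: nat_cases2)
       (auto simp del: upt_Suc simp: inc.simps[abs_def] intro!: borel_measurable_diff coordinate_meas)
qed

lemma inc_past: "(\<lambda>\<omega>. inc k (sh t \<omega>)) \<in> borel_measurable (past M Y t)"
proof -
  have "(\<lambda>\<omega>. lag_vec Y q t \<omega>) \<in> past M Y t \<rightarrow>\<^sub>M count_space UNIV"
    unfolding lag_vec_def by (rule measurable_map_list) (rule Y_past, simp)
  from measurable_compose[OF this, of _ borel] have 1: "(\<lambda>\<omega>. f (lag_vec Y q t \<omega>)) \<in> borel_measurable (past M Y t)"
    for f :: "nat list \<Rightarrow> real" by simp
  have 2: "(\<lambda>\<omega>. f (Y s \<omega>)) \<in> borel_measurable (past M Y t)" if "s \<le> t" for s and f :: "nat \<Rightarrow> real"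
    by (rule measurable_compose[OF Y_past[OF that]]) simp
  show ?thesis
    by (cases k rule: nat_cases2) (auto simp: inc_sh intro!: 1 2 borel_measurable_diff)
qed

lemma inc_sh_meas [measurable]: "(\<lambda>\<omega>. inc k (sh t \<omega>)) \<in> borel_measurable M"
  by (rule measurable_compose[OF sh_meas inc_meas])

lemma inc_bound: "\<bar>inc (Suc (Suc k)) y\<bar> \<le> 1"
  using pmf_le_1[of "poisson_pmf (rate (y (- 1)))" k] pmf_nonneg[of "poisson_pmf (rate (y (- 1)))" k]
  by (auto simp: inc.simps split: split_indicator)

lemma inc_sq: "integrable M (\<lambda>\<omega>. (inc k (sh t \<omega>))\<^sup>2)"
proof -
  have "integrable M (\<lambda>\<omega>. (inc k (sh (int q + 1) \<omega>))\<^sup>2)"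
  proof (cases k rule: nat_cases2)
    case (3 j)
    have "(inc (Suc (Suc j)) y)\<^sup>2 \<le> 1" for y using inc_bound[of j y] by (simp add: abs_square_le_1)
    then show ?thesis unfolding 3 by (intro integrable_const_bound[of _ 1]) auto
  qed (use l1_sq l2_sq in \<open>simp_all add: inc_sh\<close>)
  then show ?thesis
    using integrable_sh[of "\<lambda>y. (inc k y)\<^sup>2" t] integrable_sh[of "\<lambda>y. (inc k y)\<^sup>2" "int q + 1"] by simp
qed

text \<open>The estimation terms are martingale differences by assumption, the centred indicators by
  the Poisson model. Z is merely square integrable because partial sums are used as multipliers in
  \<open>W_sq\<close>.\<close>

lemma inc_orthogonal:
  assumes t: "int q + 1 \<le> t" and Z: "Z \<in> borel_measurable (past M Y (t - 1))"
    and Z2: "integrable M (\<lambda>\<omega>. (Z \<omega>)\<^sup>2)"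
  shows "(\<integral>\<omega>. Z \<omega> * inc k (sh t \<omega>) \<partial>M) = 0"
proof -
  interpret F: sigma_finite_subalgebra M "past M Y (t - 1)" by (rule sigma_finite_past)
  have Zm [measurable]: "Z \<in> borel_measurable M" by (rule past_measurable[OF Z])
  have Zi: "integrable M Z" by (rule square_integrable_imp_integrable[OF Zm Z2])
  have ind: "integrable M (\<lambda>\<omega>. Z \<omega> * inc k (sh t \<omega>))"
    by (intro integrable_mult_L2 Z2 inc_sq; measurable)
  have mds: "(\<integral>\<omega>. Z \<omega> * X \<omega> \<partial>M) = 0"
    if X: "integrable M (\<lambda>\<omega>. Z \<omega> * X \<omega>)" "X \<in> borel_measurable M"
      "AE \<omega> in M. real_cond_exp M (past M Y (t - 1)) X \<omega> = 0" for X
  proof -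
    have "(\<integral>\<omega>. Z \<omega> * X \<omega> \<partial>M) = (\<integral>\<omega>. Z \<omega> * real_cond_exp M (past M Y (t - 1)) X \<omega> \<partial>M)"
      by (rule F.real_cond_exp_intg(2)[symmetric, OF X(1) Z X(2)])
    also have "\<dots> = 0" using X(3) by (intro integral_eq_zero_AE) auto
    finally show ?thesis .
  qed
  show ?thesis
  proof (cases k rule: nat_cases2)
    case 1
    show ?thesis using l1_mds t unfolding 1 martingale_difference_from_def
      by (intro mds ind[unfolded 1]) (auto simp: inc_sh)
  next
    case 2
    show ?thesis using l2_mds t unfolding 2 martingale_difference_from_def
      by (intro mds ind[unfolded 2]) (auto simp: inc_sh)
  next
    case (3 j)
    show ?thesis unfolding 3 inc_sh right_diff_distrib
      using conditional_pmf[OF Z Zi, of j] by simp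
  qed
qed

lemma inc_var:
  obtains \<rho> C where "0 < \<rho>" "\<rho> < 1" "\<And>k t. (\<integral>\<omega>. (inc k (sh t \<omega>))\<^sup>2 \<partial>M) \<le> C * \<rho> ^ (4 * k)"
proof -
  obtain \<rho> A where \<rho>: "0 < \<rho>" "\<rho> < 1" and A: "0 \<le> A" "\<And>t k. prob {\<omega> \<in> space M. Y t \<omega> = k} \<le> A * \<rho> ^ (4 * k)"
    by (rule prob_Y_decay) (rule that, assumption+)
  define v where "v k = (\<integral>\<omega>. (inc k (sh 0 \<omega>))\<^sup>2 \<partial>M)" for k
  have v: "(\<integral>\<omega>. (inc k (sh t \<omega>))\<^sup>2 \<partial>M) = v k" for k t
    unfolding v_def by (rule integral_sh) measurable
  have v0: "0 \<le> v k" for k by (simp add: v_def)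
  \<comment> \<open>The centred indicator of the value j has index j + 2, which costs the factor
    \<open>\<rho> ^ 8\<close>. Enlarging C by the variances of the two estimation terms fits them
    under the same bound.\<close>
  define C where "C = (v 0 + v 1 + 4 * A) / \<rho> ^ 8"
  show thesis
  proof (rule that[OF \<rho>])
    fix k t
    have r8: "0 < \<rho> ^ 8" "\<rho> ^ 8 \<le> 1" using \<rho> by (auto intro: power_le_one)
    show "(\<integral>\<omega>. (inc k (sh t \<omega>))\<^sup>2 \<partial>M) \<le> C * \<rho> ^ (4 * k)"
    proof (cases "k < 2")
      case True
      then have "v k \<le> v 0 + v 1 + 4 * A" using v0 A by (auto simp: less_2_cases_iff)
      also have "\<dots> = C * \<rho> ^ 8" using \<rho> by (simp add: C_def)
      also have "\<dots> \<le> C * \<rho> ^ (4 * k)"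
        using True v0 A \<rho> by (intro mult_left_mono power_decreasing) (auto simp: C_def)
      finally show ?thesis unfolding v .
    next
      case False
      then obtain j where j: "k = Suc (Suc j)" by (metis add_2_eq_Suc le_Suc_ex not_less)
      have "v k \<le> (\<integral>\<omega>. 2 * indicator {j} (Y 0 \<omega>) + 2 * kern (Y (0 - 1) \<omega>) j \<partial>M)"
        unfolding v_def j inc_sh
      proof (rule integral_mono)
        show "(indicator {j} (Y 0 \<omega>) - kern (Y (0 - 1) \<omega>) j)\<^sup>2 \<le> 2 * indicator {j} (Y 0 \<omega>) + 2 * kern (Y (0 - 1) \<omega>) j" for \<omega>
        proof -
          have "(indicator {j} (Y 0 \<omega>) - p)\<^sup>2 \<le> 2 * indicator {j} (Y 0 \<omega>) + 2 * p" if p: "0 \<le> p" "p \<le> 1" for p :: real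
          proof -
            have "p\<^sup>2 \<le> p" using p by (simp add: power2_eq_square mult_left_le)
            with p show ?thesis by (auto simp: power2_diff split: split_indicator)
          qed
          then show ?thesis by (simp add: pmf_le_1)
        qed
        show "integrable M (\<lambda>\<omega>. (indicator {j} (Y 0 \<omega>) - kern (Y (0 - 1) \<omega>) j)\<^sup>2)"
          using inc_sq[of "Suc (Suc j)" 0] unfolding inc_sh .
        show "integrable M (\<lambda>\<omega>. 2 * indicator {j} (Y 0 \<omega>) + 2 * kern (Y (0 - 1) \<omega>) j)"
          by (intro Bochner_Integration.integrable_add integrable_mult_right integrable_indicator_Y integrable_kern_Y)
      qed
      also have "\<dots> = 4 * prob {\<omega> \<in> space M. Y 0 \<omega> = j}"
      proof -
        have "(\<integral>\<omega>. 2 * indicator {j} (Y 0 \<omega>) + 2 * kern (Y (0 - 1) \<omega>) j \<partial>M)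
            = (\<integral>\<omega>. 2 * indicator {j} (Y 0 \<omega>) \<partial>M) + (\<integral>\<omega>. 2 * kern (Y (0 - 1) \<omega>) j \<partial>M)"
          by (intro Bochner_Integration.integral_add integrable_mult_right integrable_indicator_Y integrable_kern_Y)
        then show ?thesis by (simp only: integral_mult_right_zero flip: prob_Y prob_Y_eq)
      qed
      also have "\<dots> \<le> 4 * A * \<rho> ^ (4 * j)" using A(2)[of 0 j] by simp
      also have "\<dots> \<le> (v 0 + v 1 + 4 * A) * \<rho> ^ (4 * j)" using v0 \<rho> by (intro mult_right_mono) auto
      also have "\<dots> = C * \<rho> ^ (4 * k)"
      proof -
        have "\<rho> ^ (4 * k) = \<rho> ^ 8 * \<rho> ^ (4 * j)" unfolding j power_add[symmetric] by simp
        then show ?thesis using \<rho> by (simp add: C_def)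
      qed
      finally show ?thesis unfolding v .
    qed
  qed
qed

end

section \<open>The limit of the empirical process\<close>

text \<open>Padding with zeros below q lets the summands start at index 0 while their number stays
  T, in step with the normalisation by the square root of T.\<close>

lemma sum_int_interval_conv_nat:
  fixes f :: "int \<Rightarrow> 'b::comm_monoid_add"
  shows "(\<Sum>t = int q + 1..int T. f t) = (\<Sum>j<T. if q \<le> j then f (int j + 1) else 0)"
proof -
  have "(\<Sum>j<T. if q \<le> j then f (int j + 1) else 0) = (\<Sum>j\<in>{q..<T}. f (int j + 1))"
    by (rule sum.mono_neutral_cong_right) auto
  also have "\<dots> = (\<Sum>t = int q + 1..int T. f t)"
    by (rule sum.reindex_bij_witness[of _ "\<lambda>t. nat (t - 1)" "\<lambda>j. int j + 1"]) auto
  finally show ?thesis ..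
qed

lemma sum_le_first_two:
  fixes a :: "nat \<Rightarrow> real"
  assumes "\<And>k. 0 \<le> a k" shows "(\<Sum>k<n. a k) \<le> a 0 + a 1 + (\<Sum>k<n. a (Suc (Suc k)))"
proof -
  have "(\<Sum>k<n. a k) \<le> (\<Sum>k<Suc (Suc n). a k)" using assms by (intro sum_mono2) auto
  also have "\<dots> = a 0 + a 1 + (\<Sum>k<n. a (Suc (Suc k)))"
    unfolding sum.lessThan_Suc_shift by simp
  finally show ?thesis .
qed

lemma sums_Suc_Suc:
  fixes a :: "nat \<Rightarrow> real"
  assumes "(\<lambda>k. a (Suc (Suc k))) sums s" shows "a sums (a 0 + a 1 + s)"
  using sums_Suc[OF sums_Suc[of "\<lambda>k. a (Suc k)", OF assms]] by (simp add: add_ac)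

section \<open>Coefficients of the process: variances and characteristic functions\<close>

context inarch_est begin

lemma r_bounds:
  assumes "u \<in> {0..1}"
  shows "\<bar>exp ((\<theta>1 + \<theta>2 * real y) * (u - 1)) * (u - 1)\<bar> \<le> 1"
    "\<bar>real y * exp ((\<theta>1 + \<theta>2 * real y) * (u - 1)) * (u - 1)\<bar> \<le> real y"
    "exp ((\<theta>1 + \<theta>2 * real y) * (u - 1)) \<le> 1"
proof -
  have "(\<theta>1 + \<theta>2 * real y) * (u - 1) \<le> 0"
    using rate_pos[of y] assms by (intro mult_nonneg_nonpos) (auto simp: rate_def)
  then show e: "exp ((\<theta>1 + \<theta>2 * real y) * (u - 1)) \<le> 1" by simp
  have "exp ((\<theta>1 + \<theta>2 * real y) * (u - 1)) * \<bar>u - 1\<bar> \<le> 1 * 1"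
    using e assms by (intro mult_mono) auto
  then show 1: "\<bar>exp ((\<theta>1 + \<theta>2 * real y) * (u - 1)) * (u - 1)\<bar> \<le> 1" by (simp add: abs_mult)
  show "\<bar>real y * exp ((\<theta>1 + \<theta>2 * real y) * (u - 1)) * (u - 1)\<bar> \<le> real y"
    using mult_left_mono[OF 1, of "real y"] by (simp add: abs_mult mult.assoc)
qed

lemma r1_continuous: "continuous_on {0..1} (r1 M Y \<theta>1 \<theta>2)"
  unfolding continuous_on_sequentially
proof safe
  fix x :: "nat \<Rightarrow> real" and a :: real assume a: "\<forall>n. x n \<in> {0..1}" "x \<longlonglongrightarrow> a"
  show "(r1 M Y \<theta>1 \<theta>2 \<circ> x) \<longlonglongrightarrow> r1 M Y \<theta>1 \<theta>2 a"
    unfolding comp_def r1_def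
  proof (rule integral_dominated_convergence[where w = "\<lambda>_. 1"])
    show "AE \<omega> in M. norm (exp ((\<theta>1 + \<theta>2 * real (Y 1 \<omega>)) * (x n - 1)) * (x n - 1)) \<le> 1" for n
      using r_bounds(1) a by auto
  qed (auto intro!: tendsto_intros a Y_fun_meas AE_I2)
qed

lemma r2_continuous: "continuous_on {0..1} (r2 M Y \<theta>1 \<theta>2)"
  unfolding continuous_on_sequentially
proof safe
  fix x :: "nat \<Rightarrow> real" and a :: real assume a: "\<forall>n. x n \<in> {0..1}" "x \<longlonglongrightarrow> a"
  show "(r2 M Y \<theta>1 \<theta>2 \<circ> x) \<longlonglongrightarrow> r2 M Y \<theta>1 \<theta>2 a"
    unfolding comp_def r2_def
  proof (rule integral_dominated_convergence[where w = "\<lambda>\<omega>. real (Y 1 \<omega>)"])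
    show "AE \<omega> in M. norm (real (Y 1 \<omega>) * exp ((\<theta>1 + \<theta>2 * real (Y 1 \<omega>)) * (x n - 1)) * (x n - 1)) \<le> real (Y 1 \<omega>)" for n
      using r_bounds(2) a by auto
  qed (auto intro!: tendsto_intros a Y_fun_meas AE_I2 integrable_Y_real)
qed

fun phi :: "nat \<Rightarrow> real \<Rightarrow> real" where
  "phi 0 u = - r1 M Y \<theta>1 \<theta>2 u"
| "phi (Suc 0) u = - r2 M Y \<theta>1 \<theta>2 u"
| "phi (Suc (Suc k)) u = u ^ k"

lemma phi_cont: "continuous_on {0..1} (phi k)"
  by (cases k rule: nat_cases2)
     (auto simp: phi.simps[abs_def] intro!: continuous_intros r1_continuous r2_continuous)

lemma phi_bound: "u \<in> {0..1} \<Longrightarrow> \<bar>phi k u\<bar> \<le> 1 + (\<integral>\<omega>. real (Y 1 \<omega>) \<partial>M)"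
proof (cases k rule: nat_cases2)
  case 1
  assume u: "u \<in> {0..1}"
  have "\<bar>r1 M Y \<theta>1 \<theta>2 u\<bar> \<le> (\<integral>\<omega>. \<bar>exp ((\<theta>1 + \<theta>2 * real (Y 1 \<omega>)) * (u - 1)) * (u - 1)\<bar> \<partial>M)"
    unfolding r1_def by (rule integral_abs_bound)
  also have "\<dots> \<le> 1"
    using r_bounds(1)[OF u] by (intro integral_le_const integrable_const_bound[of _ 1] Y_fun_meas) auto
  also have "\<dots> \<le> 1 + (\<integral>\<omega>. real (Y 1 \<omega>) \<partial>M)" by simp
  finally show ?thesis using 1 by simp
next
  case 2
  assume u: "u \<in> {0..1}"
  have "\<bar>r2 M Y \<theta>1 \<theta>2 u\<bar> \<le> (\<integral>\<omega>. \<bar>real (Y 1 \<omega>) * exp ((\<theta>1 + \<theta>2 * real (Y 1 \<omega>)) * (u - 1)) * (u - 1)\<bar> \<partial>M)"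
    unfolding r2_def by (rule integral_abs_bound)
  also have "\<dots> \<le> (\<integral>\<omega>. real (Y 1 \<omega>) \<partial>M)"
  proof (rule integral_mono)
    have "integrable M (\<lambda>\<omega>. real (Y 1 \<omega>) * exp ((\<theta>1 + \<theta>2 * real (Y 1 \<omega>)) * (u - 1)) * (u - 1))"
      by (rule Bochner_Integration.integrable_bound[OF integrable_Y_real[of 1]])
         (use r_bounds(2)[OF u] in \<open>auto intro: Y_fun_meas\<close>)
    then show "integrable M (\<lambda>\<omega>. \<bar>real (Y 1 \<omega>) * exp ((\<theta>1 + \<theta>2 * real (Y 1 \<omega>)) * (u - 1)) * (u - 1)\<bar>)"
      by (rule integrable_abs)
  qed (use r_bounds(2)[OF u] integrable_Y_real in auto)
  also have "\<dots> \<le> 1 + (\<integral>\<omega>. real (Y 1 \<omega>) \<partial>M)" by simp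
  finally show ?thesis using 2 by simp
next
  case (3 j)
  assume u: "u \<in> {0..1}"
  have "\<bar>u ^ j\<bar> \<le> 1" using u by (simp add: power_le_one)
  also have "\<dots> \<le> 1 + (\<integral>\<omega>. real (Y 1 \<omega>) \<partial>M)" by simp
  finally show ?thesis using 3 by simp
qed

text \<open>Two generating functions: that of the unit mass at the observed value is
  \<open>u ^ Y t \<omega>\<close>, and that of the conditional Poisson law is the exponential in
  \<open>V_proc\<close>.\<close>

lemma phi_inc_sums:
  "(\<lambda>k. phi k u * inc k (sh t \<omega>)) sums calV M Y q l1 l2 \<theta>1 \<theta>2 t u \<omega>"
proof -
  have 1: "(\<lambda>k. u ^ k * indicator {k} (Y t \<omega>)) sums (u ^ Y t \<omega>)"
  proof -
    have "(\<lambda>k. if k = Y t \<omega> then u ^ k else 0) sums (u ^ Y t \<omega>)" by (rule sums_single)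
    moreover have "(\<lambda>k. if k = Y t \<omega> then u ^ k else 0) = (\<lambda>k. u ^ k * indicator {k} (Y t \<omega>))"
      by (auto simp: fun_eq_iff split: split_indicator)
    ultimately show ?thesis by simp
  qed
  have 2: "(\<lambda>k. u ^ k * kern (Y (t - 1) \<omega>) k) sums exp ((\<theta>1 + \<theta>2 * real (Y (t - 1) \<omega>)) * (u - 1))"
    using poisson_sums_exp[OF rate_pos, of u "Y (t - 1) \<omega>"] by (simp add: rate_def)
  have "(\<lambda>k. phi (Suc (Suc k)) u * inc (Suc (Suc k)) (sh t \<omega>)) sums V_proc Y \<theta>1 \<theta>2 t u \<omega>"
    using sums_diff[OF 1 2] by (simp add: inc_sh V_proc_def right_diff_distrib)
  from sums_Suc_Suc[OF this] show ?thesis by (simp add: inc_sh calV_def algebra_simps)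
qed

definition W :: "nat \<Rightarrow> 'a \<Rightarrow> nat \<Rightarrow> real" where
  "W T \<omega> k = (1 / sqrt (real T)) * (\<Sum>t = int q + 1..int T. inc k (sh t \<omega>))"

lemma W_meas [measurable]: "(\<lambda>\<omega>. W T \<omega> k) \<in> borel_measurable M"
  unfolding W_def by measurable

lemma W_series: "(\<lambda>k. phi k u * W T \<omega> k) sums calV_bar M Y q l1 l2 \<theta>1 \<theta>2 T u \<omega>"
proof -
  have "(\<lambda>k. (1 / sqrt (real T)) * (\<Sum>t = int q + 1..int T. phi k u * inc k (sh t \<omega>)))
     sums calV_bar M Y q l1 l2 \<theta>1 \<theta>2 T u \<omega>"
    unfolding calV_bar_def by (intro sums_mult sums_sum phi_inc_sums)
  then show ?thesis by (simp add: W_def sum_distrib_left mult.left_commute)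
qed

definition proc_path :: "nat \<Rightarrow> 'a \<Rightarrow> real \<Rightarrow> real" where
  "proc_path T \<omega> = restrict (\<lambda>u. calV_bar M Y q l1 l2 \<theta>1 \<theta>2 T u \<omega>) {0..1}"

lemma proc_path_eq_series: "proc_path T \<omega> = series_path phi (W T \<omega>)"
  unfolding proc_path_def series_path_def by (intro restrict_ext sums_unique W_series)

text \<open>A path depends on the sample point through a finite list of natural numbers only, which
  reduces measurability into C[0,1] to continuity of each path.\<close>

lemma proc_path_meas: "proc_path T \<in> M \<rightarrow>\<^sub>M borel_of C01"
proof -
  let ?f = "\<lambda>\<omega>. map (\<lambda>t. (lag_vec Y q t \<omega>, Y t \<omega>, Y (t - 1) \<omega>)) [int q + 1..int T]"
  let ?h = "\<lambda>u (x, y, y'). u ^ y - exp ((\<theta>1 + \<theta>2 * real y') * (u - 1))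
      - r1 M Y \<theta>1 \<theta>2 u * l1 x \<theta>1 \<theta>2 - r2 M Y \<theta>1 \<theta>2 u * l2 x \<theta>1 \<theta>2"
  let ?g = "\<lambda>xs. restrict (\<lambda>u. (1 / sqrt (real T)) * sum_list (map (?h u) xs)) {0..1}"
  have conv: "(\<Sum>t = int q + 1..int T. f t) = sum_list (map f [int q + 1..int T])" for f :: "int \<Rightarrow> real"
    by (simp add: interv_sum_list_conv_sum_set_int)
  have eq: "proc_path T \<omega> = ?g (?f \<omega>)" for \<omega>
    unfolding proc_path_def calV_bar_def calV_def V_proc_def conv by (simp add: comp_def)
  have lag: "(\<lambda>\<omega>. lag_vec Y q t \<omega>) \<in> M \<rightarrow>\<^sub>M count_space UNIV" for t
    unfolding lag_vec_def by (rule measurable_map_list) simp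
  have "(\<lambda>\<omega>. (lag_vec Y q t \<omega>, Y t \<omega>, Y (t - 1) \<omega>)) \<in> M \<rightarrow>\<^sub>M count_space UNIV" for t
  proof -
    have "(\<lambda>\<omega>. (lag_vec Y q t \<omega>, Y t \<omega>, Y (t - 1) \<omega>)) \<in> M \<rightarrow>\<^sub>M count_space UNIV \<Otimes>\<^sub>M (count_space UNIV \<Otimes>\<^sub>M count_space UNIV)"
      by (intro measurable_Pair lag Y_meas)
    then show ?thesis by (simp add: pair_measure_countable)
  qed
  then have f: "?f \<in> M \<rightarrow>\<^sub>M count_space UNIV" by (rule measurable_map_list)
  have "continuous_on {0..1} (\<lambda>u. sum_list (map (?h u) xs))" for xs
    by (induction xs) (auto intro!: continuous_intros r1_continuous r2_continuous simp: case_prod_beta)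
  then show ?thesis
    unfolding eq by (intro measurable_countable_range_borel_of[OF f] restrict_in_C01 continuous_intros)
qed

text \<open>Each new summand is orthogonal to the partial sum before it, so the variance of the sum
  is at most T times that of one summand; the normalisation cancels T.\<close>

lemma W_sq: "integrable M (\<lambda>\<omega>. (W T \<omega> k)\<^sup>2)"
  "(\<integral>\<omega>. (W T \<omega> k)\<^sup>2 \<partial>M) \<le> (\<integral>\<omega>. (inc k (sh 0 \<omega>))\<^sup>2 \<partial>M)"
proof -
  define X where "X j \<omega> = (if q \<le> j then inc k (sh (int j + 1) \<omega>) else 0)" for j \<omega>
  define S where "S n \<omega> = (\<Sum>j<n. X j \<omega>)" for n \<omega>
  define v where "v = (\<integral>\<omega>. (inc k (sh 0 \<omega>))\<^sup>2 \<partial>M)"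
  have v0: "0 \<le> v" by (simp add: v_def)
  have Xm [measurable]: "X j \<in> borel_measurable M" for j unfolding X_def by measurable
  have X2: "integrable M (\<lambda>\<omega>. (X j \<omega>)\<^sup>2)" for j unfolding X_def using inc_sq by (cases "q \<le> j") auto
  have S2: "integrable M (\<lambda>\<omega>. (S n \<omega>)\<^sup>2)" for n
    unfolding S_def using integrable_sum_sq[of "{..<n}" X M "\<lambda>_. 1"] X2 by simp
  have [measurable]: "S n \<in> borel_measurable M" for n unfolding S_def by measurable
  have Sp: "S n \<in> borel_measurable (past M Y (int n))" for n
    unfolding S_def
  proof (rule borel_measurable_sum)
    fix j assume "j \<in> {..<n}"
    then have "sets (past M Y (int j + 1)) \<subseteq> sets (past M Y (int n))" by (intro past_mono) auto
    then have "(\<lambda>\<omega>. inc k (sh (int j + 1) \<omega>)) \<in> borel_measurable (past M Y (int n))"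
      using measurable_mono[of borel borel "past M Y (int j + 1)" "past M Y (int n)"] inc_past by auto
    then show "X j \<in> borel_measurable (past M Y (int n))" unfolding X_def by (cases "q \<le> j") auto
  qed
  have ES: "(\<integral>\<omega>. (S n \<omega>)\<^sup>2 \<partial>M) \<le> real n * v" for n
  proof (induction n)
    case 0
    then show ?case by (simp add: S_def)
  next
    case (Suc n)
    have SX: "integrable M (\<lambda>\<omega>. S n \<omega> * X n \<omega>)" by (intro integrable_mult_L2 S2 X2; measurable)
    have "(\<integral>\<omega>. S n \<omega> * X n \<omega> \<partial>M) = 0"
    proof (cases "q \<le> n")
      case True
      then show ?thesis unfolding X_def using inc_orthogonal[of "int n + 1" "S n" k] Sp S2 by simp
    qed (simp add: X_def)
    moreover have "(\<integral>\<omega>. (X n \<omega>)\<^sup>2 \<partial>M) \<le> v"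
      unfolding X_def v_def using integral_sh[of "\<lambda>y. (inc k y)\<^sup>2" "int n + 1"] by (cases "q \<le> n") auto
    moreover have "(\<integral>\<omega>. (S (Suc n) \<omega>)\<^sup>2 \<partial>M) = (\<integral>\<omega>. (S n \<omega>)\<^sup>2 + (X n \<omega>)\<^sup>2 + 2 * (S n \<omega> * X n \<omega>) \<partial>M)"
      by (simp add: S_def power2_sum mult.assoc)
    moreover have "\<dots> = (\<integral>\<omega>. (S n \<omega>)\<^sup>2 \<partial>M) + (\<integral>\<omega>. (X n \<omega>)\<^sup>2 \<partial>M) + 2 * (\<integral>\<omega>. S n \<omega> * X n \<omega> \<partial>M)"
      using S2[of n] X2[of n] SX by simp
    ultimately show ?case using Suc by (simp add: algebra_simps)
  qed
  have WS: "W T \<omega> k = (1 / sqrt (real T)) * S T \<omega>" for \<omega>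
    unfolding W_def S_def X_def sum_int_interval_conv_nat ..
  show "integrable M (\<lambda>\<omega>. (W T \<omega> k)\<^sup>2)" unfolding WS power_mult_distrib using S2 by simp
  have "(\<integral>\<omega>. (W T \<omega> k)\<^sup>2 \<partial>M) = (\<integral>\<omega>. (S T \<omega>)\<^sup>2 \<partial>M) / real T"
    unfolding WS power_mult_distrib by (simp add: power_divide)
  \<comment> \<open>For T = 0 the quotient is 0 by the convention on division by zero.\<close>
  also have "\<dots> \<le> v" using ES[of T] v0 by (cases "T = 0") (simp_all add: divide_le_eq mult.commute)
  finally show "(\<integral>\<omega>. (W T \<omega> k)\<^sup>2 \<partial>M) \<le> (\<integral>\<omega>. (inc k (sh 0 \<omega>))\<^sup>2 \<partial>M)" unfolding v_def .
qed

text \<open>A finite combination of the coefficients is again a normalised sum of martingale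
  differences, all given by one function f of the shifted path, so the central limit theorem applies
  with the ergodic average of f^2.\<close>

lemma W_char:
  "(\<lambda>T. \<integral>\<omega>. iexp (\<Sum>k<n. c k * W T \<omega> k) \<partial>M)
     \<longlonglongrightarrow> exp (- complex_of_real (\<integral>\<omega>. (\<Sum>k<n. c k * inc k (sh 0 \<omega>))\<^sup>2 \<partial>M) / 2)"
proof -
  define f where "f y = (\<Sum>k<n. c k * inc k y)" for y
  have fm [measurable]: "f \<in> borel_measurable seq_space" unfolding f_def by measurable
  have f2: "integrable M (\<lambda>\<omega>. (f (sh t \<omega>))\<^sup>2)" for t
    unfolding f_def by (intro integrable_sum_sq inc_sh_meas inc_sq)
  have fshm [measurable]: "(\<lambda>\<omega>. f (sh t \<omega>)) \<in> borel_measurable M" for t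
    by (rule measurable_compose[OF sh_meas fm])
  define v where "v = (\<integral>\<omega>. (f (sh 0 \<omega>))\<^sup>2 \<partial>M)"
  have v0: "0 \<le> v" by (simp add: v_def)
  define X where "X j \<omega> = (if q \<le> j then f (sh (int j + 1) \<omega>) else 0)" for j \<omega>
  have "(\<lambda>T. \<integral>\<omega>. iexp ((\<Sum>j<T. X j \<omega>) / sqrt (real T)) \<partial>M) \<longlonglongrightarrow> exp (- complex_of_real v / 2)"
  proof (rule martingale_clt[where F = "\<lambda>j. past M Y (int j)" and s = v])
    show "subalgebra M (past M Y (int j))" for j by (rule past_subalgebra)
    show "sets (past M Y (int j)) \<subseteq> sets (past M Y (int (Suc j)))" for j by (rule past_mono) simp
    show "X j \<in> borel_measurable (past M Y (int (Suc j)))" for j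
    proof -
      have "(\<lambda>\<omega>. inc k (sh (int j + 1) \<omega>)) \<in> borel_measurable (past M Y (int (Suc j)))" for k
        using inc_past[of k "int j + 1"] by (simp add: add.commute)
      then show ?thesis unfolding X_def f_def by (cases "q \<le> j") auto
    qed
    show "integrable M (\<lambda>\<omega>. (X j \<omega>)\<^sup>2)" for j unfolding X_def using f2 by (cases "q \<le> j") auto
    show "(\<integral>\<omega>. (X j \<omega>)\<^sup>2 \<partial>M) \<le> v" for j
      unfolding X_def v_def using integral_sh[of "\<lambda>y. (f y)\<^sup>2" "int j + 1"] by (cases "q \<le> j") auto
    show "(\<integral>\<omega>. Z \<omega> * X j \<omega> \<partial>M) = 0"
      if Z: "Z \<in> borel_measurable (past M Y (int j))" and b: "\<And>\<omega>. \<bar>Z \<omega>\<bar> \<le> b" for j Z b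
    proof (cases "q \<le> j")
      case True
      have Zm [measurable]: "Z \<in> borel_measurable M" by (rule past_measurable[OF Z])
      have "(Z \<omega>)\<^sup>2 \<le> b\<^sup>2" for \<omega> using power_mono[OF b, of \<omega> 2] by simp
      then have Z2: "integrable M (\<lambda>\<omega>. (Z \<omega>)\<^sup>2)" by (intro integrable_const_bound[of _ "b\<^sup>2"]) auto
      have int: "integrable M (\<lambda>\<omega>. Z \<omega> * inc k (sh (int j + 1) \<omega>))" for k
        by (intro integrable_mult_L2 Z2 inc_sq; measurable)
      have "(\<integral>\<omega>. Z \<omega> * inc k (sh (int j + 1) \<omega>) \<partial>M) = 0" for k
        using inc_orthogonal[of "int j + 1" Z k] Z Z2 True by simp
      moreover have "(\<integral>\<omega>. Z \<omega> * X j \<omega> \<partial>M) = (\<integral>\<omega>. (\<Sum>k<n. c k * (Z \<omega> * inc k (sh (int j + 1) \<omega>))) \<partial>M)"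
        using True by (simp add: X_def f_def sum_distrib_left mult.left_commute)
      ultimately show ?thesis using int by simp
    qed (simp add: X_def)
    have "AE \<omega> in M. (\<lambda>m. (\<Sum>i<m. (f (sh (int i) \<omega>))\<^sup>2) / real m) \<longlonglongrightarrow> v"
      unfolding v_def by (rule ergodic_average[of "\<lambda>y. (f y)\<^sup>2"]) (use f2 in auto)
    then show "AE \<omega> in M. (\<lambda>m. (\<Sum>j<m. (X j \<omega>)\<^sup>2) / real m) \<longlonglongrightarrow> v"
    proof eventually_elim
      fix \<omega> assume lim: "(\<lambda>m. (\<Sum>i<m. (f (sh (int i) \<omega>))\<^sup>2) / real m) \<longlonglongrightarrow> v"
      let ?a = "\<lambda>m. \<Sum>i<m. (f (sh (int i) \<omega>))\<^sup>2"
      \<comment> \<open>The ergodic averages start at time 0, whereas \<open>X j\<close> sits at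
        time j + 1 and vanishes for j < q. The discrepancy is a shift of the index and a fixed
        number of initial terms, both negligible after division by m.\<close>
      have sumX: "(\<Sum>j<m. (X j \<omega>)\<^sup>2) = ?a (Suc m) - ?a (Suc q)" if "q \<le> m" for m
        using that
      proof (induction m rule: dec_induct)
        case base
        then show ?case by (simp add: X_def)
      next
        case (step m)
        then show ?case by (simp add: X_def add.commute)
      qed
      have "(\<lambda>m. ?a (Suc m) / real (Suc m) * (real (Suc m) / real m) - ?a (Suc q) / real m) \<longlonglongrightarrow> v * 1 - 0"
        by (intro tendsto_intros LIMSEQ_Suc[OF lim] LIMSEQ_Suc_n_over_n lim_const_over_n)
      moreover have "\<forall>\<^sub>F m in sequentially. ?a (Suc m) / real (Suc m) * (real (Suc m) / real m) - ?a (Suc q) / real m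
          = (\<Sum>j<m. (X j \<omega>)\<^sup>2) / real m"
      proof (rule eventually_sequentiallyI[of "Suc q"])
        fix m assume "Suc q \<le> m"
        then show "?a (Suc m) / real (Suc m) * (real (Suc m) / real m) - ?a (Suc q) / real m = (\<Sum>j<m. (X j \<omega>)\<^sup>2) / real m"
          using sumX[of m] by (simp add: diff_divide_distrib del: sum.lessThan_Suc of_nat_Suc)
      qed
      ultimately have "(\<lambda>m. (\<Sum>j<m. (X j \<omega>)\<^sup>2) / real m) \<longlonglongrightarrow> v * 1 - 0" by (rule Lim_transform_eventually)
      then show "(\<lambda>m. (\<Sum>j<m. (X j \<omega>)\<^sup>2) / real m) \<longlonglongrightarrow> v" by simp
    qed
  qed (rule v0)
  moreover have "(\<Sum>k<n. c k * W T \<omega> k) = (\<Sum>j<T. X j \<omega>) / sqrt (real T)" for T \<omega>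
  proof -
    have "(\<Sum>k<n. c k * W T \<omega> k) = (1 / sqrt (real T)) * (\<Sum>k<n. \<Sum>t = int q + 1..int T. c k * inc k (sh t \<omega>))"
      by (simp add: W_def sum_distrib_left mult.left_commute)
    also have "(\<Sum>k<n. \<Sum>t = int q + 1..int T. c k * inc k (sh t \<omega>)) = (\<Sum>t = int q + 1..int T. f (sh t \<omega>))"
      unfolding f_def by (rule sum.swap)
    also have "\<dots> = (\<Sum>j<T. X j \<omega>)" unfolding X_def sum_int_interval_conv_nat ..
    finally show ?thesis by simp
  qed
  ultimately show ?thesis by (simp add: v_def f_def)
qed

text \<open>The 2 bounds the absolute sum of all centred indicators: the indicators sum to at most
  1, and so do the Poisson probabilities.\<close>

definition envelope :: "'a \<Rightarrow> real" where
  "envelope \<omega> = \<bar>inc 0 (sh (int q + 1) \<omega>)\<bar> + \<bar>inc (Suc 0) (sh (int q + 1) \<omega>)\<bar> + 2"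

lemma envelope_meas [measurable]: "envelope \<in> borel_measurable M"
  unfolding envelope_def by measurable

lemma envelope_sq: "integrable M (\<lambda>\<omega>. (envelope \<omega>)\<^sup>2)"
proof (rule Bochner_Integration.integrable_bound)
  let ?i = "\<lambda>k \<omega>. inc k (sh (int q + 1) \<omega>)"
  show "integrable M (\<lambda>\<omega>. 3 * ((?i 0 \<omega>)\<^sup>2 + (?i (Suc 0) \<omega>)\<^sup>2 + 4))" using inc_sq by simp
  show "AE \<omega> in M. norm ((envelope \<omega>)\<^sup>2) \<le> norm (3 * ((?i 0 \<omega>)\<^sup>2 + (?i (Suc 0) \<omega>)\<^sup>2 + 4))"
  proof (rule AE_I2)
    fix \<omega>
    have "(a + b + 2)\<^sup>2 \<le> 3 * (a\<^sup>2 + b\<^sup>2 + 4)" for a b :: real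
      using zero_le_power2[of "a - b"] zero_le_power2[of "a - 2"] zero_le_power2[of "b - 2"]
      by (simp add: power2_eq_square algebra_simps)
    from this[of "\<bar>?i 0 \<omega>\<bar>" "\<bar>?i (Suc 0) \<omega>\<bar>"]
    show "norm ((envelope \<omega>)\<^sup>2) \<le> norm (3 * ((?i 0 \<omega>)\<^sup>2 + (?i (Suc 0) \<omega>)\<^sup>2 + 4))" by (simp add: envelope_def)
  qed
qed measurable

lemma inc_envelope: "(\<Sum>k<n. \<bar>inc k (sh (int q + 1) \<omega>)\<bar>) \<le> envelope \<omega>"
proof -
  let ?y = "Y (int q + 1) \<omega>" and ?z = "Y (int q + 1 - 1) \<omega>"
  have "(\<Sum>k<n. \<bar>inc (Suc (Suc k)) (sh (int q + 1) \<omega>)\<bar>) \<le> (\<Sum>k<n. indicator {k} ?y + kern ?z k)"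
    unfolding inc_sh by (intro sum_mono order_trans[OF abs_triangle_ineq4]) (simp split: split_indicator)
  also have "\<dots> = (\<Sum>k<n. indicator {k} ?y) + (\<Sum>k<n. kern ?z k)" by (rule sum.distrib)
  also have "(\<Sum>k<n. indicator {k} ?y) = (\<Sum>k<n. if k = ?y then 1 else 0 :: real)"
    by (intro sum.cong) (auto split: split_indicator)
  also have "\<dots> \<le> 1" by simp
  also have "(\<Sum>k<n. kern ?z k) \<le> 1"
    using measure_measure_pmf_finite[of "{..<n}" "poisson_pmf (rate ?z)"]
      measure_pmf.prob_le_1[of "poisson_pmf (rate ?z)" "{..<n}"] by simp
  finally show ?thesis
    using sum_le_first_two[of "\<lambda>k. \<bar>inc k (sh (int q + 1) \<omega>)\<bar>" n] by (simp add: envelope_def)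
qed

text \<open>The summand at time q + 1 is the one in the covariance of the theorem; stationarity
  moves the variance found at time 0 to it.\<close>

lemma gaussian_series:
  obtains \<rho> C where "gaussian_series_limit M W (\<lambda>k \<omega>. inc k (sh (int q + 1) \<omega>)) phi envelope
    (1 + (\<integral>\<omega>. real (Y 1 \<omega>) \<partial>M)) C \<rho>"
proof -
  obtain \<rho> C where \<rho>: "0 < \<rho>" "\<rho> < 1" "\<And>k t. (\<integral>\<omega>. (inc k (sh t \<omega>))\<^sup>2 \<partial>M) \<le> C * \<rho> ^ (4 * k)"
    by (rule inc_var) (rule that, assumption+)
  have "gaussian_series_limit M W (\<lambda>k \<omega>. inc k (sh (int q + 1) \<omega>)) phi envelope
    (1 + (\<integral>\<omega>. real (Y 1 \<omega>) \<partial>M)) C \<rho>"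
  proof
    show "(\<lambda>T. \<integral>\<omega>. iexp (\<Sum>k<n. c k * W T \<omega> k) \<partial>M)
       \<longlonglongrightarrow> exp (- complex_of_real (\<integral>\<omega>. (\<Sum>k<n. c k * inc k (sh (int q + 1) \<omega>))\<^sup>2 \<partial>M) / 2)" for n c
      using W_char[where n = n and c = c] integral_sh[of "\<lambda>y. (\<Sum>k<n. c k * inc k y)\<^sup>2" "int q + 1"] by simp
    show "(\<integral>\<omega>. (W T \<omega> k)\<^sup>2 \<partial>M) \<le> C * \<rho> ^ (4 * k)" for T k
      using W_sq(2) \<rho>(3) by (rule order_trans)
  qed (use \<rho> W_sq(1) envelope_sq inc_envelope phi_cont phi_bound in auto)
  then show thesis by (rule that)
qed

end

section \<open>Two elementary estimates for the expansion of the statistic\<close>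

lemma exp_linear_bound: "\<bar>exp y - 1 - y\<bar> \<le> y\<^sup>2 * exp \<bar>y\<bar>" for y :: real
proof -
  have a: "exp z - 1 \<le> z * exp z" for z :: real
  proof -
    have "(1 - z) * exp z \<le> exp (- z) * exp z"
      using exp_ge_add_one_self[of "- z"] by (intro mult_right_mono) auto
    then show ?thesis by (simp add: algebra_simps flip: exp_add)
  qed
  have b: "\<bar>exp y - 1\<bar> \<le> \<bar>y\<bar> * exp \<bar>y\<bar>"
  proof (cases "0 \<le> y")
    case True
    then show ?thesis using a[of y] by simp
  next
    case False
    have "1 - exp y \<le> - y * 1" using exp_ge_add_one_self[of y] by linarith
    also have "\<dots> \<le> - y * exp (- y)" using False by (intro mult_left_mono) auto
    finally show ?thesis using False by simp
  qed
  have "0 \<le> exp y - 1 - y" using exp_ge_add_one_self[of y] by linarith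
  moreover have "exp y - 1 - y \<le> y * (exp y - 1)" using a[of y] by (simp add: algebra_simps)
  ultimately have "\<bar>exp y - 1 - y\<bar> \<le> y * (exp y - 1)" by simp
  also have "\<dots> \<le> \<bar>y\<bar> * \<bar>exp y - 1\<bar>" by (metis abs_ge_self abs_mult)
  also have "\<dots> \<le> \<bar>y\<bar> * (\<bar>y\<bar> * exp \<bar>y\<bar>)" using b by (intro mult_left_mono) auto
  finally show ?thesis by (simp add: power2_eq_square)
qed

lemma truncated_sum_diff:
  fixes g :: "nat \<Rightarrow> real"
  assumes g: "\<And>j. 0 \<le> g j" "\<And>j. g j \<le> 1"
  shows "\<bar>(\<Sum>j<n. g j) - (\<Sum>j<n. if q \<le> j then g j else 0)\<bar> \<le> real q"
proof -
  have "(\<Sum>j<n. g j) - (\<Sum>j<n. if q \<le> j then g j else 0) = (\<Sum>j<n. if j < q then g j else 0)"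
    by (auto simp: not_le intro!: sum.cong simp flip: sum_subtractf)
  moreover have "0 \<le> (\<Sum>j<n. if j < q then g j else 0)" using g by (intro sum_nonneg) auto
  moreover have "(\<Sum>j<n. if j < q then g j else 0) \<le> (\<Sum>j\<in>{..<n} \<inter> {..<q}. 1)"
    using g by (subst sum.inter_restrict) (auto intro!: sum_mono)
  moreover have "(\<Sum>j\<in>{..<n} \<inter> {..<q}. 1 :: real) \<le> real q"
    using card_mono[of "{..<q}" "{..<n} \<inter> {..<q}"] by simp
  ultimately show ?thesis by linarith
qed

section \<open>Boundedness and convergence in probability\<close>

definition is_O_P_1 :: "'a measure \<Rightarrow> (nat \<Rightarrow> 'a \<Rightarrow> real) \<Rightarrow> bool" where
  "is_O_P_1 M X \<longleftrightarrow> (\<forall>d>0. \<exists>K>0. \<forall>\<^sub>F T in sequentially. measure M {\<omega> \<in> space M. \<bar>X T \<omega>\<bar> > K} \<le> d)"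

lemma is_o_P_1_iff:
  "is_o_P_1 M X \<longleftrightarrow> (\<forall>e>0. \<forall>d>0. \<forall>\<^sub>F T in sequentially. measure M {\<omega> \<in> space M. \<bar>X T \<omega>\<bar> > e} \<le> d)"
proof -
  have "(\<lambda>T. measure M {\<omega> \<in> space M. \<bar>X T \<omega>\<bar> > e}) \<longlonglongrightarrow> 0 \<longleftrightarrow>
     (\<forall>d>0. \<forall>\<^sub>F T in sequentially. measure M {\<omega> \<in> space M. \<bar>X T \<omega>\<bar> > e} \<le> d)" for e
  proof (intro iffI allI impI)
    fix d :: real assume "(\<lambda>T. measure M {\<omega> \<in> space M. \<bar>X T \<omega>\<bar> > e}) \<longlonglongrightarrow> 0" "d > 0"
    from order_tendstoD(2)[OF this] show "\<forall>\<^sub>F T in sequentially. measure M {\<omega> \<in> space M. \<bar>X T \<omega>\<bar> > e} \<le> d"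
      by (rule eventually_mono) simp
  next
    assume *: "\<forall>d>0. \<forall>\<^sub>F T in sequentially. measure M {\<omega> \<in> space M. \<bar>X T \<omega>\<bar> > e} \<le> d"
    show "(\<lambda>T. measure M {\<omega> \<in> space M. \<bar>X T \<omega>\<bar> > e}) \<longlonglongrightarrow> 0"
    proof (rule tendstoI)
      fix d :: real assume "d > 0"
      then have "\<forall>\<^sub>F T in sequentially. measure M {\<omega> \<in> space M. \<bar>X T \<omega>\<bar> > e} \<le> d / 2" using * half_gt_zero by blast
      then show "\<forall>\<^sub>F T in sequentially. dist (measure M {\<omega> \<in> space M. \<bar>X T \<omega>\<bar> > e}) 0 < d"
        by (rule eventually_mono) (use \<open>d > 0\<close> in simp)
    qed
  qed
  then show ?thesis unfolding is_o_P_1_def by blast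
qed

context prob_space
begin

lemma prob_subset_Un:
  assumes [measurable]: "f \<in> borel_measurable M" "g \<in> borel_measurable M"
    and sub: "\<And>\<omega>. \<omega> \<in> space M \<Longrightarrow> P \<omega> \<Longrightarrow> \<bar>f \<omega>\<bar> > a \<or> \<bar>g \<omega>\<bar> > (b::real)"
    and "prob {\<omega> \<in> space M. \<bar>f \<omega>\<bar> > (a::real)} \<le> d / 2" "prob {\<omega> \<in> space M. \<bar>g \<omega>\<bar> > b} \<le> d / 2"
  shows "prob {\<omega> \<in> space M. P \<omega>} \<le> d"
proof -
  have "prob {\<omega> \<in> space M. P \<omega>} \<le> prob ({\<omega> \<in> space M. \<bar>f \<omega>\<bar> > a} \<union> {\<omega> \<in> space M. \<bar>g \<omega>\<bar> > b})"
    using sub by (intro finite_measure_mono) auto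
  also have "\<dots> \<le> prob {\<omega> \<in> space M. \<bar>f \<omega>\<bar> > a} + prob {\<omega> \<in> space M. \<bar>g \<omega>\<bar> > b}"
    by (intro measure_Un_le) auto
  finally show ?thesis using assms(4,5) by simp
qed

lemma is_o_P_1_add:
  assumes [measurable]: "\<And>T. X T \<in> borel_measurable M" "\<And>T. Z T \<in> borel_measurable M"
    and "is_o_P_1 M X" "is_o_P_1 M Z"
  shows "is_o_P_1 M (\<lambda>T \<omega>. X T \<omega> + Z T \<omega>)"
  unfolding is_o_P_1_iff
proof (intro allI impI)
  fix e d :: real assume e: "e > 0" and d: "d > 0"
  have "\<forall>\<^sub>F T in sequentially. prob {\<omega> \<in> space M. \<bar>X T \<omega>\<bar> > e / 2} \<le> d / 2 \<and> prob {\<omega> \<in> space M. \<bar>Z T \<omega>\<bar> > e / 2} \<le> d / 2"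
    using e d assms(3,4)[unfolded is_o_P_1_iff, rule_format, OF half_gt_zero half_gt_zero]
    by (intro eventually_conj)
  then show "\<forall>\<^sub>F T in sequentially. prob {\<omega> \<in> space M. \<bar>X T \<omega> + Z T \<omega>\<bar> > e} \<le> d"
    by eventually_elim (rule prob_subset_Un[of "X _" "Z _" _ "e / 2" "e / 2"], auto)
qed

lemma is_O_P_1_add:
  assumes [measurable]: "\<And>T. X T \<in> borel_measurable M" "\<And>T. Z T \<in> borel_measurable M"
    and "is_O_P_1 M X" "is_O_P_1 M Z"
  shows "is_O_P_1 M (\<lambda>T \<omega>. X T \<omega> + Z T \<omega>)"
  unfolding is_O_P_1_def
proof (intro allI impI)
  fix d :: real assume d: "d > 0"
  obtain K K' where K: "K > 0" "K' > 0" "\<forall>\<^sub>F T in sequentially. prob {\<omega> \<in> space M. \<bar>X T \<omega>\<bar> > K} \<le> d / 2"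
    "\<forall>\<^sub>F T in sequentially. prob {\<omega> \<in> space M. \<bar>Z T \<omega>\<bar> > K'} \<le> d / 2"
    using assms(3,4) d unfolding is_O_P_1_def by (meson half_gt_zero)
  have "\<forall>\<^sub>F T in sequentially. prob {\<omega> \<in> space M. \<bar>X T \<omega> + Z T \<omega>\<bar> > K + K'} \<le> d"
    using K(3,4) by eventually_elim (rule prob_subset_Un[of "X _" "Z _" _ K K'], auto)
  then show "\<exists>K>0. \<forall>\<^sub>F T in sequentially. prob {\<omega> \<in> space M. \<bar>X T \<omega> + Z T \<omega>\<bar> > K} \<le> d"
    using K by (intro exI[of _ "K + K'"]) auto
qed

lemma is_O_P_1_mult:
  assumes [measurable]: "\<And>T. X T \<in> borel_measurable M" "\<And>T. Z T \<in> borel_measurable M"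
    and "is_O_P_1 M X" "is_O_P_1 M Z"
  shows "is_O_P_1 M (\<lambda>T \<omega>. X T \<omega> * Z T \<omega>)"
  unfolding is_O_P_1_def
proof (intro allI impI)
  fix d :: real assume d: "d > 0"
  obtain K K' where K: "K > 0" "K' > 0" "\<forall>\<^sub>F T in sequentially. prob {\<omega> \<in> space M. \<bar>X T \<omega>\<bar> > K} \<le> d / 2"
    "\<forall>\<^sub>F T in sequentially. prob {\<omega> \<in> space M. \<bar>Z T \<omega>\<bar> > K'} \<le> d / 2"
    using assms(3,4) d unfolding is_O_P_1_def by (meson half_gt_zero)
  have sub: "\<bar>x\<bar> > K \<or> \<bar>z\<bar> > K'" if "\<bar>x * z\<bar> > K * K'" for x z :: real
    using that mult_mono[of "\<bar>x\<bar>" K "\<bar>z\<bar>" K'] K by (auto simp: abs_mult not_less[symmetric])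
  have "\<forall>\<^sub>F T in sequentially. prob {\<omega> \<in> space M. \<bar>X T \<omega> * Z T \<omega>\<bar> > K * K'} \<le> d"
    using K(3,4) by eventually_elim (rule prob_subset_Un[of "X _" "Z _" _ K K'], use sub in auto)
  then show "\<exists>K>0. \<forall>\<^sub>F T in sequentially. prob {\<omega> \<in> space M. \<bar>X T \<omega> * Z T \<omega>\<bar> > K} \<le> d"
    using K by (intro exI[of _ "K * K'"]) auto
qed

lemma is_o_P_1_mult:
  assumes [measurable]: "\<And>T. X T \<in> borel_measurable M" "\<And>T. Z T \<in> borel_measurable M"
    and "is_o_P_1 M X" "is_O_P_1 M Z"
  shows "is_o_P_1 M (\<lambda>T \<omega>. X T \<omega> * Z T \<omega>)"
  unfolding is_o_P_1_iff
proof (intro allI impI)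
  fix e d :: real assume e: "e > 0" and d: "d > 0"
  obtain K where K: "K > 0" "\<forall>\<^sub>F T in sequentially. prob {\<omega> \<in> space M. \<bar>Z T \<omega>\<bar> > K} \<le> d / 2"
    using assms(4) d unfolding is_O_P_1_def by (meson half_gt_zero)
  have X: "\<forall>\<^sub>F T in sequentially. prob {\<omega> \<in> space M. \<bar>X T \<omega>\<bar> > e / K} \<le> d / 2"
    using assms(3)[unfolded is_o_P_1_iff, rule_format, OF divide_pos_pos half_gt_zero] e d K(1) by blast
  have sub: "\<bar>x\<bar> > e / K \<or> \<bar>z\<bar> > K" if "\<bar>x * z\<bar> > e" for x z :: real
  proof (rule ccontr)
    assume "\<not> ?thesis"
    then have "\<bar>x\<bar> * \<bar>z\<bar> \<le> e / K * K" using K(1) e by (intro mult_mono) auto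
    with that K(1) show False by (simp add: abs_mult)
  qed
  show "\<forall>\<^sub>F T in sequentially. prob {\<omega> \<in> space M. \<bar>X T \<omega> * Z T \<omega>\<bar> > e} \<le> d"
    using X K(2) by eventually_elim (rule prob_subset_Un[of "X _" "Z _" _ "e / K" K], use sub in auto)
qed

lemma is_o_P_1_imp_O: "is_o_P_1 M X \<Longrightarrow> is_O_P_1 M X"
  unfolding is_o_P_1_iff is_O_P_1_def by (meson zero_less_one)

lemma is_O_P_1_abs: "is_O_P_1 M X \<Longrightarrow> is_O_P_1 M (\<lambda>T \<omega>. \<bar>X T \<omega>\<bar>)"
  and is_o_P_1_abs: "is_o_P_1 M X \<Longrightarrow> is_o_P_1 M (\<lambda>T \<omega>. \<bar>X T \<omega>\<bar>)"
  by (simp_all add: is_O_P_1_def is_o_P_1_def)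

lemma is_O_P_1_exp:
  assumes [measurable]: "\<And>T. X T \<in> borel_measurable M" and X: "is_O_P_1 M X"
  shows "is_O_P_1 M (\<lambda>T \<omega>. exp (X T \<omega>))"
  unfolding is_O_P_1_def
proof (intro allI impI)
  fix d :: real assume "d > 0"
  then obtain K where K: "\<forall>\<^sub>F T in sequentially. prob {\<omega> \<in> space M. \<bar>X T \<omega>\<bar> > K} \<le> d"
    using X unfolding is_O_P_1_def by blast
  have "prob {\<omega> \<in> space M. \<bar>exp (X T \<omega>)\<bar> > exp K} \<le> prob {\<omega> \<in> space M. \<bar>X T \<omega>\<bar> > K}" for T
    by (intro finite_measure_mono) auto
  with K have "\<forall>\<^sub>F T in sequentially. prob {\<omega> \<in> space M. \<bar>exp (X T \<omega>)\<bar> > exp K} \<le> d"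
    by (auto elim!: eventually_mono intro: order_trans)
  then show "\<exists>K>0. \<forall>\<^sub>F T in sequentially. prob {\<omega> \<in> space M. \<bar>exp (X T \<omega>)\<bar> > K} \<le> d"
    by (intro exI[of _ "exp K"]) simp
qed

lemma is_O_P_1_const: "is_O_P_1 M (\<lambda>T \<omega>. c)"
  unfolding is_O_P_1_def
proof (intro allI impI)
  fix d :: real assume "d > 0"
  then show "\<exists>K>0. \<forall>\<^sub>F T in sequentially. prob {\<omega> \<in> space M. \<bar>c\<bar> > K} \<le> d"
    by (intro exI[of _ "\<bar>c\<bar> + 1"]) auto
qed

lemma is_o_P_1_deterministic:
  assumes "c \<longlonglongrightarrow> 0" shows "is_o_P_1 M (\<lambda>T \<omega>. c T)"
  unfolding is_o_P_1_iff
proof (intro allI impI)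
  fix e d :: real assume "e > 0" "d > 0"
  have "\<forall>\<^sub>F T in sequentially. \<bar>c T\<bar> < e" using tendstoD[OF assms \<open>e > 0\<close>] by simp
  then show "\<forall>\<^sub>F T in sequentially. prob {\<omega> \<in> space M. \<bar>c T\<bar> > e} \<le> d"
    by (rule eventually_mono) (use \<open>d > 0\<close> in auto)
qed

lemma prob_abs_gt_le:
  fixes X :: "'a \<Rightarrow> real"
  assumes X: "integrable M X" and "K > 0"
  shows "prob {\<omega> \<in> space M. \<bar>X \<omega>\<bar> > K} \<le> (\<integral>\<omega>. \<bar>X \<omega>\<bar> \<partial>M) / K"
proof -
  have [measurable]: "X \<in> borel_measurable M" using X by auto
  have "prob {\<omega> \<in> space M. \<bar>X \<omega>\<bar> > K} \<le> prob {\<omega> \<in> space M. \<bar>X \<omega>\<bar> \<ge> K}"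
    by (intro finite_measure_mono) auto
  also have "\<dots> \<le> (\<integral>\<omega>. \<bar>X \<omega>\<bar> \<partial>M) / K"
    using assms by (intro integral_Markov_inequality_measure[of M _ "{}"]) auto
  finally show ?thesis .
qed

lemma is_O_P_1_integrable:
  assumes X: "\<And>T. integrable M (X T)" and b: "\<And>T. (\<integral>\<omega>. \<bar>X T \<omega>\<bar> \<partial>M) \<le> B"
  shows "is_O_P_1 M X"
  unfolding is_O_P_1_def
proof (intro allI impI)
  fix d :: real assume d: "d > 0"
  have B: "0 \<le> B" using b[of 0] by (rule order_trans[rotated]) simp
  define K where "K = (B + 1) / d"
  have K: "K > 0" using B d by (simp add: K_def)
  have "prob {\<omega> \<in> space M. \<bar>X T \<omega>\<bar> > K} \<le> d" for T
  proof -
    have "prob {\<omega> \<in> space M. \<bar>X T \<omega>\<bar> > K} \<le> (\<integral>\<omega>. \<bar>X T \<omega>\<bar> \<partial>M) / K" by (rule prob_abs_gt_le[OF X K])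
    also have "\<dots> \<le> B / K" using b K by (intro divide_right_mono) auto
    also have "\<dots> \<le> d" using B d by (simp add: K_def field_simps)
    finally show ?thesis .
  qed
  with K show "\<exists>K>0. \<forall>\<^sub>F T in sequentially. prob {\<omega> \<in> space M. \<bar>X T \<omega>\<bar> > K} \<le> d" by auto
qed

lemma is_o_P_1_integrable:
  assumes X: "\<And>T. integrable M (X T)" and b: "(\<lambda>T. \<integral>\<omega>. \<bar>X T \<omega>\<bar> \<partial>M) \<longlonglongrightarrow> 0"
  shows "is_o_P_1 M X"
  unfolding is_o_P_1_def
proof (intro allI impI)
  fix e :: real assume e: "e > 0"
  show "(\<lambda>T. prob {\<omega> \<in> space M. \<bar>X T \<omega>\<bar> > e}) \<longlonglongrightarrow> 0"
  proof (rule Lim_null_comparison)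
    show "\<forall>\<^sub>F T in sequentially. norm (prob {\<omega> \<in> space M. \<bar>X T \<omega>\<bar> > e}) \<le> (\<integral>\<omega>. \<bar>X T \<omega>\<bar> \<partial>M) / e"
      using prob_abs_gt_le[OF X e] by simp
    show "(\<lambda>T. (\<integral>\<omega>. \<bar>X T \<omega>\<bar> \<partial>M) / e) \<longlonglongrightarrow> 0" using tendsto_divide_zero[OF b] .
  qed
qed

lemma is_O_P_1_square_integrable:
  assumes [measurable]: "\<And>T. X T \<in> borel_measurable M" and X: "\<And>T. integrable M (\<lambda>\<omega>. (X T \<omega>)\<^sup>2)"
    and b: "\<And>T. (\<integral>\<omega>. (X T \<omega>)\<^sup>2 \<partial>M) \<le> B"
  shows "is_O_P_1 M X"
proof (rule is_O_P_1_integrable[where B = "1 + B"])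
  show Xi: "integrable M (X T)" for T by (rule square_integrable_imp_integrable[OF _ X]) measurable
  show "(\<integral>\<omega>. \<bar>X T \<omega>\<bar> \<partial>M) \<le> 1 + B" for T
  proof -
    have "(\<integral>\<omega>. \<bar>X T \<omega>\<bar> \<partial>M) \<le> (\<integral>\<omega>. 1 + (X T \<omega>)\<^sup>2 \<partial>M)"
    proof (rule integral_mono)
      show "\<bar>X T \<omega>\<bar> \<le> 1 + (X T \<omega>)\<^sup>2" for \<omega>
        using zero_le_power2[of "\<bar>X T \<omega>\<bar> - 1"] zero_le_power2[of "X T \<omega>"]
        unfolding power2_diff power2_abs one_power2 mult_1_right by linarith
    qed (use Xi X in auto)
    then show ?thesis using X b[of T] by (simp add: prob_space)
  qed
qed

end

section \<open>Empirical probabilities in a weighted norm\<close>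

context inarch begin

definition pmf_error :: "nat \<Rightarrow> 'a \<Rightarrow> nat \<Rightarrow> real" where
  "pmf_error T \<omega> k = (\<Sum>j<T. indicator {k} (Y (int j + 1) \<omega>)) / real T - prob {\<omega> \<in> space M. Y 1 \<omega> = k}"

text \<open>The weight k + 1 matches the growth of the derivative in \<open>\<theta>2\<close>, which
  carries a factor y. This single variable bounds the error of the averages of all functions of that
  growth, hence of the derivatives at all u at once.\<close>

definition total_error :: "nat \<Rightarrow> 'a \<Rightarrow> real" where
  "total_error T \<omega> = (\<Sum>k. real (Suc k) * \<bar>pmf_error T \<omega> k\<bar>)"

lemma summable_prob_Y: "summable (\<lambda>k. real (Suc k) * prob {\<omega> \<in> space M. Y 1 \<omega> = k})"
proof -
  obtain \<rho> A where \<rho>: "0 < \<rho>" "\<rho> < 1" and A: "0 \<le> A" "\<And>t k. prob {\<omega> \<in> space M. Y t \<omega> = k} \<le> A * \<rho> ^ (4 * k)"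
    by (rule prob_Y_decay) (rule that, assumption+)
  have "norm (\<rho> ^ 4) < 1" using \<rho> by (simp add: power_less_one_iff)
  from summable_mult[OF sums_summable[OF geometric_deriv_sums[OF this]], of A]
  show ?thesis
  proof (rule summable_comparison_test')
    fix k
    have "real (Suc k) * prob {\<omega> \<in> space M. Y 1 \<omega> = k} \<le> real (Suc k) * (A * (\<rho> ^ 4) ^ k)"
      using A(2)[of 1 k] by (intro mult_left_mono) (simp_all add: power_mult)
    then show "norm (real (Suc k) * prob {\<omega> \<in> space M. Y 1 \<omega> = k}) \<le> A * (of_nat (Suc k) * (\<rho> ^ 4) ^ k)"
      by (simp add: mult_ac)
  qed
qed

lemma pmf_error_meas [measurable]: "(\<lambda>\<omega>. pmf_error T \<omega> k) \<in> borel_measurable M"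
  unfolding pmf_error_def by measurable

lemma finite_support_average:
  fixes h :: "nat \<Rightarrow> real"
  shows "(\<lambda>k. h k * ((\<Sum>j<T. indicator {k} (Y (int j + 1) \<omega>)) / real T)) sums ((\<Sum>j<T. h (Y (int j + 1) \<omega>)) / real T)"
proof -
  have "(\<lambda>k. h k * indicator {k} y) sums h y" for y
  proof -
    have "(\<lambda>k. if k = y then h k else 0) sums h y" by (rule sums_single)
    moreover have "(\<lambda>k. if k = y then h k else 0) = (\<lambda>k. h k * indicator {k} y)"
      by (auto simp: fun_eq_iff split: split_indicator)
    ultimately show ?thesis by simp
  qed
  then have "(\<lambda>k. (\<Sum>j<T. h k * indicator {k} (Y (int j + 1) \<omega>)) / real T) sums ((\<Sum>j<T. h (Y (int j + 1) \<omega>)) / real T)"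
    by (intro sums_divide sums_sum)
  then show ?thesis by (simp add: sum_distrib_left)
qed

lemma expectation_Y_sums:
  fixes h :: "nat \<Rightarrow> real"
  assumes h: "\<And>k. \<bar>h k\<bar> \<le> real (Suc k)"
  shows "(\<lambda>k. h k * prob {\<omega> \<in> space M. Y 1 \<omega> = k}) sums (\<integral>\<omega>. h (Y 1 \<omega>) \<partial>M)"
proof -
  have hk: "(\<lambda>k. h k * indicator {k} y) sums h y" for y
  proof -
    have "(\<lambda>k. if k = y then h k else 0) sums h y" by (rule sums_single)
    moreover have "(\<lambda>k. if k = y then h k else 0) = (\<lambda>k. h k * indicator {k} y)"
      by (auto simp: fun_eq_iff split: split_indicator)
    ultimately show ?thesis by simp
  qed
  have i: "integrable M (\<lambda>\<omega>. h k * indicator {k} (Y 1 \<omega>))" for k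
    by (intro integrable_mult_right integrable_indicator_Y)
  have s: "summable (\<lambda>k. \<bar>h k * indicator {k} y\<bar>)" for y
    by (rule summable_finite[of "{y}"]) (auto split: split_indicator)
  have n: "(\<integral>\<omega>. \<bar>h k * indicator {k} (Y 1 \<omega>)\<bar> \<partial>M) = \<bar>h k\<bar> * prob {\<omega> \<in> space M. Y 1 \<omega> = k}" for k
    unfolding prob_Y by (simp add: abs_mult)
  have s2: "summable (\<lambda>k. \<integral>\<omega>. \<bar>h k * indicator {k} (Y 1 \<omega>)\<bar> \<partial>M)"
    unfolding n by (rule summable_comparison_test'[OF summable_prob_Y]) (auto simp del: of_nat_Suc intro!: mult_right_mono h)
  have "(\<lambda>k. \<integral>\<omega>. h k * indicator {k} (Y 1 \<omega>) \<partial>M) sums (\<integral>\<omega>. (\<Sum>k. h k * indicator {k} (Y 1 \<omega>)) \<partial>M)"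
    using i s s2 by (intro sums_integral) auto
  moreover have "(\<Sum>k. h k * indicator {k} (Y 1 \<omega>)) = h (Y 1 \<omega>)" for \<omega> using hk sums_unique by metis
  ultimately show ?thesis unfolding prob_Y by simp
qed

lemma total_error_summable: "summable (\<lambda>k. real (Suc k) * \<bar>pmf_error T \<omega> k\<bar>)"
proof -
  have "summable (\<lambda>k. real (Suc k) * ((\<Sum>j<T. indicator {k} (Y (int j + 1) \<omega>)) / real T)
      + real (Suc k) * prob {\<omega> \<in> space M. Y 1 \<omega> = k})"
    by (intro summable_add summable_prob_Y sums_summable[OF finite_support_average])
  then show ?thesis
  proof (rule summable_comparison_test')
    fix k
    have "\<bar>pmf_error T \<omega> k\<bar> \<le> (\<Sum>j<T. indicator {k} (Y (int j + 1) \<omega>)) / real T + prob {\<omega> \<in> space M. Y 1 \<omega> = k}"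
      unfolding pmf_error_def by (rule order_trans[OF abs_triangle_ineq4]) (simp add: sum_nonneg)
    then have "real (Suc k) * \<bar>pmf_error T \<omega> k\<bar> \<le> real (Suc k) * ((\<Sum>j<T. indicator {k} (Y (int j + 1) \<omega>)) / real T + prob {\<omega> \<in> space M. Y 1 \<omega> = k})"
      by (intro mult_left_mono) auto
    then show "norm (real (Suc k) * \<bar>pmf_error T \<omega> k\<bar>) \<le> real (Suc k) * ((\<Sum>j<T. indicator {k} (Y (int j + 1) \<omega>)) / real T)
      + real (Suc k) * prob {\<omega> \<in> space M. Y 1 \<omega> = k}"
      by (simp add: abs_mult distrib_left del: of_nat_Suc)
  qed
qed

lemma average_error:
  fixes h :: "nat \<Rightarrow> real"
  assumes h: "\<And>k. \<bar>h k\<bar> \<le> real (Suc k)"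
  shows "\<bar>(\<Sum>j<T. h (Y (int j + 1) \<omega>)) / real T - (\<integral>\<omega>. h (Y 1 \<omega>) \<partial>M)\<bar> \<le> total_error T \<omega>"
proof -
  have "(\<lambda>k. h k * pmf_error T \<omega> k) sums ((\<Sum>j<T. h (Y (int j + 1) \<omega>)) / real T - (\<integral>\<omega>. h (Y 1 \<omega>) \<partial>M))"
    unfolding pmf_error_def right_diff_distrib by (intro sums_diff finite_support_average expectation_Y_sums h)
  then have eq: "(\<Sum>j<T. h (Y (int j + 1) \<omega>)) / real T - (\<integral>\<omega>. h (Y 1 \<omega>) \<partial>M) = (\<Sum>k. h k * pmf_error T \<omega> k)"
    by (rule sums_unique)
  have le: "\<bar>h k * pmf_error T \<omega> k\<bar> \<le> real (Suc k) * \<bar>pmf_error T \<omega> k\<bar>" for k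
    unfolding abs_mult by (intro mult_right_mono h) simp
  have sa: "summable (\<lambda>k. \<bar>h k * pmf_error T \<omega> k\<bar>)"
    by (rule summable_comparison_test'[OF total_error_summable]) (use le in simp)
  show ?thesis unfolding eq total_error_def
    by (intro order_trans[OF summable_rabs[OF sa]] suminf_le le sa total_error_summable)
qed

lemma total_error_meas [measurable]: "total_error T \<in> borel_measurable M"
  unfolding total_error_def by measurable

lemma total_error_nonneg: "0 \<le> total_error T \<omega>"
  unfolding total_error_def by (intro suminf_nonneg total_error_summable) simp

text \<open>Each \<open>pmf_error\<close> is at most 1 and tends to 0 almost surely by the ergodic
  theorem, hence in mean. Its mean is at most twice the probability of k, which is summable against
  the weight, so Tannery's theorem carries the limit through the sum.\<close>

lemma total_error_o_P: "is_o_P_1 M total_error"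
proof (rule is_o_P_1_integrable)
  let ?p = "\<lambda>k. prob {\<omega> \<in> space M. Y 1 \<omega> = k}"
  let ?m = "\<lambda>T k. \<integral>\<omega>. \<bar>pmf_error T \<omega> k\<bar> \<partial>M"
  have av: "0 \<le> (\<Sum>j<T. indicator {k} (Y (int j + 1) \<omega>) :: real) / real T \<and>
    (\<Sum>j<T. indicator {k} (Y (int j + 1) \<omega>) :: real) / real T \<le> 1" for T k \<omega>
  proof
    show "0 \<le> (\<Sum>j<T. indicator {k} (Y (int j + 1) \<omega>) :: real)  / real T" by (simp add: sum_nonneg)
    have "(\<Sum>j<T. indicator {k} (Y (int j + 1) \<omega>) :: real) \<le> (\<Sum>j<T. 1)" by (intro sum_mono) (simp split: split_indicator)
    then show "(\<Sum>j<T. indicator {k} (Y (int j + 1) \<omega>) :: real) / real T \<le> 1" by (simp add: divide_le_eq)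
  qed
  have bd: "\<bar>pmf_error T \<omega> k\<bar> \<le> 1" for T \<omega> k
    unfolding pmf_error_def using av[of k \<omega> T] prob_le_1[of "{\<omega> \<in> space M. Y 1 \<omega> = k}"]
      measure_nonneg[of M "{\<omega> \<in> space M. Y 1 \<omega> = k}"] by linarith
  have ei: "integrable M (\<lambda>\<omega>. pmf_error T \<omega> k)" for T k
    using bd by (intro integrable_const_bound[of _ 1]) auto
  have m2: "?m T k \<le> 2 * ?p k" for T k
  proof -
    have "?m T k \<le> (\<integral>\<omega>. (\<Sum>j<T. indicator {k} (Y (int j + 1) \<omega>)) / real T + ?p k \<partial>M)"
    proof (rule integral_mono)
      show "\<bar>pmf_error T \<omega> k\<bar> \<le> (\<Sum>j<T. indicator {k} (Y (int j + 1) \<omega>)) / real T + ?p k" for \<omega>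
        unfolding pmf_error_def by (rule order_trans[OF abs_triangle_ineq4]) (simp add: sum_nonneg)
    qed (use ei integrable_indicator_Y in auto)
    also have "\<dots> = (\<Sum>j<T. ?p k) / real T + ?p k"
      using integrable_indicator_Y by (simp add: prob_Y[symmetric] prob_space prob_Y_shift[of "int _ + 1"])
    also have "\<dots> \<le> 2 * ?p k" by simp
    finally show ?thesis .
  qed
  have m0: "(\<lambda>T. ?m T k) \<longlonglongrightarrow> 0" for k
  proof -
    have "(\<lambda>T. ?m T k) \<longlonglongrightarrow> (\<integral>\<omega>. 0 \<partial>M)"
    proof (rule integral_dominated_convergence[where w = "\<lambda>_. 1"])
      \<comment> \<open>Coordinate 1, because averaging over the shifts i = 0, ..., n - 1 must give
        the observations at times 1 to n.\<close>
      let ?f = "\<lambda>y :: int \<Rightarrow> nat. indicator {k} (y 1) :: real"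
      have "AE \<omega> in M. (\<lambda>n. (\<Sum>i<n. ?f (sh (int i) \<omega>)) / real n) \<longlonglongrightarrow> (\<integral>\<omega>. ?f (sh 0 \<omega>) \<partial>M)"
        by (rule ergodic_average) (auto simp: sh_def intro: coordinate_meas integrable_indicator_Y)
      moreover have "(\<integral>\<omega>. ?f (sh 0 \<omega>) \<partial>M) = ?p k" unfolding prob_Y by (simp add: sh_def)
      ultimately show "AE \<omega> in M. (\<lambda>T. \<bar>pmf_error T \<omega> k\<bar>) \<longlonglongrightarrow> 0"
        unfolding pmf_error_def sh_def
        by (auto simp: add.commute elim!: eventually_mono intro!: tendsto_rabs_zero LIM_zero)
    qed (use bd in auto)
    then show ?thesis by simp
  qed
  have sm: "summable (\<lambda>k. real (Suc k) * ?m T k)" for T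
  proof (rule summable_comparison_test'[OF summable_mult[OF summable_prob_Y, of 2]])
    fix k
    have "real (Suc k) * ?m T k \<le> real (Suc k) * (2 * ?p k)" by (intro mult_left_mono m2) simp
    then show "norm (real (Suc k) * ?m T k) \<le> 2 * (real (Suc k) * ?p k)" by (simp del: of_nat_Suc add: abs_mult)
  qed
  have e1: "integrable M (\<lambda>\<omega>. real (Suc k) * \<bar>pmf_error T \<omega> k\<bar>)" for T k using ei by simp
  have e2: "AE \<omega> in M. summable (\<lambda>k. norm (real (Suc k) * \<bar>pmf_error T \<omega> k\<bar>))" for T
    using total_error_summable by (simp add: abs_mult del: of_nat_Suc)
  have e3: "summable (\<lambda>k. \<integral>\<omega>. norm (real (Suc k) * \<bar>pmf_error T \<omega> k\<bar>) \<partial>M)" for T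
    using sm by (simp add: abs_mult del: of_nat_Suc)
  show "integrable M (total_error T)" for T
    unfolding total_error_def by (rule integrable_suminf[OF e1 e2 e3])
  have "(\<integral>\<omega>. \<bar>total_error T \<omega>\<bar> \<partial>M) = (\<Sum>k. real (Suc k) * ?m T k)" for T
  proof -
    have "(\<integral>\<omega>. \<bar>total_error T \<omega>\<bar> \<partial>M) = (\<integral>\<omega>. total_error T \<omega> \<partial>M)" by (simp add: total_error_nonneg)
    also have "\<dots> = (\<Sum>k. \<integral>\<omega>. real (Suc k) * \<bar>pmf_error T \<omega> k\<bar> \<partial>M)"
      unfolding total_error_def by (rule integral_suminf[OF e1 e2 e3])
    finally show ?thesis by simp
  qed
  moreover have "(\<lambda>T. \<Sum>k. real (Suc k) * ?m T k) \<longlonglongrightarrow> (\<Sum>k. real (Suc k) * 0)"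
  proof -
    have "\<forall>\<^sub>F (k, T) in at_top \<times>\<^sub>F sequentially. norm (real (Suc k) * ?m T k) \<le> 2 * (real (Suc k) * ?p k)"
      using mult_left_mono[OF m2, of "real (Suc _)"] by (intro always_eventually) (auto simp del: of_nat_Suc simp: abs_mult mult_ac)
    then show ?thesis
      by (rule tannerys_theorem[THEN conjunct2, THEN conjunct2, rotated])
         (auto simp del: of_nat_Suc intro!: tendsto_mult_right_zero m0 summable_mult summable_prob_Y)
  qed
  ultimately show "(\<lambda>T. \<integral>\<omega>. \<bar>total_error T \<omega>\<bar> \<partial>M) \<longlonglongrightarrow> 0" by simp
qed

end

section \<open>The test statistic\<close>

text \<open>Weak convergence is tested on the functions \<open>cts_step\<close>; they are uniformly
  continuous with values in [0,1], so a perturbation that is small with high probability changes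
  their means little.\<close>

lemma slutsky:
  assumes M: "prob_space M" and I: "conv_in_dist_real M I \<mu>"
    and S [measurable]: "\<And>T. S T \<in> borel_measurable M"
    and diff: "is_o_P_1 M (\<lambda>T \<omega>. S T \<omega> - I T \<omega>)"
  shows "conv_in_dist_real M S \<mu>"
proof -
  interpret prob_space M by fact
  have \<mu>: "real_distribution \<mu>" and w: "weak_conv_m (\<lambda>T. distr M borel (I T)) \<mu>"
    using I by (auto simp: conv_in_dist_real_def)
  have Im [measurable]: "I T \<in> borel_measurable M" for T
    using I by (auto simp: conv_in_dist_real_def)
  have dI: "real_distribution (distr M borel (I T))" and dS: "real_distribution (distr M borel (S T))" for T
    by (auto intro: real_distribution_distr)
  have "weak_conv_m (\<lambda>T. distr M borel (S T)) \<mu>"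
  proof (rule integral_cts_step_conv_imp_weak_conv[OF dS \<mu>])
    fix a b :: real assume ab: "a < b"
    let ?g = "cts_step a b"
    have g01: "0 \<le> ?g x" "?g x \<le> 1" for x using ab by (auto simp: cts_step_def divide_simps)
    have uc: "uniformly_continuous_on UNIV ?g" by (rule cts_step_uniformly_continuous[OF ab])
    then have gc: "isCont ?g x" for x
      by (intro continuous_on_interior[OF uniformly_continuous_imp_continuous]) auto
    then have [measurable]: "?g \<in> borel_measurable borel"
      by (intro borel_measurable_continuous_onI continuous_at_imp_continuous_on) auto
    have "(\<lambda>T. integral\<^sup>L (distr M borel (I T)) ?g) \<longlonglongrightarrow> integral\<^sup>L \<mu> ?g"
      by (rule weak_conv_imp_integral_bdd_continuous_conv[OF dI \<mu> w gc, of 1]) (use g01 in auto)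
    moreover have "(\<lambda>T. integral\<^sup>L (distr M borel (S T)) ?g - integral\<^sup>L (distr M borel (I T)) ?g) \<longlonglongrightarrow> 0"
    proof (rule LIMSEQ_I)
      fix e :: real assume e: "e > 0"
      obtain d where d: "d > 0" "\<And>x y. dist x y < d \<Longrightarrow> dist (?g x) (?g y) < e / 4"
        using uc[unfolded uniformly_continuous_on_def, rule_format, of "e / 4"] e by (auto simp: dist_commute)
      have "\<forall>\<^sub>F T in sequentially. prob {\<omega> \<in> space M. \<bar>S T \<omega> - I T \<omega>\<bar> > d / 2} \<le> e / 8"
        using diff[unfolded is_o_P_1_iff, rule_format, of "d / 2" "e / 8"] d e by simp
      then obtain m where m: "\<And>T. T \<ge> m \<Longrightarrow> prob {\<omega> \<in> space M. \<bar>S T \<omega> - I T \<omega>\<bar> > d / 2} \<le> e / 8"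
        by (auto simp: eventually_sequentially)
      have "norm (integral\<^sup>L (distr M borel (S T)) ?g - integral\<^sup>L (distr M borel (I T)) ?g - 0) < e" if "T \<ge> m" for T
      proof -
        let ?A = "{\<omega> \<in> space M. \<bar>S T \<omega> - I T \<omega>\<bar> \<le> d / 2}"
        have "\<bar>(\<integral>\<omega>. ?g (S T \<omega>) \<partial>M) - (\<integral>\<omega>. ?g (I T \<omega>) \<partial>M)\<bar> \<le> e / 4 + (1 + 1) * prob (space M - ?A)"
        proof (rule integral_diff_le_on_large_set)
          show "\<bar>?g (S T \<omega>) - ?g (I T \<omega>)\<bar> \<le> e / 4" if "\<omega> \<in> ?A" for \<omega>
            using d(2)[of "S T \<omega>" "I T \<omega>"] that d(1) by (auto simp: dist_real_def)
        qed (use g01 e in auto)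
        also have "space M - ?A = {\<omega> \<in> space M. \<bar>S T \<omega> - I T \<omega>\<bar> > d / 2}" by auto
        also have "e / 4 + (1 + 1) * prob {\<omega> \<in> space M. \<bar>S T \<omega> - I T \<omega>\<bar> > d / 2} < e"
          using m[OF that] e by simp
        finally show ?thesis by (simp add: integral_distr)
      qed
      then show "\<exists>no. \<forall>T\<ge>no. norm (integral\<^sup>L (distr M borel (S T)) ?g - integral\<^sup>L (distr M borel (I T)) ?g - 0) < e"
        by blast
    qed
    ultimately show "(\<lambda>T. integral\<^sup>L (distr M borel (S T)) ?g) \<longlonglongrightarrow> integral\<^sup>L \<mu> ?g"
      using tendsto_add by fastforce
  qed
  with \<mu> show ?thesis by (simp add: conv_in_dist_real_def)
qed

section \<open>The weighted square functional on paths\<close>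

definition weighted_sq :: "(real \<Rightarrow> real) \<Rightarrow> (real \<Rightarrow> real) \<Rightarrow> real" where
  "weighted_sq w f = (LINT u|lebesgue_on {0..1}. (f u)\<^sup>2 * w u)"

lemma weighted_sq_restrict: "weighted_sq w (restrict f {0..1}) = weighted_sq w f"
  unfolding weighted_sq_def by (rule Bochner_Integration.integral_cong) auto

lemma integrable_weighted:
  fixes f w :: "real \<Rightarrow> real"
  assumes w: "integrable (lebesgue_on {0..1}) w" and f: "continuous_on {0..1} f"
  shows "integrable (lebesgue_on {0..1}) (\<lambda>u. f u * w u)"
proof -
  obtain b where b: "\<And>u. u \<in> {0..1} \<Longrightarrow> \<bar>f u\<bar> \<le> b"
    using compact_imp_bounded[OF compact_continuous_image[OF f]] unfolding bounded_iff by force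
  have "f \<in> borel_measurable (lebesgue_on {0..1})"
    by (rule continuous_imp_measurable_on_sets_lebesgue[OF f]) simp
  then show ?thesis
  proof (rule Bochner_Integration.integrable_bound[rotated 1, OF borel_measurable_times])
    show "integrable (lebesgue_on {0..1}) (\<lambda>u. b * w u)" using w by simp
    show "AE u in lebesgue_on {0..1}. norm (f u * w u) \<le> norm (b * w u)"
    proof (rule AE_I2)
      fix u :: real assume "u \<in> space (lebesgue_on {0..1})"
      then have "\<bar>f u\<bar> \<le> \<bar>b\<bar>" using b[of u] by simp
      then show "norm (f u * w u) \<le> norm (b * w u)" by (simp add: abs_mult mult_right_mono)
    qed
  qed (use w in auto)
qed

text \<open>In the factorisation of f^2 - g^2 the sum f + g is written as (f - g) + 2g, so a bound
  is required of g alone. It is used with g the process path, bounded on a box, and f the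
  statistic.\<close>

lemma weighted_sq_diff:
  assumes w: "integrable (lebesgue_on {0..1}) w" and w0: "\<And>u. u \<in> {0..1} \<Longrightarrow> 0 \<le> w u"
    and f: "continuous_on {0..1} f" and g: "continuous_on {0..1} g"
    and d: "\<And>u. u \<in> {0..1} \<Longrightarrow> \<bar>f u - g u\<bar> \<le> d" and b: "\<And>u. u \<in> {0..1} \<Longrightarrow> \<bar>g u\<bar> \<le> b"
  shows "\<bar>weighted_sq w f - weighted_sq w g\<bar> \<le> d * (d + 2 * b) * (LINT u|lebesgue_on {0..1}. w u)"
proof -
  note cont = continuous_on_power[OF f, of 2] continuous_on_power[OF g, of 2]
  note int = integrable_weighted[OF w cont(1)] integrable_weighted[OF w cont(2)]
  have "\<bar>weighted_sq w f - weighted_sq w g\<bar> = \<bar>LINT u|lebesgue_on {0..1}. (f u)\<^sup>2 * w u - (g u)\<^sup>2 * w u\<bar>"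
    unfolding weighted_sq_def using int by simp
  also have "\<dots> \<le> (LINT u|lebesgue_on {0..1}. \<bar>(f u)\<^sup>2 * w u - (g u)\<^sup>2 * w u\<bar>)" by (rule integral_abs_bound)
  also have "\<dots> \<le> (LINT u|lebesgue_on {0..1}. d * (d + 2 * b) * w u)"
  proof (rule integral_mono)
    fix u :: real assume "u \<in> space (lebesgue_on {0..1})"
    then have u: "u \<in> {0..1}" by simp
    have "\<bar>(f u)\<^sup>2 - (g u)\<^sup>2\<bar> = \<bar>f u - g u\<bar> * \<bar>(f u - g u) + 2 * g u\<bar>"
      by (simp add: power2_eq_square algebra_simps flip: abs_mult)
    also have "\<dots> \<le> d * (d + 2 * b)"
      using d[OF u] b[OF u] by (intro mult_mono) auto
    finally have "\<bar>(f u)\<^sup>2 - (g u)\<^sup>2\<bar> * w u \<le> d * (d + 2 * b) * w u"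
      using w0[OF u] by (rule mult_right_mono)
    then show "\<bar>(f u)\<^sup>2 * w u - (g u)\<^sup>2 * w u\<bar> \<le> d * (d + 2 * b) * w u"
      using w0[OF u] by (simp add: abs_mult flip: left_diff_distrib)
  qed (use w int in auto)
  finally show ?thesis by simp
qed

lemma weighted_sq_continuous:
  assumes w: "integrable (lebesgue_on {0..1}) w" and w0: "\<And>u. u \<in> {0..1} \<Longrightarrow> 0 \<le> w u"
  shows "continuous_map C01 euclideanreal (weighted_sq w)"
proof (rule continuous_map_from_C01)
  fix f and e :: real assume f: "f \<in> topspace C01" and e: "0 < e"
  have fc: "continuous_on {0..1} f" using f by (simp add: topspace_C01)
  then obtain b where b: "\<And>u. u \<in> {0..1} \<Longrightarrow> \<bar>f u\<bar> \<le> b"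
    using compact_imp_bounded[OF compact_continuous_image[OF fc]] unfolding bounded_iff by force
  have b0: "0 \<le> b" using b[of 0] by auto
  let ?I = "LINT u|lebesgue_on {0..1}. w u"
  have I: "0 \<le> ?I" using w0 by (intro integral_nonneg_AE AE_I2) auto
  \<comment> \<open>The cap 1 replaces the factor d + 2b by 1 + 2b, and adding 1 to the integral of
    w keeps the denominator positive.\<close>
  define d where "d = min 1 (e / (2 * (1 + 2 * b) * (?I + 1)))"
  have d: "0 < d" "d \<le> 1" using e b0 I by (auto simp: d_def intro!: divide_pos_pos mult_pos_pos)
  have "d * (d + 2 * b) * ?I \<le> d * (1 + 2 * b) * (?I + 1)"
    using d b0 I by (intro mult_mono mult_left_mono) auto
  also have "\<dots> \<le> (e / (2 * (1 + 2 * b) * (?I + 1))) * (1 + 2 * b) * (?I + 1)"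
    using b0 I by (intro mult_right_mono) (auto simp: d_def)
  also have "\<dots> = e / 2"
  proof -
    have eq: "e / (2 * x * z) * x * z = e / 2" if "x \<noteq> 0" "z \<noteq> 0" for x z :: real using that by simp
    show ?thesis by (rule eq) (use b0 I in auto)
  qed
  finally have small: "d * (d + 2 * b) * ?I < e" using e by simp
  show "\<exists>d>0. \<forall>g\<in>topspace C01. (\<forall>u\<in>{0..1}. \<bar>f u - g u\<bar> \<le> d) \<longrightarrow> \<bar>weighted_sq w f - weighted_sq w g\<bar> < e"
  proof (intro exI[of _ d] conjI ballI impI)
    fix g assume g: "g \<in> topspace C01" "\<forall>u\<in>{0..1}. \<bar>f u - g u\<bar> \<le> d"
    have "\<bar>weighted_sq w g - weighted_sq w f\<bar> \<le> d * (d + 2 * b) * ?I"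
      using g fc b by (intro weighted_sq_diff w w0) (auto simp: topspace_C01 abs_minus_commute)
    with small show "\<bar>weighted_sq w f - weighted_sq w g\<bar> < e" by (simp add: abs_minus_commute)
  qed (rule d)
qed

section \<open>Expansion of the statistic around the true parameters\<close>

locale inarch_test = inarch_est M Y \<theta>1 \<theta>2 q l1 l2 for M :: "'a measure" and Y \<theta>1 \<theta>2 q l1 l2 +
  fixes est1 est2 :: "nat list \<Rightarrow> real" and w :: "real \<Rightarrow> real"
  assumes lin1: "asymp_linear M Y q est1 \<theta>1 (\<lambda>t \<omega>. l1 (lag_vec Y q t \<omega>) \<theta>1 \<theta>2)"
    and lin2: "asymp_linear M Y q est2 \<theta>2 (\<lambda>t \<omega>. l2 (lag_vec Y q t \<omega>) \<theta>1 \<theta>2)"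
    and w_int: "integrable (lebesgue_on {0..1}) w"
    and w_nonneg: "\<And>u. u \<in> {0..1} \<Longrightarrow> 0 \<le> w u"
begin

definition D1 :: "nat \<Rightarrow> 'a \<Rightarrow> real" where "D1 T \<omega> = sqrt (real T) * (est1 (obs Y T \<omega>) - \<theta>1)"
definition D2 :: "nat \<Rightarrow> 'a \<Rightarrow> real" where "D2 T \<omega> = sqrt (real T) * (est2 (obs Y T \<omega>) - \<theta>2)"
definition A :: "nat \<Rightarrow> 'a \<Rightarrow> real" where "A T \<omega> = (\<Sum>j<T. (real (Y (int j + 1) \<omega>))\<^sup>2) / real T"

definition stat :: "nat \<Rightarrow> 'a \<Rightarrow> real \<Rightarrow> real" where
  "stat T \<omega> u = sqrt (real T) * (emp_pgf Y T u \<omega> - est_pgf est1 est2 Y T u \<omega>)"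

lemma obs_fun_meas: "(\<lambda>\<omega>. f (obs Y T \<omega>)) \<in> borel_measurable M" for f :: "nat list \<Rightarrow> real"
proof -
  have "(\<lambda>\<omega>. obs Y T \<omega>) \<in> M \<rightarrow>\<^sub>M count_space UNIV"
    unfolding obs_def by (rule measurable_map_list) simp
  then show ?thesis by (rule measurable_compose) simp
qed

lemma [measurable]: "D1 T \<in> borel_measurable M" "D2 T \<in> borel_measurable M"
  unfolding D1_def D2_def by (rule obs_fun_meas)+

lemma A_meas [measurable]: "A T \<in> borel_measurable M"
proof -
  have "(\<lambda>\<omega>. (real (Y t \<omega>))\<^sup>2) \<in> borel_measurable M" for t by (rule Y_fun_meas)
  then show ?thesis unfolding A_def by measurable
qed

lemma D_minus_L:
  "is_o_P_1 M (\<lambda>T \<omega>. D1 T \<omega> - W T \<omega> 0)" "is_o_P_1 M (\<lambda>T \<omega>. D2 T \<omega> - W T \<omega> (Suc 0))"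
  using lin1 lin2 unfolding asymp_linear_def D1_def D2_def W_def inc_sh .

lemma W_O_P: "is_O_P_1 M (\<lambda>T \<omega>. W T \<omega> k)"
  by (rule is_O_P_1_square_integrable[OF W_meas W_sq])

lemma D_O_P: "is_O_P_1 M D1" "is_O_P_1 M D2"
proof -
  have "is_O_P_1 M (\<lambda>T \<omega>. (D1 T \<omega> - W T \<omega> 0) + W T \<omega> 0)"
    by (intro is_O_P_1_add is_o_P_1_imp_O D_minus_L W_O_P) measurable
  then show "is_O_P_1 M D1" by simp
  have "is_O_P_1 M (\<lambda>T \<omega>. (D2 T \<omega> - W T \<omega> (Suc 0)) + W T \<omega> (Suc 0))"
    by (intro is_O_P_1_add is_o_P_1_imp_O D_minus_L W_O_P) measurable
  then show "is_O_P_1 M D2" by simp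
qed

lemma A_nonneg: "0 \<le> A T \<omega>"
  unfolding A_def by (simp add: sum_nonneg)

lemma A_O_P: "is_O_P_1 M A"
proof (rule is_O_P_1_integrable)
  show "integrable M (A T)" for T unfolding A_def using integrable_Y_sq by auto
  show "(\<integral>\<omega>. \<bar>A T \<omega>\<bar> \<partial>M) \<le> (\<integral>\<omega>. (real (Y 1 \<omega>))\<^sup>2 \<partial>M)" for T
  proof -
    have "(\<integral>\<omega>. \<bar>A T \<omega>\<bar> \<partial>M) = (\<integral>\<omega>. A T \<omega> \<partial>M)" by (simp add: A_nonneg)
    also have "\<dots> = (\<Sum>j<T. \<integral>\<omega>. (real (Y (int j + 1) \<omega>))\<^sup>2 \<partial>M) / real T"
      unfolding A_def using integrable_Y_sq by simp
    also have "\<dots> = (\<Sum>j<T. \<integral>\<omega>. (real (Y 1 \<omega>))\<^sup>2 \<partial>M) / real T"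
      by (simp only: integral_Y[of "\<lambda>y. (real y)\<^sup>2" "int _ + 1"])
    also have "\<dots> \<le> (\<integral>\<omega>. (real (Y 1 \<omega>))\<^sup>2 \<partial>M)" by simp
    finally show ?thesis .
  qed
qed

text \<open>None of the terms involves u. In order they bound: the boundary terms of the sums; the
  linear term in \<open>\<theta>1\<close>, through the linearisation of its estimator and the
  average of the derivative; the same for \<open>\<theta>2\<close>; and the second-order Taylor
  remainder.\<close>

definition remainder :: "nat \<Rightarrow> 'a \<Rightarrow> real" where
  "remainder T \<omega> = (2 * real q + 1) / sqrt (real T)
     + (\<bar>D1 T \<omega> - W T \<omega> 0\<bar> + total_error T \<omega> * \<bar>W T \<omega> 0\<bar>)
     + (\<bar>D2 T \<omega> - W T \<omega> (Suc 0)\<bar> * (1 + A T \<omega>) + total_error T \<omega> * \<bar>W T \<omega> (Suc 0)\<bar>)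
     + 1 / sqrt (real T) * (2 * ((D1 T \<omega>)\<^sup>2 + (D2 T \<omega>)\<^sup>2 * A T \<omega>) * exp (\<bar>D1 T \<omega>\<bar> + \<bar>D2 T \<omega>\<bar> * (1 + A T \<omega>)))"

lemma remainder_meas [measurable]: "remainder T \<in> borel_measurable M"
  unfolding remainder_def by measurable

lemma remainder_o_P: "is_o_P_1 M remainder"
proof -
  have s0: "(\<lambda>T. c / sqrt (real T)) \<longlonglongrightarrow> 0" for c :: real
    by (intro tendsto_divide_0[OF tendsto_const] filterlim_at_top_imp_at_infinity
        filterlim_compose[OF sqrt_at_top] filterlim_real_sequentially)
  note O = is_O_P_1_abs W_O_P D_O_P A_O_P is_O_P_1_const
  have "is_O_P_1 M (\<lambda>T \<omega>. \<bar>D1 T \<omega>\<bar> + \<bar>D2 T \<omega>\<bar> * (1 + A T \<omega>))"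
    by (intro is_O_P_1_add is_O_P_1_mult O) measurable
  then have ex: "is_O_P_1 M (\<lambda>T \<omega>. exp (\<bar>D1 T \<omega>\<bar> + \<bar>D2 T \<omega>\<bar> * (1 + A T \<omega>)))"
    by (intro is_O_P_1_exp) measurable
  have "is_O_P_1 M (\<lambda>T \<omega>. 2 * (D1 T \<omega> * D1 T \<omega> + D2 T \<omega> * D2 T \<omega> * A T \<omega>) * exp (\<bar>D1 T \<omega>\<bar> + \<bar>D2 T \<omega>\<bar> * (1 + A T \<omega>)))"
    by (intro is_O_P_1_add is_O_P_1_mult O ex) measurable
  from this have 4: "is_o_P_1 M (\<lambda>T \<omega>. 1 / sqrt (real T) * (2 * (D1 T \<omega> * D1 T \<omega> + D2 T \<omega> * D2 T \<omega> * A T \<omega>) * exp (\<bar>D1 T \<omega>\<bar> + \<bar>D2 T \<omega>\<bar> * (1 + A T \<omega>))))"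
    by (intro is_o_P_1_mult[OF _ _ is_o_P_1_deterministic[OF s0]]) measurable
  have 3: "is_o_P_1 M (\<lambda>T \<omega>. \<bar>D2 T \<omega> - W T \<omega> (Suc 0)\<bar> * (1 + A T \<omega>) + total_error T \<omega> * \<bar>W T \<omega> (Suc 0)\<bar>)"
    by (intro is_o_P_1_add is_o_P_1_mult is_o_P_1_abs D_minus_L total_error_o_P is_O_P_1_add O) measurable
  have 2: "is_o_P_1 M (\<lambda>T \<omega>. \<bar>D1 T \<omega> - W T \<omega> 0\<bar> + total_error T \<omega> * \<bar>W T \<omega> 0\<bar>)"
    by (intro is_o_P_1_add is_o_P_1_mult is_o_P_1_abs D_minus_L total_error_o_P O) measurable
  have 1: "is_o_P_1 M (\<lambda>T \<omega>. (2 * real q + 1) / sqrt (real T))"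
    by (rule is_o_P_1_deterministic[OF s0])
  show ?thesis unfolding remainder_def power2_eq_square
    by (rule is_o_P_1_add[OF _ _ is_o_P_1_add[OF _ _ is_o_P_1_add[OF _ _ 1 2] 3] 4]) measurable
qed

text \<open>A pathwise inequality, so all probability is left to \<open>remainder_o_P\<close>. The
  exponentials are linearised in the estimation error, the averaged derivatives are replaced by
  \<open>r1\<close> and \<open>r2\<close>, and the summation ranges are aligned.\<close>

lemma stat_expansion:
  assumes T: "1 \<le> T" and u: "u \<in> {0..1}"
  shows "\<bar>stat T \<omega> u - calV_bar M Y q l1 l2 \<theta>1 \<theta>2 T u \<omega>\<bar> \<le> remainder T \<omega>"
proof -
  define n where "n = real T"
  define s where "s = sqrt n"
  have n: "n > 0" using T by (simp add: n_def)
  have s: "s > 0" "s * s = n" using n by (simp_all add: s_def)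
  define y where "y j = Y (int j + 1) \<omega>" for j
  define y' where "y' j = Y (int j) \<omega>" for j
  define e where "e k = exp ((\<theta>1 + \<theta>2 * real k) * (u - 1))" for k
  define \<delta> where "\<delta> j = (D1 T \<omega> + D2 T \<omega> * real (y j)) / s" for j
  define \<rho> where "\<rho> j = e (y j) * (exp (\<delta> j * (u - 1)) - 1 - \<delta> j * (u - 1))" for j
  have e01: "0 \<le> e k" "e k \<le> 1" for k using r_bounds(3)[OF u] by (simp_all add: e_def)
  have u01: "0 \<le> u ^ k" "u ^ k \<le> 1" for k using u by (auto intro: power_le_one)
  have sumT: "(\<Sum>t = 1..int T. f t) = (\<Sum>j<T. f (int j + 1))" for f :: "int \<Rightarrow> real"
    using sum_int_interval_conv_nat[of f 0 T] by simp
  have est: "est1 (obs Y T \<omega>) = \<theta>1 + D1 T \<omega> / s" "est2 (obs Y T \<omega>) = \<theta>2 + D2 T \<omega> / s"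
    using s by (simp_all add: D1_def D2_def flip: n_def s_def)
  \<comment> \<open>The power \<open>y j\<close> turns the empirical generating function at the
    estimated argument into an average of exponentials with perturbed parameters;
    \<open>\<delta> j\<close> is the resulting change of the Poisson mean, and
    \<open>\<rho> j\<close> what linearisation leaves over.\<close>
  have ehat: "exp (est1 (obs Y T \<omega>) * (u - 1)) * exp (est2 (obs Y T \<omega>) * (u - 1)) ^ y j
      = e (y j) + \<delta> j * (e (y j) * (u - 1)) + \<rho> j" for j
  proof -
    have "exp (est1 (obs Y T \<omega>) * (u - 1)) * exp (est2 (obs Y T \<omega>) * (u - 1)) ^ y j
       = exp (est1 (obs Y T \<omega>) * (u - 1) + real (y j) * (est2 (obs Y T \<omega>) * (u - 1)))"
      by (simp add: exp_add exp_of_nat_mult)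
    also have "est1 (obs Y T \<omega>) * (u - 1) + real (y j) * (est2 (obs Y T \<omega>) * (u - 1))
       = (\<theta>1 + \<theta>2 * real (y j)) * (u - 1) + \<delta> j * (u - 1)"
      unfolding est \<delta>_def by (simp add: add_divide_distrib distrib_left distrib_right right_diff_distrib left_diff_distrib mult_ac)
    also have "exp \<dots> = e (y j) * exp (\<delta> j * (u - 1))" by (simp add: exp_add e_def)
    also have "\<dots> = e (y j) + \<delta> j * (e (y j) * (u - 1)) + \<rho> j" by (simp add: \<rho>_def algebra_simps)
    finally show ?thesis .
  qed
  define c1 where "c1 = (\<Sum>j<T. e (y j) * (u - 1)) / n"
  define c2 where "c2 = (\<Sum>j<T. real (y j) * e (y j) * (u - 1)) / n"
  have sn: "s / n = 1 / s" using s n by (simp add: field_simps)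
  have stat: "stat T \<omega> u = (\<Sum>j<T. u ^ y j) / s - (\<Sum>j<T. e (y j)) / s - D1 T \<omega> * c1 - D2 T \<omega> * c2 - (\<Sum>j<T. \<rho> j) / s"
  proof -
    have "stat T \<omega> u = s / n * ((\<Sum>j<T. u ^ y j)
        - (\<Sum>j<T. exp (est1 (obs Y T \<omega>) * (u - 1)) * exp (est2 (obs Y T \<omega>) * (u - 1)) ^ y j))"
      unfolding stat_def emp_pgf_def est_pgf_def sumT
      by (simp add: sum_distrib_left right_diff_distrib y_def mult.left_commute flip: n_def s_def)
    also have "\<dots> = (\<Sum>j<T. u ^ y j) / s - (\<Sum>j<T. e (y j)) / s - (\<Sum>j<T. \<delta> j * (e (y j) * (u - 1))) / s - (\<Sum>j<T. \<rho> j) / s"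
      unfolding ehat sn by (simp add: sum.distrib diff_divide_distrib add_divide_distrib)
    also have "(\<Sum>j<T. \<delta> j * (e (y j) * (u - 1))) / s = D1 T \<omega> * c1 + D2 T \<omega> * c2"
    proof -
      have "\<delta> j * (e (y j) * (u - 1)) / s = D1 T \<omega> * (e (y j) * (u - 1) / n) + D2 T \<omega> * (real (y j) * e (y j) * (u - 1) / n)" for j
        unfolding \<delta>_def s(2)[symmetric] by (simp add: add_divide_distrib diff_divide_distrib algebra_simps)
      then show ?thesis
        by (simp add: c1_def c2_def sum_divide_distrib sum.distrib sum_distrib_left)
    qed
    finally show ?thesis by simp
  qed
  define \<beta>1 where "\<beta>1 = r1 M Y \<theta>1 \<theta>2 u"
  define \<beta>2 where "\<beta>2 = r2 M Y \<theta>1 \<theta>2 u"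
  let ?L1 = "W T \<omega> 0" and ?L2 = "W T \<omega> (Suc 0)"
  have bar: "calV_bar M Y q l1 l2 \<theta>1 \<theta>2 T u \<omega> = (\<Sum>j<T. if q \<le> j then u ^ y j else 0) / s
      - (\<Sum>j<T. if q \<le> j then e (y' j) else 0) / s - \<beta>1 * ?L1 - \<beta>2 * ?L2"
  proof -
    have "calV_bar M Y q l1 l2 \<theta>1 \<theta>2 T u \<omega> = ((\<Sum>t = int q + 1..int T. u ^ Y t \<omega>) - (\<Sum>t = int q + 1..int T. e (Y (t - 1) \<omega>))
        - \<beta>1 * (\<Sum>t = int q + 1..int T. inc 0 (sh t \<omega>)) - \<beta>2 * (\<Sum>t = int q + 1..int T. inc (Suc 0) (sh t \<omega>))) / s"
      unfolding calV_bar_def calV_def V_proc_def inc_sh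
      by (simp add: sum_subtractf sum_distrib_left e_def \<beta>1_def \<beta>2_def flip: n_def s_def)
    also have "\<dots> = ((\<Sum>j<T. if q \<le> j then u ^ y j else 0) - (\<Sum>j<T. if q \<le> j then e (y' j) else 0)) / s - \<beta>1 * ?L1 - \<beta>2 * ?L2"
      unfolding W_def sum_int_interval_conv_nat[of "\<lambda>t. u ^ Y t \<omega>"] sum_int_interval_conv_nat[of "\<lambda>t. e (Y (t - 1) \<omega>)"]
      by (simp add: y_def y'_def diff_divide_distrib cong: if_cong flip: n_def s_def)
    finally show ?thesis by (simp add: diff_divide_distrib)
  qed
  have b1: "\<bar>(\<Sum>j<T. u ^ y j) / s - (\<Sum>j<T. if q \<le> j then u ^ y j else 0) / s\<bar> \<le> real q / s"
  proof -
    have "\<bar>(\<Sum>j<T. u ^ y j) - (\<Sum>j<T. if q \<le> j then u ^ y j else 0)\<bar> / s \<le> real q / s"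
      using s by (intro divide_right_mono truncated_sum_diff u01) auto
    then show ?thesis using s by (simp flip: diff_divide_distrib)
  qed
  have b2: "\<bar>(\<Sum>j<T. e (y j)) / s - (\<Sum>j<T. if q \<le> j then e (y' j) else 0) / s\<bar> \<le> (real q + 1) / s"
  proof -
    \<comment> \<open>The statistic evaluates the exponential at the current value and the process
      at the previous one. The two sums telescope to end terms in [0,1], which is the source of the
      extra 1 beside 2q.\<close>
    have "(\<Sum>j<T. e (y j)) - (\<Sum>j<T. e (y' j)) = e (y' T) - e (y' 0)"
    proof -
      have "y j = y' (Suc j)" for j by (simp add: y_def y'_def add.commute)
      then show ?thesis using sum_lessThan_telescope[of "\<lambda>j. e (y' j)" T] by (simp add: sum_subtractf)
    qed
    moreover have "\<bar>(\<Sum>j<T. e (y' j)) - (\<Sum>j<T. if q \<le> j then e (y' j) else 0)\<bar> \<le> real q"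
      by (intro truncated_sum_diff e01)
    ultimately have "\<bar>(\<Sum>j<T. e (y j)) - (\<Sum>j<T. if q \<le> j then e (y' j) else 0)\<bar> \<le> real q + 1"
      using e01[of "y' T"] e01[of "y' 0"] by linarith
    then have "\<bar>(\<Sum>j<T. e (y j)) - (\<Sum>j<T. if q \<le> j then e (y' j) else 0)\<bar> / s \<le> (real q + 1) / s"
      using s by (intro divide_right_mono) auto
    then show ?thesis using s by (simp flip: diff_divide_distrib)
  qed
  have y_le: "real k \<le> 1 + (real k)\<^sup>2" for k :: nat
    using zero_le_power2[of "real k - 1"] zero_le_power2[of "real k"]
    unfolding power2_diff one_power2 mult_1_right by linarith
  have c1: "\<bar>c1\<bar> \<le> 1"
  proof -
    have "\<bar>\<Sum>j<T. e (y j) * (u - 1)\<bar> \<le> (\<Sum>j<T. 1)"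
      using r_bounds(1)[OF u] by (intro order_trans[OF sum_abs] sum_mono) (simp add: e_def)
    then show ?thesis using n by (simp add: c1_def divide_le_eq n_def)
  qed
  have c2: "\<bar>c2\<bar> \<le> 1 + A T \<omega>"
  proof -
    have "\<bar>\<Sum>j<T. real (y j) * e (y j) * (u - 1)\<bar> \<le> (\<Sum>j<T. 1 + (real (y j))\<^sup>2)"
      using r_bounds(2)[OF u] by (intro order_trans[OF sum_abs] sum_mono order_trans[OF _ y_le]) (simp add: e_def)
    also have "\<dots> = n * (1 + A T \<omega>)" using n by (simp add: A_def y_def n_def sum.distrib algebra_simps)
    finally show ?thesis using n by (simp add: c2_def pos_divide_le_eq mult.commute)
  qed
  have d1: "\<bar>c1 - \<beta>1\<bar> \<le> total_error T \<omega>"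
  proof -
    have "\<bar>exp ((\<theta>1 + \<theta>2 * real k) * (u - 1)) * (u - 1)\<bar> \<le> real (Suc k)" for k
      using r_bounds(1)[OF u, of k] by simp
    from average_error[OF this, of \<omega> T] show ?thesis by (simp add: c1_def \<beta>1_def r1_def e_def y_def n_def)
  qed
  have d2: "\<bar>c2 - \<beta>2\<bar> \<le> total_error T \<omega>"
  proof -
    have "\<bar>real k * exp ((\<theta>1 + \<theta>2 * real k) * (u - 1)) * (u - 1)\<bar> \<le> real (Suc k)" for k
      using r_bounds(2)[OF u, of k] by simp
    from average_error[OF this, of \<omega> T] show ?thesis by (simp add: c2_def \<beta>2_def r2_def e_def y_def n_def)
  qed
  \<comment> \<open>Split so that the random average \<open>c1\<close>, bounded by 1, multiplies the
    linearisation error, while its deviation from \<open>\<beta>1\<close> multiplies the normalised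
    sum.\<close>
  have b3: "\<bar>D1 T \<omega> * c1 - \<beta>1 * ?L1\<bar> \<le> \<bar>D1 T \<omega> - ?L1\<bar> + total_error T \<omega> * \<bar>?L1\<bar>"
  proof -
    have "\<bar>D1 T \<omega> * c1 - \<beta>1 * ?L1\<bar> = \<bar>(D1 T \<omega> - ?L1) * c1 + (c1 - \<beta>1) * ?L1\<bar>" by (simp add: algebra_simps)
    also have "\<dots> \<le> \<bar>D1 T \<omega> - ?L1\<bar> * \<bar>c1\<bar> + \<bar>c1 - \<beta>1\<bar> * \<bar>?L1\<bar>"
      by (rule order_trans[OF abs_triangle_ineq]) (simp add: abs_mult)
    also have "\<dots> \<le> \<bar>D1 T \<omega> - ?L1\<bar> * 1 + total_error T \<omega> * \<bar>?L1\<bar>"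
      by (intro add_mono mult_left_mono mult_right_mono c1 d1) auto
    finally show ?thesis by simp
  qed
  have b4: "\<bar>D2 T \<omega> * c2 - \<beta>2 * ?L2\<bar> \<le> \<bar>D2 T \<omega> - ?L2\<bar> * (1 + A T \<omega>) + total_error T \<omega> * \<bar>?L2\<bar>"
  proof -
    have "\<bar>D2 T \<omega> * c2 - \<beta>2 * ?L2\<bar> = \<bar>(D2 T \<omega> - ?L2) * c2 + (c2 - \<beta>2) * ?L2\<bar>" by (simp add: algebra_simps)
    also have "\<dots> \<le> \<bar>D2 T \<omega> - ?L2\<bar> * \<bar>c2\<bar> + \<bar>c2 - \<beta>2\<bar> * \<bar>?L2\<bar>"
      by (rule order_trans[OF abs_triangle_ineq]) (simp add: abs_mult)
    also have "\<dots> \<le> \<bar>D2 T \<omega> - ?L2\<bar> * (1 + A T \<omega>) + total_error T \<omega> * \<bar>?L2\<bar>"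
      by (intro add_mono mult_left_mono mult_right_mono c2 d2) auto
    finally show ?thesis .
  qed
  have b5: "\<bar>(\<Sum>j<T. \<rho> j) / s\<bar> \<le> 1 / s * (2 * ((D1 T \<omega>)\<^sup>2 + (D2 T \<omega>)\<^sup>2 * A T \<omega>) * exp (\<bar>D1 T \<omega>\<bar> + \<bar>D2 T \<omega>\<bar> * (1 + A T \<omega>)))"
  proof -
    let ?E = "exp (\<bar>D1 T \<omega>\<bar> + \<bar>D2 T \<omega>\<bar> * (1 + A T \<omega>))"
    have \<rho>b: "\<bar>\<rho> j\<bar> \<le> 2 * ((D1 T \<omega>)\<^sup>2 / n + (D2 T \<omega>)\<^sup>2 * ((real (y j))\<^sup>2 / n)) * ?E" if j: "j < T" for j
    proof -
      have "\<bar>\<delta> j * (u - 1)\<bar> \<le> \<bar>\<delta> j\<bar>" using u by (simp add: abs_mult mult_left_le)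
      then have du: "(\<delta> j * (u - 1))\<^sup>2 \<le> (\<delta> j)\<^sup>2" "\<bar>\<delta> j * (u - 1)\<bar> \<le> \<bar>\<delta> j\<bar>"
        by (simp_all add: abs_le_square_iff)
      have "\<bar>\<rho> j\<bar> \<le> 1 * \<bar>exp (\<delta> j * (u - 1)) - 1 - \<delta> j * (u - 1)\<bar>"
        unfolding \<rho>_def abs_mult using e01 by (intro mult_right_mono) auto
      also have "\<dots> \<le> (\<delta> j * (u - 1))\<^sup>2 * exp \<bar>\<delta> j * (u - 1)\<bar>" using exp_linear_bound by simp
      also have "\<dots> \<le> (\<delta> j)\<^sup>2 * exp \<bar>\<delta> j\<bar>" using du by (intro mult_mono) auto
      also have "(\<delta> j)\<^sup>2 * exp \<bar>\<delta> j\<bar> \<le> 2 * ((D1 T \<omega>)\<^sup>2 / n + (D2 T \<omega>)\<^sup>2 * ((real (y j))\<^sup>2 / n)) * ?E"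
      proof (rule mult_mono)
        have sq: "(a + b)\<^sup>2 \<le> 2 * (a\<^sup>2 + b\<^sup>2)" for a b :: real
          using zero_le_power2[of "a - b"] by (simp add: power2_eq_square algebra_simps)
        have "(\<delta> j)\<^sup>2 = (D1 T \<omega> + D2 T \<omega> * real (y j))\<^sup>2 / n"
          unfolding \<delta>_def power_divide by (simp add: s(2) power2_eq_square[of s])
        also have "\<dots> \<le> 2 * ((D1 T \<omega>)\<^sup>2 + (D2 T \<omega> * real (y j))\<^sup>2) / n"
          using n by (intro divide_right_mono sq) auto
        finally show "(\<delta> j)\<^sup>2 \<le> 2 * ((D1 T \<omega>)\<^sup>2 / n + (D2 T \<omega>)\<^sup>2 * ((real (y j))\<^sup>2 / n))"
          by (simp add: power_mult_distrib add_divide_distrib)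
        \<comment> \<open>One square is at most the sum of all of them, so the largest observation
          is controlled by \<open>A T\<close>; x \<le> 1 + x^2 avoids a square root in the
          bound.\<close>
        have "(real (y j))\<^sup>2 / n \<le> A T \<omega>"
          unfolding A_def n_def[symmetric] using n j
          by (intro divide_right_mono) (auto simp: y_def intro!: member_le_sum[of j "{..<T}" "\<lambda>j. (real (Y (int j + 1) \<omega>))\<^sup>2"])
        moreover have "(real (y j))\<^sup>2 / n = (real (y j) / s)\<^sup>2" by (simp add: power_divide power2_eq_square[of s] s(2))
        moreover have "real (y j) / s \<le> 1 + (real (y j) / s)\<^sup>2"
          using zero_le_power2[of "real (y j) / s - 1"] zero_le_power2[of "real (y j) / s"]
          unfolding power2_diff one_power2 mult_1_right by linarith
        ultimately have "real (y j) / s \<le> 1 + A T \<omega>" by linarith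
        then have "\<bar>D2 T \<omega>\<bar> * (real (y j) / s) \<le> \<bar>D2 T \<omega>\<bar> * (1 + A T \<omega>)" by (intro mult_left_mono) auto
        moreover have "\<bar>D1 T \<omega>\<bar> / s \<le> \<bar>D1 T \<omega>\<bar>"
        proof -
          have "1 \<le> s" using T by (simp add: s_def n_def)
          then show ?thesis using s by (simp add: divide_le_eq mult_le_cancel_left1)
        qed
        moreover have "\<bar>\<delta> j\<bar> \<le> \<bar>D1 T \<omega>\<bar> / s + \<bar>D2 T \<omega>\<bar> * (real (y j) / s)"
          unfolding \<delta>_def add_divide_distrib using s
          by (intro order_trans[OF abs_triangle_ineq]) (simp add: abs_mult)
        ultimately show "exp \<bar>\<delta> j\<bar> \<le> ?E" by simp
      qed (use n in \<open>auto intro!: mult_nonneg_nonneg add_nonneg_nonneg\<close>)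
      finally show ?thesis .
    qed
    have "\<bar>\<Sum>j<T. \<rho> j\<bar> \<le> (\<Sum>j<T. 2 * ((D1 T \<omega>)\<^sup>2 / n + (D2 T \<omega>)\<^sup>2 * ((real (y j))\<^sup>2 / n)) * ?E)"
      using \<rho>b by (intro order_trans[OF sum_abs] sum_mono) auto
    also have "\<dots> = 2 * (\<Sum>j<T. (D1 T \<omega>)\<^sup>2 / n + (D2 T \<omega>)\<^sup>2 * ((real (y j))\<^sup>2 / n)) * ?E"
      by (simp only: sum_distrib_left sum_distrib_right)
    also have "(\<Sum>j<T. (D1 T \<omega>)\<^sup>2 / n + (D2 T \<omega>)\<^sup>2 * ((real (y j))\<^sup>2 / n)) = (D1 T \<omega>)\<^sup>2 + (D2 T \<omega>)\<^sup>2 * A T \<omega>"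
      using n by (simp add: sum.distrib A_def n_def y_def sum_divide_distrib sum_distrib_left)
    finally have "\<bar>\<Sum>j<T. \<rho> j\<bar> / s \<le> (2 * ((D1 T \<omega>)\<^sup>2 + (D2 T \<omega>)\<^sup>2 * A T \<omega>) * ?E) / s"
      using s by (intro divide_right_mono) auto
    then show ?thesis using s by simp
  qed
  have split: "(2 * real q + 1) / s = real q / s + (real q + 1) / s" by (simp add: add_divide_distrib)
  have combine: "\<bar>(a - b - c - d - f) - (a' - b' - c' - d')\<bar> \<le> x1 + x2 + x3 + x4 + x5"
    if "\<bar>a - a'\<bar> \<le> x1" "\<bar>b - b'\<bar> \<le> x2" "\<bar>c - c'\<bar> \<le> x3" "\<bar>d - d'\<bar> \<le> x4" "\<bar>f\<bar> \<le> x5"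
    for a a' b b' c c' d d' f x1 x2 x3 x4 x5 :: real
    using that by linarith
  show ?thesis
    unfolding stat bar remainder_def n_def[symmetric] s_def[symmetric] split
    by (rule combine[OF b1 b2 b3 b4 b5])
qed

lemma stat_continuous: "continuous_on {0..1} (stat T \<omega>)"
  unfolding stat_def emp_pgf_def est_pgf_def by (intro continuous_intros)

lemma test_stat_eq: "test_stat est1 est2 w Y T \<omega> = weighted_sq w (stat T \<omega>)"
  unfolding test_stat_def weighted_sq_def stat_def by (simp add: power_mult_distrib mult.assoc)

text \<open>The statistic, integral included, is a function of the finite list of observations,
  which is discrete data.\<close>

lemma test_stat_meas: "test_stat est1 est2 w Y T \<in> borel_measurable M"
proof -
  have conv: "(\<Sum>t = 1..int T. f t) = sum_list (map f [1..int T])" for f :: "int \<Rightarrow> real"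
    by (simp add: interv_sum_list_conv_sum_set_int)
  let ?h = "\<lambda>xs u. (1 / real T) * sum_list (map (\<lambda>k. u ^ k) xs)"
  have emp: "emp_pgf Y T u \<omega> = ?h (obs Y T \<omega>) u" for u \<omega>
    unfolding emp_pgf_def obs_def conv by (simp add: comp_def)
  show ?thesis unfolding test_stat_def[abs_def] est_pgf_def emp
    by (rule obs_fun_meas[of "\<lambda>xs. real T * (LINT u|lebesgue_on {0..1}.
      (?h xs u - exp (est1 xs * (u - 1)) * ?h xs (exp (est2 xs * (u - 1))))\<^sup>2 * w u)"])
qed

lemma weighted_path: "(LINT u|lebesgue_on {0..1}. (calV_bar M Y q l1 l2 \<theta>1 \<theta>2 T u \<omega>)\<^sup>2 * w u) = weighted_sq w (proc_path T \<omega>)"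
  unfolding proc_path_def weighted_sq_restrict unfolding weighted_sq_def ..

text \<open>Parts (i) and (iii) share one limit: the functional \<open>I\<close> of the process
  converges to \<open>J\<close>, and the statistic differs from \<open>I\<close> by a term tending
  to 0 in probability. Part (ii) is the same convergence for arbitrary bounded continuous
  functionals.\<close>

theorem conclusion:
    "(\<exists>\<mu>. conv_in_dist_real M (test_stat est1 est2 w Y) \<mu> \<and>
          conv_in_dist_real M
            (\<lambda>T \<omega>. LINT u|lebesgue_on {0..1}. (calV_bar M Y q l1 l2 \<theta>1 \<theta>2 T u \<omega>)\<^sup>2 * w u) \<mu>) \<and>
     (\<exists>(N :: (real \<Rightarrow> real) measure) (V :: real \<Rightarrow> (real \<Rightarrow> real) \<Rightarrow> real).
        prob_space N \<and>
        gaussian_process N {0..1} V \<and>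
        (\<forall>u\<in>{0..1}. (\<integral>x. V u x \<partial>N) = 0) \<and>
        (\<forall>u1\<in>{0..1}. \<forall>u2\<in>{0..1}.
           integrable M (\<lambda>\<omega>. calV M Y q l1 l2 \<theta>1 \<theta>2 (int q + 1) u1 \<omega>
                            * calV M Y q l1 l2 \<theta>1 \<theta>2 (int q + 1) u2 \<omega>) \<and>
           (\<integral>x. V u1 x * V u2 x \<partial>N) =
             (\<integral>\<omega>. calV M Y q l1 l2 \<theta>1 \<theta>2 (int q + 1) u1 \<omega>
                 * calV M Y q l1 l2 \<theta>1 \<theta>2 (int q + 1) u2 \<omega> \<partial>M)) \<and>
        conv_in_dist_C01 M (calV_bar M Y q l1 l2 \<theta>1 \<theta>2) N V \<and>
        (\<lambda>x. LINT u|lebesgue_on {0..1}. (V u x)\<^sup>2 * w u) \<in> borel_measurable N \<and>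
        conv_in_dist_real M (test_stat est1 est2 w Y)
          (distr N borel (\<lambda>x. LINT u|lebesgue_on {0..1}. (V u x)\<^sup>2 * w u)))"
proof -
  obtain \<rho> C where "gaussian_series_limit M W (\<lambda>k \<omega>. inc k (sh (int q + 1) \<omega>)) phi envelope
    (1 + (\<integral>\<omega>. real (Y 1 \<omega>) \<partial>M)) C \<rho>" by (rule gaussian_series)
  then interpret GS: gaussian_series_limit M W "\<lambda>k \<omega>. inc k (sh (int q + 1) \<omega>)" phi envelope
    "1 + (\<integral>\<omega>. real (Y 1 \<omega>) \<partial>M)" C \<rho> .
  interpret N: prob_space gauss_space by (rule prob_space_gauss_space)
  let ?V = GS.V
  have target: "GS.target u = calV M Y q l1 l2 \<theta>1 \<theta>2 (int q + 1) u" for u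
    unfolding GS.target_def[abs_def] by (rule ext) (rule sums_unique[symmetric, OF phi_inc_sums])
  have cw: "continuous_map C01 euclideanreal (weighted_sq w)" by (rule weighted_sq_continuous[OF w_int w_nonneg])
  note wm = continuous_map_borel_of[OF cw]
  define I where "I T \<omega> = weighted_sq w (proc_path T \<omega>)" for T \<omega>
  define J where "J x = weighted_sq w (restrict (\<lambda>u. ?V u x) {0..1})" for x
  have J: "J x = (LINT u|lebesgue_on {0..1}. (?V u x)\<^sup>2 * w u)" for x
    unfolding J_def weighted_sq_restrict unfolding weighted_sq_def ..
  have Im [measurable]: "I T \<in> borel_measurable M" for T
    unfolding I_def by (rule measurable_compose[OF proc_path_meas wm])
  have Jm [measurable]: "J \<in> borel_measurable gauss_space"
    unfolding J_def by (rule measurable_compose[OF GS.path_V_meas wm])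
  have func: "(\<lambda>T. \<integral>\<omega>. F (proc_path T \<omega>) \<partial>M) \<longlonglongrightarrow> (\<integral>x. F (restrict (\<lambda>u. ?V u x) {0..1}) \<partial>gauss_space)"
    if "continuous_map C01 euclideanreal F" "\<And>f. f \<in> topspace C01 \<Longrightarrow> \<bar>F f\<bar> \<le> b" for F b
    by (rule GS.tendsto_functional[OF that proc_path_meas proc_path_eq_series])
  have convI: "conv_in_dist_real M I (distr gauss_space borel J)"
    unfolding conv_in_dist_real_def
  proof (intro conjI allI Im)
    show dJ: "real_distribution (distr gauss_space borel J)" by (rule N.real_distribution_distr) simp
    have dI: "real_distribution (distr M borel (I T))" for T by (rule real_distribution_distr) simp
    show "weak_conv_m (\<lambda>T. distr M borel (I T)) (distr gauss_space borel J)"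
    proof (rule integral_bdd_continuous_conv_imp_weak_conv[OF dI dJ])
      fix g :: "real \<Rightarrow> real" assume g: "\<And>x. isCont g x" "\<And>x. \<bar>g x\<bar> \<le> 1"
      have gc: "continuous_on UNIV g" using g(1) by (intro continuous_at_imp_continuous_on) auto
      then have [measurable]: "g \<in> borel_measurable borel" by (rule borel_measurable_continuous_onI)
      \<comment> \<open>\<open>weighted_sq w\<close> is unbounded on paths, so it enters only
        composed with a bounded test function.\<close>
      have "continuous_map C01 euclideanreal (g \<circ> weighted_sq w)"
        by (rule continuous_map_compose[OF cw]) (use gc in simp)
      from func[OF this, of 1] g(2)
      have "(\<lambda>T. \<integral>\<omega>. g (I T \<omega>) \<partial>M) \<longlonglongrightarrow> (\<integral>x. g (J x) \<partial>gauss_space)" by (simp add: I_def J_def)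
      then show "(\<lambda>T. integral\<^sup>L (distr M borel (I T)) g) \<longlonglongrightarrow> integral\<^sup>L (distr gauss_space borel J) g"
        by (simp add: integral_distr)
    qed
  qed
  have diff: "is_o_P_1 M (\<lambda>T \<omega>. test_stat est1 est2 w Y T \<omega> - I T \<omega>)"
    unfolding is_o_P_1_iff
  proof (intro allI impI)
    fix e d :: real assume e: "e > 0" and d: "d > 0"
    \<comment> \<open>With probability at least 1 - d/2 the coefficients lie in this box, where the
      path is bounded by b; the quadratic functional is then Lipschitz enough for
      \<open>remainder\<close> to control the difference.\<close>
    obtain R :: nat where R: "\<And>T. prob {\<omega> \<in> space M. W T \<omega> \<notin> geom_box \<rho> R} \<le> d / 2"
      by (rule GS.tightness[OF half_gt_zero[OF d]]) (rule that, assumption)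
    define b where "b = (1 + (\<integral>\<omega>. real (Y 1 \<omega>) \<partial>M)) * R / (1 - \<rho>)"
    have b: "0 \<le> b" unfolding b_def using GS.\<rho> GS.B_nonneg by simp
    let ?Iw = "LINT u|lebesgue_on {0..1}. w u"
    have Iw: "0 \<le> ?Iw" using w_nonneg by (intro integral_nonneg_AE AE_I2) auto
    \<comment> \<open>Solves \<open>\<eta> * (\<eta> + 2 * b) * ?Iw \<le> e\<close>, with the cap 1
      used to linearise the bracket.\<close>
    define \<eta> where "\<eta> = min 1 (e / ((1 + 2 * b) * (?Iw + 1)))"
    have \<eta>: "0 < \<eta>" "\<eta> \<le> 1" using e b Iw by (auto simp: \<eta>_def intro!: divide_pos_pos mult_pos_pos)
    have \<eta>e: "\<eta> * (\<eta> + 2 * b) * ?Iw \<le> e"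
    proof -
      have "\<eta> * (\<eta> + 2 * b) * ?Iw \<le> \<eta> * (1 + 2 * b) * (?Iw + 1)"
        using \<eta> b Iw by (intro mult_mono mult_left_mono) auto
      also have "\<dots> \<le> (e / ((1 + 2 * b) * (?Iw + 1))) * (1 + 2 * b) * (?Iw + 1)"
        using b Iw by (intro mult_right_mono) (auto simp: \<eta>_def)
      also have "\<dots> = e"
      proof -
        have eq: "e / (x * z) * x * z = e" if "x \<noteq> 0" "z \<noteq> 0" for x z :: real using that by simp
        show ?thesis by (rule eq) (use b Iw in auto)
      qed
      finally show ?thesis .
    qed
    have "\<forall>\<^sub>F T in sequentially. prob {\<omega> \<in> space M. \<bar>remainder T \<omega>\<bar> > \<eta>} \<le> d / 2"
      using remainder_o_P[unfolded is_o_P_1_iff, rule_format, OF \<eta>(1) half_gt_zero[OF d]] .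
    then show "\<forall>\<^sub>F T in sequentially. prob {\<omega> \<in> space M. \<bar>test_stat est1 est2 w Y T \<omega> - I T \<omega>\<bar> > e} \<le> d"
      using eventually_ge_at_top[of 1]
    proof eventually_elim
      fix T :: nat assume rem: "prob {\<omega> \<in> space M. \<bar>remainder T \<omega>\<bar> > \<eta>} \<le> d / 2" and T: "1 \<le> T"
      have Wm [measurable]: "W T \<in> borel_measurable M"
        by (rule measurable_coordinatewise_then_product) simp
      have small: "\<bar>test_stat est1 est2 w Y T \<omega> - I T \<omega>\<bar> \<le> e"
        if r: "\<bar>remainder T \<omega>\<bar> \<le> \<eta>" and box: "W T \<omega> \<in> geom_box \<rho> R" for \<omega>
      proof -
        have pc: "continuous_on {0..1} (proc_path T \<omega>)"
          using series_path_in_C01[where \<phi> = phi, OF phi_cont phi_bound GS.\<rho> box]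
          unfolding proc_path_eq_series topspace_C01 by simp
        have "\<bar>test_stat est1 est2 w Y T \<omega> - I T \<omega>\<bar> \<le> \<eta> * (\<eta> + 2 * b) * ?Iw"
          unfolding test_stat_eq I_def
        proof (rule weighted_sq_diff[OF w_int w_nonneg stat_continuous pc])
          fix u :: real assume u: "u \<in> {0..1}"
          show "\<bar>stat T \<omega> u - proc_path T \<omega> u\<bar> \<le> \<eta>"
            using stat_expansion[OF T u, of \<omega>] r u by (simp add: proc_path_def)
          show "\<bar>proc_path T \<omega> u\<bar> \<le> b"
            unfolding proc_path_eq_series b_def series_path_def
            using series_path_bound[where \<phi> = phi, OF phi_cont phi_bound GS.\<rho> box u] u by simp
        qed auto
        with \<eta>e show ?thesis by simp
      qed
      have "prob {\<omega> \<in> space M. \<bar>test_stat est1 est2 w Y T \<omega> - I T \<omega>\<bar> > e}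
         \<le> prob ({\<omega> \<in> space M. \<bar>remainder T \<omega>\<bar> > \<eta>} \<union> {\<omega> \<in> space M. W T \<omega> \<notin> geom_box \<rho> R})"
        using small by (intro finite_measure_mono) (auto simp: not_le[symmetric])
      also have "\<dots> \<le> prob {\<omega> \<in> space M. \<bar>remainder T \<omega>\<bar> > \<eta>} + prob {\<omega> \<in> space M. W T \<omega> \<notin> geom_box \<rho> R}"
        by (intro measure_Un_le) auto
      also have "\<dots> \<le> d" using rem R[of T] by simp
      finally show "prob {\<omega> \<in> space M. \<bar>test_stat est1 est2 w Y T \<omega> - I T \<omega>\<bar> > e} \<le> d" .
    qed
  qed
  have convS: "conv_in_dist_real M (test_stat est1 est2 w Y) (distr gauss_space borel J)"
    by (rule slutsky[OF prob_space_axioms convI test_stat_meas diff])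
  have "conv_in_dist_C01 M (calV_bar M Y q l1 l2 \<theta>1 \<theta>2) gauss_space ?V"
    unfolding conv_in_dist_C01_def conv_in_dist_top_def proc_path_def[symmetric]
  proof (intro conjI allI impI proc_path_meas GS.path_V_meas)
    fix F :: "(real \<Rightarrow> real) \<Rightarrow> real"
    assume F: "continuous_map C01 euclideanreal F \<and> bounded (F ` topspace C01)"
    then obtain b where "\<And>f. f \<in> topspace C01 \<Longrightarrow> \<bar>F f\<bar> \<le> b" by (auto simp: bounded_iff)
    with F show "(\<lambda>T. \<integral>\<omega>. F (proc_path T \<omega>) \<partial>M) \<longlonglongrightarrow> (\<integral>x. F (restrict (\<lambda>u. ?V u x) {0..1}) \<partial>gauss_space)"
      by (intro func) auto
  qed
  moreover have "integrable M (\<lambda>\<omega>. calV M Y q l1 l2 \<theta>1 \<theta>2 (int q + 1) u1 \<omega> * calV M Y q l1 l2 \<theta>1 \<theta>2 (int q + 1) u2 \<omega>)"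
    "(\<integral>x. ?V u1 x * ?V u2 x \<partial>gauss_space) =
       (\<integral>\<omega>. calV M Y q l1 l2 \<theta>1 \<theta>2 (int q + 1) u1 \<omega> * calV M Y q l1 l2 \<theta>1 \<theta>2 (int q + 1) u2 \<omega> \<partial>M)"
    if "u1 \<in> {0..1}" "u2 \<in> {0..1}" for u1 u2
    using GS.target_mult[OF that] GS.V_cov[OF that] unfolding target by auto
  ultimately show ?thesis
    using convS convI Jm prob_space_gauss_space GS.gaussian_process_V GS.V_mean
    unfolding I_def weighted_path[symmetric] J by blast
qed

end

text \<open>The factor 1 + f is at least 1 and M has total mass 1, so the double integral dominates
  the integral of w over [0,1].\<close>

lemma integrable_weight:
  fixes w :: "real \<Rightarrow> real" and f :: "'a \<Rightarrow> real \<Rightarrow> real"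
  assumes M: "prob_space M" and w: "w \<in> borel_measurable (lebesgue_on {0..1})"
    and f: "\<And>\<omega> u. 0 \<le> f \<omega> u" and w0: "\<And>u. u \<in> {0..1} \<Longrightarrow> 0 \<le> w u"
    and fin: "(\<integral>\<^sup>+\<omega>. (\<integral>\<^sup>+u. ennreal ((1 + f \<omega> u) * w u) \<partial>lebesgue_on {0..1}) \<partial>M) < \<infinity>"
  shows "integrable (lebesgue_on {0..1}) w"
proof -
  interpret prob_space M by fact
  have "(\<integral>\<^sup>+u. ennreal (norm (w u)) \<partial>lebesgue_on {0..1})
     = (\<integral>\<^sup>+\<omega>. (\<integral>\<^sup>+u. ennreal (norm (w u)) \<partial>lebesgue_on {0..1}) \<partial>M)"
    by (simp add: emeasure_space_1)
  also have "\<dots> \<le> (\<integral>\<^sup>+\<omega>. (\<integral>\<^sup>+u. ennreal ((1 + f \<omega> u) * w u) \<partial>lebesgue_on {0..1}) \<partial>M)"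
  proof (intro nn_integral_mono ennreal_leI)
    fix \<omega> and u :: real assume "u \<in> space (lebesgue_on {0..1})"
    then have "0 \<le> w u" using w0 by simp
    then show "norm (w u) \<le> (1 + f \<omega> u) * w u" using f[of \<omega> u] by (simp add: distrib_right)
  qed
  also note fin
  finally show ?thesis using w by (intro integrableI_bounded)
qed

theorem theorem4p4:
  fixes M :: "'a measure"
    and Y :: "int \<Rightarrow> 'a \<Rightarrow> nat"
    and \<theta>1 \<theta>2 :: real
    and q :: nat
    and est1 est2 :: "nat list \<Rightarrow> real"
    and l1 l2 :: "nat list \<Rightarrow> real \<Rightarrow> real \<Rightarrow> real"
    and w :: "real \<Rightarrow> real"
  assumes "prob_space M"
    and "\<theta>1 > 0" and "0 \<le> \<theta>2" and "\<theta>2 < 1"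
    and "poisson_inarch1 M Y \<theta>1 \<theta>2"
    and "strictly_stationary M Y"
    and "ergodic_process M Y"
    and "q \<ge> 1"
    and "asymp_linear M Y q est1 \<theta>1 (\<lambda>t \<omega>. l1 (lag_vec Y q t \<omega>) \<theta>1 \<theta>2)"
    and "asymp_linear M Y q est2 \<theta>2 (\<lambda>t \<omega>. l2 (lag_vec Y q t \<omega>) \<theta>1 \<theta>2)"
    and "martingale_difference_from M (past M Y) (int q + 1)
           (\<lambda>t \<omega>. l1 (lag_vec Y q t \<omega>) \<theta>1 \<theta>2)"
    and "martingale_difference_from M (past M Y) (int q + 1)
           (\<lambda>t \<omega>. l2 (lag_vec Y q t \<omega>) \<theta>1 \<theta>2)"
    and "\<And>t. t \<ge> int q + 1 \<Longrightarrow> integrable M (\<lambda>\<omega>. (l1 (lag_vec Y q t \<omega>) \<theta>1 \<theta>2)\<^sup>2)"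
    and "\<And>t. t \<ge> int q + 1 \<Longrightarrow> integrable M (\<lambda>\<omega>. (l2 (lag_vec Y q t \<omega>) \<theta>1 \<theta>2)\<^sup>2)"
    and "w \<in> borel_measurable (lebesgue_on {0..1})"
    and "\<And>u. u \<in> {0..1} \<Longrightarrow> w u \<ge> 0"
    and "(\<integral>\<^sup>+\<omega>. (\<integral>\<^sup>+u. ennreal ((1 + exp (2 * (\<theta>1 + \<theta>2 * real (Y 1 \<omega>)) * (u - 1))
              * (1 + real (Y 1 \<omega>) ^ 4)) * w u) \<partial>lebesgue_on {0..1}) \<partial>M) < \<infinity>"
  shows
    "(\<exists>\<mu>. conv_in_dist_real M (test_stat est1 est2 w Y) \<mu> \<and>
          conv_in_dist_real M
            (\<lambda>T \<omega>. LINT u|lebesgue_on {0..1}. (calV_bar M Y q l1 l2 \<theta>1 \<theta>2 T u \<omega>)\<^sup>2 * w u) \<mu>) \<and>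
     (\<exists>(N :: (real \<Rightarrow> real) measure) (V :: real \<Rightarrow> (real \<Rightarrow> real) \<Rightarrow> real).
        prob_space N \<and>
        gaussian_process N {0..1} V \<and>
        (\<forall>u\<in>{0..1}. (\<integral>x. V u x \<partial>N) = 0) \<and>
        (\<forall>u1\<in>{0..1}. \<forall>u2\<in>{0..1}.
           integrable M (\<lambda>\<omega>. calV M Y q l1 l2 \<theta>1 \<theta>2 (int q + 1) u1 \<omega>
                            * calV M Y q l1 l2 \<theta>1 \<theta>2 (int q + 1) u2 \<omega>) \<and>
           (\<integral>x. V u1 x * V u2 x \<partial>N) =
             (\<integral>\<omega>. calV M Y q l1 l2 \<theta>1 \<theta>2 (int q + 1) u1 \<omega>
                 * calV M Y q l1 l2 \<theta>1 \<theta>2 (int q + 1) u2 \<omega> \<partial>M)) \<and>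
        conv_in_dist_C01 M (calV_bar M Y q l1 l2 \<theta>1 \<theta>2) N V \<and>
        (\<lambda>x. LINT u|lebesgue_on {0..1}. (V u x)\<^sup>2 * w u) \<in> borel_measurable N \<and>
        conv_in_dist_real M (test_stat est1 est2 w Y)
          (distr N borel (\<lambda>x. LINT u|lebesgue_on {0..1}. (V u x)\<^sup>2 * w u)))"
proof -
  have w_int: "integrable (lebesgue_on {0..1}) w"
    by (rule integrable_weight[where M = M and f = "\<lambda>\<omega> u. exp (2 * (\<theta>1 + \<theta>2 * real (Y 1 \<omega>)) * (u - 1)) * (1 + real (Y 1 \<omega>) ^ 4)"])
       (use assms in auto)
  interpret prob_space M by fact
  interpret inarch_test M Y \<theta>1 \<theta>2 q l1 l2 est1 est2 w
    by unfold_locales (use assms w_int in auto)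
  show ?thesis by (rule conclusion)
qed

end
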